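(* Let $T>0$, $x\in\mathbb{R}$, and let $W$ be a one-dimensional standard Brownian motion. Consider the stochastic differential equation $$dX^x_t=b(t,X^x_t)\,dt+\sigma(t,X^x_t)\,dW_t,\quad t\in[0,T],\qquad X^x_0=x,$$ where $b:[0,T]\times\mathbb{R}\to\mathbb{R}$ is continuous and Lipschitz continuous in its second variable uniformly in $t\in[0,T]$, and $\sigma:[0,T]\times\mathbb{R}\to\mathbb{R}$ is continuous with linear growth in its second variable uniformly in $t\in[0,T]$ and satisfies $$\forall\,y,z\in\mathbb{R},\ \forall\,t\in[0,T],\quad|\sigma(t,y)-\sigma(t,z)|\le\rho(|y-z|),$$ where $\rho:\mathbb{R}\to\mathbb{R}$ is increasing, $\rho(0)=0$ and $\int_{0+}\frac{du}{\rho^2(u)}=+\infty$. Then the (unique strong) solution $X^x=(X^x_t)_{t\in[0,T]}$ satisfies a functional co-monotony principle on $\mathcal{C}([0,T],\mathbb{R})$.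
   Context: $\mathcal{C}([0,T],\mathbb{R})$ is equipped with the sup-norm, its Borel $\sigma$-field, and the pointwise order: $\alpha\le\beta$ if $\alpha(t)\le\beta(t)$ for all $t\in[0,T]$. Two measurable functionals $F,G$ on this space are co-monotone if they are both non-decreasing or both non-increasing for this order. $F$ is $\mathbb{P}_X$-a.s. continuous if it is sup-norm continuous at every point of a set of probability $1$ under the distribution $\mathbb{P}_X$ of $X$. A continuous process $X$ satisfies a functional co-monotony principle on $\mathcal{C}([0,T],\mathbb{R})$ if, for every pair of bounded, co-monotone, $\mathbb{P}_X$-a.s. continuous, measurable functionals $F,G:\mathcal{C}([0,T],\mathbb{R})\to\mathbb{R}$, $\mathbb{E}\,F(X)G(X)\ge\mathbb{E}\,F(X)\,\mathbb{E}\,G(X)$. *)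

theory Defs
  imports "HOL-Probability.Probability"
begin

section \<open>The path space and functional co-monotony\<close>

text \<open>Paths are functions on the reals that are extensional on \<open>{0..T}\<close>; the metric of
  \<^const>\<open>cfunspace\<close> is the supremum distance.\<close>

definition path_metric :: "real \<Rightarrow> (real \<Rightarrow> real) metric" where
  "path_metric T = cfunspace (top_of_set {0..T}) euclidean_metric"

definition path_borel :: "real \<Rightarrow> (real \<Rightarrow> real) measure" where
  "path_borel T = sigma (mspace (path_metric T)) {U. openin (mtopology_of (path_metric T)) U}"

lemma mspace_path_metric:
  "mspace (path_metric T) = {\<alpha> \<in> extensional {0..T}. continuous_on {0..T} \<alpha>}"
proof -
  have "bounded (\<alpha> ` {0..T})" if "continuous_on {0..T} \<alpha>" for \<alpha> :: "real \<Rightarrow> real"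
    using that compact_continuous_image[of "{0..T}" \<alpha>] compact_imp_bounded by blast
  then show ?thesis
    by (auto simp: path_metric_def)
qed

lemma space_path_borel: "space (path_borel T) = mspace (path_metric T)"
  unfolding path_borel_def
  by (subst space_measure_of) (use openin_subset in force)+

definition path_of :: "real \<Rightarrow> (real \<Rightarrow> 'a \<Rightarrow> real) \<Rightarrow> 'a \<Rightarrow> real \<Rightarrow> real" where
  "path_of T X \<omega> = restrict (\<lambda>t. X t \<omega>) {0..T}"

definition path_law :: "'a measure \<Rightarrow> real \<Rightarrow> (real \<Rightarrow> 'a \<Rightarrow> real) \<Rightarrow> (real \<Rightarrow> real) measure" where
  "path_law M T X = distr M (path_borel T) (path_of T X)"

definition path_le :: "real \<Rightarrow> (real \<Rightarrow> real) \<Rightarrow> (real \<Rightarrow> real) \<Rightarrow> bool" where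
  "path_le T \<alpha> \<beta> \<longleftrightarrow> (\<forall>t\<in>{0..T}. \<alpha> t \<le> \<beta> t)"

definition co_monotone :: "real \<Rightarrow> ((real \<Rightarrow> real) \<Rightarrow> real) \<Rightarrow> ((real \<Rightarrow> real) \<Rightarrow> real) \<Rightarrow> bool" where
  "co_monotone T F G \<longleftrightarrow>
     (monotone_on (mspace (path_metric T)) (path_le T) (\<le>) F \<and>
      monotone_on (mspace (path_metric T)) (path_le T) (\<le>) G) \<or>
     (monotone_on (mspace (path_metric T)) (path_le T) (\<ge>) F \<and>
      monotone_on (mspace (path_metric T)) (path_le T) (\<ge>) G)"

definition as_continuous :: "real \<Rightarrow> (real \<Rightarrow> real) measure \<Rightarrow> ((real \<Rightarrow> real) \<Rightarrow> real) \<Rightarrow> bool" where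
  "as_continuous T P F \<longleftrightarrow>
     (AE \<alpha> in P. topcontinuous_at (mtopology_of (path_metric T)) euclideanreal F \<alpha>)"

definition admissible_functional ::
    "real \<Rightarrow> (real \<Rightarrow> real) measure \<Rightarrow> ((real \<Rightarrow> real) \<Rightarrow> real) \<Rightarrow> bool" where
  "admissible_functional T P F \<longleftrightarrow>
     F \<in> borel_measurable (path_borel T) \<and> bounded (F ` mspace (path_metric T)) \<and>
     as_continuous T P F"

definition functional_co_monotony :: "'a measure \<Rightarrow> real \<Rightarrow> (real \<Rightarrow> 'a \<Rightarrow> real) \<Rightarrow> bool" where
  "functional_co_monotony M T X \<longleftrightarrow>
     (\<forall>F G. admissible_functional T (path_law M T X) F \<and>
            admissible_functional T (path_law M T X) G \<and> co_monotone T F G \<longrightarrow>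
        (\<integral>\<omega>. F (path_of T X \<omega>) * G (path_of T X \<omega>) \<partial>M)
          \<ge> (\<integral>\<omega>. F (path_of T X \<omega>) \<partial>M) * (\<integral>\<omega>. G (path_of T X \<omega>) \<partial>M))"

section \<open>Brownian motion and the Ito integral on a finite horizon\<close>

definition continuous_process :: "'a measure \<Rightarrow> real \<Rightarrow> (real \<Rightarrow> 'a \<Rightarrow> real) \<Rightarrow> bool" where
  "continuous_process M T X \<longleftrightarrow>
     (\<forall>t\<in>{0..T}. X t \<in> borel_measurable M) \<and>
     (\<forall>\<omega>\<in>space M. continuous_on {0..T} (\<lambda>t. X t \<omega>))"

definition standard_brownian_motion :: "'a measure \<Rightarrow> real \<Rightarrow> (real \<Rightarrow> 'a \<Rightarrow> real) \<Rightarrow> bool" where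
  "standard_brownian_motion M T W \<longleftrightarrow>
     continuous_process M T W \<and>
     (AE \<omega> in M. W 0 \<omega> = 0) \<and>
     (\<forall>s t. 0 \<le> s \<and> s < t \<and> t \<le> T \<longrightarrow>
        distributed M lborel (\<lambda>\<omega>. W t \<omega> - W s \<omega>) (normal_density 0 (sqrt (t - s)))) \<and>
     (\<forall>(n::nat) \<tau>. (\<forall>i\<le>n. \<tau> i \<in> {0..T}) \<and> (\<forall>i<n. \<tau> i \<le> \<tau> (Suc i)) \<longrightarrow>
        prob_space.indep_vars M (\<lambda>_. borel) (\<lambda>i \<omega>. W (\<tau> (Suc i)) \<omega> - W (\<tau> i) \<omega>) {..<n})"

text \<open>The natural filtration of \<open>W\<close> augmented by the null sets of \<open>M\<close>.  The measure attached to
  each \<open>\<sigma>\<close>-field is irrelevant, as for the library's \<^locale>\<open>filtration\<close>.\<close>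

definition brownian_filtration :: "'a measure \<Rightarrow> (real \<Rightarrow> 'a \<Rightarrow> real) \<Rightarrow> real \<Rightarrow> 'a measure" where
  "brownian_filtration M W t =
     sigma (space M)
       ({W s -` B \<inter> space M | s B. 0 \<le> s \<and> s \<le> t \<and> B \<in> sets borel} \<union> null_sets M)"

definition adapted :: "(real \<Rightarrow> 'a measure) \<Rightarrow> real \<Rightarrow> (real \<Rightarrow> 'a \<Rightarrow> real) \<Rightarrow> bool" where
  "adapted \<F> T X \<longleftrightarrow> (\<forall>t\<in>{0..T}. X t \<in> borel_measurable (\<F> t))"

definition progressive :: "(real \<Rightarrow> 'a measure) \<Rightarrow> real \<Rightarrow> (real \<Rightarrow> 'a \<Rightarrow> real) \<Rightarrow> bool" where
  "progressive \<F> T H \<longleftrightarrow>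
     (\<forall>t\<in>{0..T}. (\<lambda>(s, \<omega>). H s \<omega>)
        \<in> borel_measurable (restrict_space borel {0..t} \<Otimes>\<^sub>M \<F> t))"

text \<open>A simple integrand is given by times \<open>\<tau> 0 \<le> \<dots> \<le> \<tau> n\<close> in \<open>{0..T}\<close> and bounded
  \<open>\<F> (\<tau> i)\<close>-measurable weights \<open>\<xi> i\<close> on the intervals \<open>{\<tau> i<..\<tau> (Suc i)}\<close>.\<close>

type_synonym 'a simple_integrand = "nat \<times> (nat \<Rightarrow> real) \<times> (nat \<Rightarrow> 'a \<Rightarrow> real)"

definition simple_integrand ::
    "'a measure \<Rightarrow> (real \<Rightarrow> 'a measure) \<Rightarrow> real \<Rightarrow> 'a simple_integrand \<Rightarrow> bool" where
  "simple_integrand M \<F> T = (\<lambda>(n, \<tau>, \<xi>).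
     (\<forall>i\<le>n. \<tau> i \<in> {0..T}) \<and> (\<forall>i<n. \<tau> i \<le> \<tau> (Suc i)) \<and>
     (\<forall>i<n. \<xi> i \<in> borel_measurable (\<F> (\<tau> i)) \<and> bounded (\<xi> i ` space M)))"

definition simple_process :: "'a simple_integrand \<Rightarrow> real \<Rightarrow> 'a \<Rightarrow> real" where
  "simple_process = (\<lambda>(n, \<tau>, \<xi>) t \<omega>.
     \<Sum>i<n. \<xi> i \<omega> * indicator {\<tau> i<..\<tau> (Suc i)} t)"

definition simple_integral ::
    "(real \<Rightarrow> 'a \<Rightarrow> real) \<Rightarrow> 'a simple_integrand \<Rightarrow> real \<Rightarrow> 'a \<Rightarrow> real" where
  "simple_integral W = (\<lambda>(n, \<tau>, \<xi>) t \<omega>.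
     \<Sum>i<n. \<xi> i \<omega> * (W (min (\<tau> (Suc i)) t) \<omega> - W (min (\<tau> i) t) \<omega>))"

definition null_in_probability :: "'a measure \<Rightarrow> (nat \<Rightarrow> 'a \<Rightarrow> ennreal) \<Rightarrow> bool" where
  "null_in_probability M Y \<longleftrightarrow>
     (\<forall>k. Y k \<in> borel_measurable M) \<and>
     (\<forall>\<epsilon>>0. (\<lambda>k. measure M {\<omega> \<in> space M. Y k \<omega> > ennreal \<epsilon>}) \<longlonglongrightarrow> 0)"

text \<open>\<open>I\<close> is (a continuous version of) the process \<open>t \<mapsto> \<integral>\<^sub>0\<^sup>t H dW\<close>, \<open>t \<in> {0..T}\<close>, for a progressive
  \<open>H\<close> with almost surely square integrable paths: the limit, uniformly on \<open>{0..T}\<close> in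
  probability, of the integrals of simple integrands that approximate \<open>H\<close> in \<open>L\<^sup>2(0, T)\<close> in
  probability.  It is determined up to indistinguishability.\<close>

definition ito_integral ::
    "'a measure \<Rightarrow> (real \<Rightarrow> 'a measure) \<Rightarrow> real \<Rightarrow> (real \<Rightarrow> 'a \<Rightarrow> real) \<Rightarrow>
     (real \<Rightarrow> 'a \<Rightarrow> real) \<Rightarrow> (real \<Rightarrow> 'a \<Rightarrow> real) \<Rightarrow> bool" where
  "ito_integral M \<F> T W H I \<longleftrightarrow>
     progressive \<F> T H \<and>
     (AE \<omega> in M. (\<integral>\<^sup>+s\<in>{0..T}. ennreal ((H s \<omega>)\<^sup>2) \<partial>lborel) < \<infinity>) \<and>
     continuous_process M T I \<and> adapted \<F> T I \<and>
     (\<exists>S. (\<forall>k. simple_integrand M \<F> T (S k)) \<and>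
        null_in_probability M
          (\<lambda>k \<omega>. \<integral>\<^sup>+s\<in>{0..T}. ennreal ((simple_process (S k) s \<omega> - H s \<omega>)\<^sup>2) \<partial>lborel) \<and>
        null_in_probability M
          (\<lambda>k \<omega>. SUP t\<in>{0..T}. ennreal \<bar>simple_integral W (S k) t \<omega> - I t \<omega>\<bar>))"

section \<open>Stochastic differential equations\<close>

definition sde_solution ::
    "'a measure \<Rightarrow> (real \<Rightarrow> 'a measure) \<Rightarrow> real \<Rightarrow> (real \<Rightarrow> 'a \<Rightarrow> real) \<Rightarrow>
     (real \<Rightarrow> real \<Rightarrow> real) \<Rightarrow> (real \<Rightarrow> real \<Rightarrow> real) \<Rightarrow> real \<Rightarrow> (real \<Rightarrow> 'a \<Rightarrow> real) \<Rightarrow> bool" where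
  "sde_solution M \<F> T W b \<sigma> x X \<longleftrightarrow>
     continuous_process M T X \<and> adapted \<F> T X \<and>
     (AE \<omega> in M. set_integrable lborel {0..T} (\<lambda>s. b s (X s \<omega>))) \<and>
     (\<exists>I. ito_integral M \<F> T W (\<lambda>s \<omega>. \<sigma> s (X s \<omega>)) I \<and>
        (AE \<omega> in M. \<forall>t\<in>{0..T}. X t \<omega> = x + (LBINT s:{0..t}. b s (X s \<omega>)) + I t \<omega>))"

definition strong_solution ::
    "'a measure \<Rightarrow> real \<Rightarrow> (real \<Rightarrow> 'a \<Rightarrow> real) \<Rightarrow>
     (real \<Rightarrow> real \<Rightarrow> real) \<Rightarrow> (real \<Rightarrow> real \<Rightarrow> real) \<Rightarrow> real \<Rightarrow> (real \<Rightarrow> 'a \<Rightarrow> real) \<Rightarrow> bool" where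
  "strong_solution M T W b \<sigma> x X \<longleftrightarrow> sde_solution M (brownian_filtration M W) T W b \<sigma> x X"

end

(*
  The solution is approximated by an Euler scheme that is monotone in its current state: the
  coefficients are frozen outside a ball, the diffusion coefficient is replaced by its Lipschitz
  inf-convolution, and the Brownian increments are truncated.  For such a chain the covariance
  inequality follows by induction over time from Chebyshev's association inequality, because
  conditionally on the past the functionals depend monotonically on a single real variable.

  The scheme converges to the solution in probability at fixed times, by a discrete version of the
  Yamada-Watanabe argument: both are driven by the same increments, and a smoothed absolute value of
  their difference is estimated step by step, with a Taylor expansion in place of Ito's formula.
  Stochastic integration enters only through the convergence of the Riemann sums of the Ito
  integral at fixed times.  Linear interpolation on a coarse grid and Borel-Cantelli then give
  almost sure uniform convergence of monotone images of the chain, and the inequality passes to the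
  limit at almost sure continuity points of the functionals.
*)

theory Submission
  imports Defs
begin

section \<open>The Yamada--Watanabe function\<close>

text \<open>An ordinary Euler step is not monotone in its state: \<open>\<sigma>\<close> is
  controlled only by \<open>\<rho>\<close>, and a Gaussian increment is unbounded. The repair is a
  Lipschitz constant \<open>\<Lambda>\<close> and a truncation level \<open>c\<close> with
  \<open>\<Lambda> * c \<le> 1 / 2\<close>, both fixed while the step \<open>h\<close> tends to
  zero. Truncating at a fixed level is cheap: the expected excess is of order
  \<open>h\<^sup>2\<close> per step, hence of order \<open>h\<close> in total. The comparison must
  be in mean and not in mean square, since the Osgood condition controls just the second-order term
  of a smoothed absolute value. For an exact recursion the chain is compared with the Euler sum
  along the path of \<open>X\<close>. That sum is close to \<open>X\<close> only in probability, so
  the coefficients are compared at displaced points, with errors that are bounded and small in mean.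
  The order of the choices carries the argument: the ball and the smoothing come first, as the
  Lipschitz constant \<open>K\<close> of the slope depends on them, then the tolerances that
  multiply \<open>K\<close>, then \<open>\<Lambda>\<close> and \<open>c\<close>, and the number of
  steps last.\<close>

lemma osgood_tail_ge:
  fixes r :: "real \<Rightarrow> real"
  assumes [measurable]: "r \<in> borel_measurable borel"
    and inf: "(\<integral>\<^sup>+u\<in>{0<..<\<eta>}. ennreal (r u) \<partial>lborel) = \<infinity>"
  shows "\<exists>\<delta>>0. \<delta> < \<eta> \<and> ennreal c \<le> (\<integral>\<^sup>+u\<in>{\<delta>..\<eta>}. ennreal (r u) \<partial>lborel)"
proof -
  have \<eta>: "\<eta> > 0"
  proof (rule ccontr)
    assume "\<not> \<eta> > 0"
    then have "{0<..<\<eta>} = {}" by auto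
    then show False using inf by simp
  qed
  \<comment> \<open>By monotone convergence the truncated integrals increase to at least the
    infinite one. The \<open>+ 2\<close> puts the lower endpoint strictly below
    \<open>\<eta>\<close> already for \<open>n = 0\<close>.\<close>
  let ?f = "\<lambda>n u. ennreal (r u) * indicator {\<eta> / (real n + 2)..\<eta>} u"
  have anti: "\<eta> / (real n + 2) \<le> \<eta> / (real m + 2)" if "m \<le> n" for m n
    using that \<eta> by (intro divide_left_mono) auto
  have "(SUP n. \<integral>\<^sup>+u. ?f n u \<partial>lborel) = (\<integral>\<^sup>+u. (SUP n. ?f n u) \<partial>lborel)"
    by (rule nn_integral_monotone_convergence_SUP[symmetric])
      (auto simp: incseq_def le_fun_def indicator_def intro: order_trans[OF anti])
  also have "\<dots> \<ge> (\<integral>\<^sup>+u\<in>{0<..<\<eta>}. ennreal (r u) \<partial>lborel)"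
  proof (rule nn_integral_mono)
    fix u
    show "ennreal (r u) * indicator {0<..<\<eta>} u \<le> (SUP n. ?f n u)"
    proof (cases "u \<in> {0<..<\<eta>}")
      case True
      obtain n :: nat where "\<eta> / u < real n" using reals_Archimedean2 by blast
      then have "\<eta> / (real n + 2) \<le> u" using True by (simp add: field_simps)
      then have "ennreal (r u) * indicator {0<..<\<eta>} u \<le> ?f n u" using True by simp
      then show ?thesis by (rule order_trans) (rule SUP_upper, simp)
    qed simp
  qed
  finally have eq: "(SUP n. \<integral>\<^sup>+u. ?f n u \<partial>lborel) = \<infinity>" using inf by (simp add: top_unique)
  have "ennreal c < (SUP n. \<integral>\<^sup>+u. ?f n u \<partial>lborel)" unfolding eq by simp
  then obtain n where "ennreal c < (\<integral>\<^sup>+u. ?f n u \<partial>lborel)" unfolding less_SUP_iff by blast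
  then show ?thesis using \<eta>
    by (intro exI[of _ "\<eta> / (real n + 2)"]) (auto simp: field_simps add_pos_nonneg)
qed

text \<open>No continuity of \<open>\<rho>\<close> is assumed, but a jump at zero would bound
  \<open>1 / (\<rho> u)\<^sup>2\<close> near zero and make its integral finite.\<close>

lemma osgood_small:
  fixes \<rho> :: "real \<Rightarrow> real"
  assumes \<rho>: "strict_mono \<rho>" "\<rho> 0 = 0"
    and osgood: "\<forall>\<epsilon>>0. (\<integral>\<^sup>+u\<in>{0<..<\<epsilon>}. ennreal (1 / (\<rho> u)\<^sup>2) \<partial>lborel) = \<infinity>"
    and "e > 0"
  shows "\<exists>\<delta>>0. \<rho> \<delta> < e"
proof (rule ccontr)
  assume "\<not> (\<exists>\<delta>>0. \<rho> \<delta> < e)"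
  then have ge: "e \<le> \<rho> u" if "u > 0" for u using that by force
  have "(\<integral>\<^sup>+u\<in>{0<..<1}. ennreal (1 / (\<rho> u)\<^sup>2) \<partial>lborel) \<le> (\<integral>\<^sup>+u\<in>{0<..<1::real}. ennreal (1 / e\<^sup>2) \<partial>lborel)"
  proof (rule nn_integral_mono)
    fix u :: real
    show "ennreal (1 / (\<rho> u)\<^sup>2) * indicator {0<..<1} u \<le> ennreal (1 / e\<^sup>2) * indicator {0<..<1} u"
      using ge[of u] \<open>e > 0\<close>
      by (cases "u \<in> {0<..<1}") (auto intro!: ennreal_leI divide_left_mono power_mono mult_pos_pos)
  qed
  also have "\<dots> < \<infinity>" by (subst nn_integral_cmult_indicator) (auto simp: ennreal_mult_less_top)
  finally show False using osgood[rule_format, of 1] by simp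
qed

text \<open>Up to \<open>\<eta>\<close> it is enough that \<open>f\<close> is nonnegative; beyond,
  \<open>f u - u\<close> no longer decreases. This is the price \<open>\<eta>\<close> for smoothing
  the absolute value at its kink.\<close>

lemma abs_minus_le_antiderivative:
  fixes f p :: "real \<Rightarrow> real"
  assumes f: "\<And>u. (f has_real_derivative p u) (at u)" "f 0 = 0" and "\<eta> > 0"
    and p: "\<And>u. u \<ge> 0 \<Longrightarrow> p u \<ge> 0" "\<And>u. u \<ge> \<eta> \<Longrightarrow> p u = 1" and "u \<ge> 0"
  shows "u - \<eta> \<le> f u"
proof -
  have pos: "0 \<le> f v" if "v \<ge> 0" for v
  proof -
    have "f 0 \<le> f v"
      by (rule DERIV_nonneg_imp_nondecreasing[OF that]) (use f(1) p(1) in blast)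
    then show ?thesis using f(2) by simp
  qed
  show ?thesis
  proof (cases "u \<le> \<eta>")
    case True
    then show ?thesis using pos[OF \<open>u \<ge> 0\<close>] by linarith
  next
    case False
    have "f \<eta> - \<eta> \<le> f u - u"
    proof (rule DERIV_nonneg_imp_nondecreasing[where f="\<lambda>u. f u - u" and a=\<eta> and b=u])
      fix v assume "\<eta> \<le> v" "v \<le> u"
      then show "\<exists>y. ((\<lambda>u. f u - u) has_real_derivative y) (at v) \<and> 0 \<le> y"
        using p(2)[of v] by (intro exI[of _ "p v - 1"] conjI DERIV_diff f DERIV_ident) auto
    qed (use False in simp)
    then show ?thesis using pos[of \<eta>] \<open>\<eta> > 0\<close> by linarith
  qed
qed

text \<open>The slope of \<open>\<phi>\<close> is the truncation of \<open>\<kappa> \<integral> du / \<rho>\<^sup>2(u + \<delta>)\<close> to \<open>[-1, 1]\<close>.  Because of the shift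
  by \<open>\<delta>\<close>, the density at any point within distance \<open>\<delta>\<close> of \<open>d\<close> is at most \<open>\<kappa> / \<rho>\<^sup>2(|d|)\<close>, although
  \<open>\<rho>\<close> may be discontinuous.\<close>

lemma yamada_watanabe_slope:
  fixes \<rho> :: "real \<Rightarrow> real"
  assumes \<rho>: "strict_mono \<rho>" "\<rho> 0 = 0"
    and osgood: "\<forall>\<epsilon>>0. (\<integral>\<^sup>+u\<in>{0<..<\<epsilon>}. ennreal (1 / (\<rho> u)\<^sup>2) \<partial>lborel) = \<infinity>"
    and \<eta>: "\<eta> > 0" and \<kappa>: "\<kappa> > 0"
  obtains p :: "real \<Rightarrow> real" and K \<delta> where "K \<ge> 0" "\<delta> > 0" "\<And>u. \<bar>p u\<bar> \<le> 1"
    "\<And>u. p (- u) = - p u" "\<And>u. u \<ge> 0 \<Longrightarrow> p u \<ge> 0" "\<And>u. u \<ge> \<eta> \<Longrightarrow> p u = 1"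
    "\<And>u v. \<bar>p u - p v\<bar> \<le> K * \<bar>u - v\<bar>"
    "\<And>d u. \<bar>u\<bar> \<le> \<delta> \<Longrightarrow> (\<rho> \<bar>d\<bar>)\<^sup>2 * \<bar>p (d + u) - p d\<bar> \<le> \<kappa> * \<bar>u\<bar>"
proof -
  define r where "r v = 1 / (\<rho> v)\<^sup>2" for v
  have \<rho>pos: "\<rho> v > 0" if "v > 0" for v using strict_monoD[OF \<rho>(1) that] \<rho>(2) by simp
  have \<rho>mono: "\<rho> v \<le> \<rho> w" if "v \<le> w" for v w using \<rho>(1) that by (simp add: strict_mono_less_eq)
  have [measurable]: "\<rho> \<in> borel_measurable borel"
    using strict_mono_mono[OF \<rho>(1)] by (rule borel_measurable_mono)
  have rm[measurable]: "r \<in> borel_measurable borel" unfolding r_def by measurable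
  have r_pos: "r v > 0" if "v > 0" for v using \<rho>pos[OF that] by (simp add: r_def)
  have r_anti: "r w \<le> r v" if "0 < v" "v \<le> w" for v w
    using \<rho>pos[OF that(1)] \<rho>mono[OF that(2)] unfolding r_def
    by (intro divide_left_mono power_mono mult_pos_pos) auto
  \<comment> \<open>The amount \<open>1 / \<kappa>\<close> is what lets the slope
    \<open>\<kappa> * R\<close> reach 1 no later than at \<open>\<eta>\<close>.\<close>
  obtain \<delta> where \<delta>: "\<delta> > 0" "\<delta> < \<eta>" and big: "ennreal (1 / \<kappa>) \<le> (\<integral>\<^sup>+u\<in>{\<delta>..\<eta>}. ennreal (r u) \<partial>lborel)"
    using osgood_tail_ge[OF rm, of \<eta> "1 / \<kappa>"] osgood \<eta> unfolding r_def by blast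
  have r_int: "r integrable_on {a..c}" if "\<delta> \<le> a" for a c
  proof -
    have "set_integrable lborel {a..c} r"
      unfolding set_integrable_def
    proof (rule integrableI_bounded_set[where A="{a..c}" and B="r \<delta>"])
      show "AE x in lborel. x \<in> {a..c} \<longrightarrow> norm (indicator {a..c} x *\<^sub>R r x) \<le> r \<delta>"
        using that \<delta> r_anti r_pos by (intro AE_I2) (auto simp: abs_of_pos)
    qed (auto simp: emeasure_lborel_Icc_eq)
    then show ?thesis by (rule set_borel_integral_eq_integral)
  qed
  define R where "R u = integral {\<delta>..\<delta> + u} r" for u
  have R_diff: "0 \<le> R w - R u" "R w - R u \<le> (w - u) * r (\<delta> + u)" if "0 \<le> u" "u \<le> w" for u w
  proof -
    have i: "r integrable_on {\<delta> + u..\<delta> + w}" using r_int that by simp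
    have "R u + integral {\<delta> + u..\<delta> + w} r = R w"
      unfolding R_def using that by (intro Henstock_Kurzweil_Integration.integral_combine r_int) auto
    then have eq: "R w - R u = integral {\<delta> + u..\<delta> + w} r" by simp
    show "0 \<le> R w - R u"
      unfolding eq using that \<delta> by (intro Henstock_Kurzweil_Integration.integral_nonneg i) (auto intro!: less_imp_le r_pos)
    have "integral {\<delta> + u..\<delta> + w} r \<le> integral {\<delta> + u..\<delta> + w} (\<lambda>_. r (\<delta> + u))"
      using that \<delta> by (intro Henstock_Kurzweil_Integration.integral_le i) (auto intro!: r_anti)
    then show "R w - R u \<le> (w - u) * r (\<delta> + u)" unfolding eq using that by simp
  qed
  have R0: "R 0 = 0" by (simp add: R_def)
  \<comment> \<open>\<open>R \<eta>\<close> integrates from \<open>\<delta>\<close> to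
    \<open>\<delta> + \<eta>\<close>, which covers the interval on which the integral is known to be
    large.\<close>
  have R\<eta>: "\<kappa> * R \<eta> \<ge> 1"
  proof -
    have "(r has_integral R (\<eta> - \<delta>)) {\<delta>..\<eta>}" using r_int[of \<delta> \<eta>] by (auto simp: R_def)
    then have "(\<integral>\<^sup>+u\<in>{\<delta>..\<eta>}. ennreal (r u) \<partial>lborel) = ennreal (R (\<eta> - \<delta>))"
      using \<delta> by (intro nn_integral_has_integral_lebesgue') (auto intro!: less_imp_le r_pos)
    then have "ennreal (1 / \<kappa>) \<le> ennreal (R (\<eta> - \<delta>))" using big by simp
    moreover have "0 \<le> R (\<eta> - \<delta>)" using R_diff(1)[of 0 "\<eta> - \<delta>"] R0 \<delta> by simp
    ultimately have "1 / \<kappa> \<le> R (\<eta> - \<delta>)" by simp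
    also have "\<dots> \<le> R \<eta>" using R_diff(1)[of "\<eta> - \<delta>" \<eta>] \<delta> by simp
    finally show ?thesis using \<kappa> by (simp add: field_simps)
  qed
  define P where "P u = (if u \<ge> 0 then R u else - R (- u))" for u
  have P_odd: "P (- u) = - P u" for u using R0 by (auto simp: P_def)
  \<comment> \<open>As \<open>r\<close> decreases, any \<open>c\<close> below
    \<open>\<delta> + \<bar>v\<bar>\<close> along the segment gives the density bound
    \<open>r c\<close>. A segment across zero is split there, \<open>P\<close> being the odd
    extension of \<open>R\<close>.\<close>
  have P_ord: "\<bar>P w - P d\<bar> \<le> (w - d) * r c"
    if "d \<le> w" "c > 0" "\<And>v. d \<le> v \<Longrightarrow> v \<le> w \<Longrightarrow> c \<le> \<delta> + \<bar>v\<bar>" for d w c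
  proof -
    consider "0 \<le> d" | "w < 0" | "d < 0" "0 \<le> w" by linarith
    then show ?thesis
    proof cases
      case 1
      have "(w - d) * r (\<delta> + d) \<le> (w - d) * r c"
        using that 1 by (intro mult_left_mono r_anti) (auto dest: that(3)[of d])
      then show ?thesis using R_diff[OF 1 that(1)] 1 that(1) by (simp add: P_def)
    next
      case 2
      have "(w - d) * r (\<delta> - w) \<le> (w - d) * r c"
        using that 2 by (intro mult_left_mono r_anti) (auto dest: that(3)[of w])
      then show ?thesis using R_diff[of "- w" "- d"] 2 that(1) by (simp add: P_def)
    next
      case 3
      have "r \<delta> \<le> r c" using that(3)[of 0] 3 that(2) by (intro r_anti) auto
      then have "w * r \<delta> \<le> w * r c" "(- d) * r \<delta> \<le> (- d) * r c"
        using 3 by (intro mult_left_mono; simp)+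
      moreover have "0 \<le> R w" "R w \<le> w * r \<delta>" "0 \<le> R (- d)" "R (- d) \<le> (- d) * r \<delta>"
        using R_diff[of 0 w] R_diff[of 0 "- d"] 3 R0 by auto
      moreover have "(w - d) * r c = w * r c + (- d) * r c" by (simp add: algebra_simps)
      moreover have "\<bar>P w - P d\<bar> = \<bar>R w + R (- d)\<bar>" using 3 by (simp add: P_def)
      ultimately show ?thesis by linarith
    qed
  qed
  have P_lip: "\<bar>P w - P d\<bar> \<le> \<bar>w - d\<bar> * r c"
    if "c > 0" "\<And>v. min d w \<le> v \<Longrightarrow> v \<le> max d w \<Longrightarrow> c \<le> \<delta> + \<bar>v\<bar>" for d w c
    using P_ord[of d w c] P_ord[of w d c] that by (cases "d \<le> w") (auto simp: abs_minus_commute)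
  define p where "p u = max (-1) (min 1 (\<kappa> * P u))" for u
  have p_P: "\<bar>p w - p d\<bar> \<le> \<kappa> * \<bar>P w - P d\<bar>" for w d
  proof -
    have "\<bar>max (-1) (min 1 a) - max (-1) (min 1 b)\<bar> \<le> \<bar>a - b\<bar>" for a b :: real by linarith
    moreover have "\<kappa> * \<bar>P w - P d\<bar> = \<bar>\<kappa> * P w - \<kappa> * P d\<bar>"
      using \<kappa> by (simp add: abs_mult flip: right_diff_distrib)
    ultimately show ?thesis unfolding p_def by simp
  qed
  show thesis
  proof (rule that[of "\<kappa> * r \<delta>" \<delta> p])
    show "0 \<le> \<kappa> * r \<delta>" using \<kappa> r_pos[OF \<delta>(1)] by simp
    show "\<bar>p u\<bar> \<le> 1" for u by (auto simp: p_def)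
    show "p (- u) = - p u" for u by (auto simp: p_def P_odd max_def min_def)
    show "p u \<ge> 0" if "u \<ge> 0" for u
      using R_diff(1)[of 0 u] that R0 \<kappa> by (auto simp: p_def P_def le_max_iff_disj)
    show "p u = 1" if "u \<ge> \<eta>" for u
    proof -
      have "R \<eta> \<le> R u" using R_diff(1)[of \<eta> u] \<eta> that by simp
      then have "\<kappa> * R \<eta> \<le> \<kappa> * R u" using \<kappa> by simp
      then show ?thesis using R\<eta> \<eta> that by (auto simp: p_def P_def)
    qed
    show "\<bar>p u - p v\<bar> \<le> \<kappa> * r \<delta> * \<bar>u - v\<bar>" for u v
    proof -
      have "\<kappa> * \<bar>P u - P v\<bar> \<le> \<kappa> * (\<bar>u - v\<bar> * r \<delta>)" using \<delta> \<kappa> by (intro mult_left_mono P_lip) auto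
      then show ?thesis using p_P[of u v] by (simp add: mult_ac)
    qed
    show "(\<rho> \<bar>d\<bar>)\<^sup>2 * \<bar>p (d + u) - p d\<bar> \<le> \<kappa> * \<bar>u\<bar>" if "\<bar>u\<bar> \<le> \<delta>" for d u
    proof (cases "d = 0")
      case False
      \<comment> \<open>The segment from \<open>d\<close> to \<open>d + u\<close> stays within
        \<open>\<delta>\<close> of \<open>d\<close>, so \<open>\<bar>d\<bar>\<close> is an
        admissible \<open>c\<close>; then \<open>r \<bar>d\<bar>\<close> cancels
        \<open>(\<rho> \<bar>d\<bar>)\<^sup>2\<close>.\<close>
      have "\<bar>P (d + u) - P d\<bar> \<le> \<bar>d + u - d\<bar> * r \<bar>d\<bar>"
        using False that by (intro P_lip) auto
      then have "\<kappa> * \<bar>P (d + u) - P d\<bar> \<le> \<kappa> * (\<bar>u\<bar> * r \<bar>d\<bar>)" using \<kappa> by simp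
      then have "\<bar>p (d + u) - p d\<bar> \<le> \<kappa> * (\<bar>u\<bar> * r \<bar>d\<bar>)" using p_P[of "d + u" d] by linarith
      then have "(\<rho> \<bar>d\<bar>)\<^sup>2 * \<bar>p (d + u) - p d\<bar> \<le> (\<rho> \<bar>d\<bar>)\<^sup>2 * (\<kappa> * (\<bar>u\<bar> * r \<bar>d\<bar>))"
        by (intro mult_left_mono) auto
      also have "\<dots> = \<kappa> * \<bar>u\<bar>" using \<rho>pos[of "\<bar>d\<bar>"] False by (simp add: r_def)
      finally show ?thesis .
    qed (use \<rho>(2) \<kappa> in simp)
  qed (use \<delta> in auto)
qed

text \<open>In the last inequality only the first-order term is kept exactly, because it will have
  mean zero when \<open>w\<close> is a Brownian increment. Displacements up to
  \<open>\<delta>\<close> use the local slope bound, in which \<open>\<rho>\<close> cancels; larger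
  ones are charged to \<open>w ^ 4\<close>, whose mean is quadratic in the time step.\<close>

lemma yamada_watanabe_function:
  fixes \<rho> :: "real \<Rightarrow> real"
  assumes \<rho>: "strict_mono \<rho>" "\<rho> 0 = 0"
    and osgood: "\<forall>\<epsilon>>0. (\<integral>\<^sup>+u\<in>{0<..<\<epsilon>}. ennreal (1 / (\<rho> u)\<^sup>2) \<partial>lborel) = \<infinity>"
    and \<eta>: "\<eta> > 0" and \<kappa>: "\<kappa> > 0"
  obtains \<phi> p :: "real \<Rightarrow> real" and K \<delta> where "K \<ge> 0" "\<delta> > 0" "\<phi> 0 = 0" "continuous_on UNIV p"
    "\<And>u. (\<phi> has_real_derivative p u) (at u)" "\<And>u. \<bar>p u\<bar> \<le> 1" "\<And>u. \<bar>u\<bar> - \<eta> \<le> \<phi> u"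
    "\<And>d a e w. \<bar>a\<bar> \<le> \<rho> \<bar>d\<bar> + e \<Longrightarrow> e \<ge> 0 \<Longrightarrow>
       \<phi> (d + a * w) \<le> \<phi> d + p d * a * w + (2 * \<kappa> + 2 * K * e\<^sup>2) * w\<^sup>2 + K / \<delta>\<^sup>2 * a ^ 4 * w ^ 4"
proof -
  obtain p K \<delta> where K: "K \<ge> 0" and \<delta>: "\<delta> > 0" and p1: "\<And>u. \<bar>p u\<bar> \<le> 1"
    and p_odd: "\<And>u. p (- u) = - p u"
    and p_pos: "\<And>u. u \<ge> 0 \<Longrightarrow> p u \<ge> 0" and p_eq: "\<And>u. u \<ge> \<eta> \<Longrightarrow> p u = 1"
    and p_lip: "\<And>u v. \<bar>p u - p v\<bar> \<le> K * \<bar>u - v\<bar>"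
    and p_loc: "\<And>d u. \<bar>u\<bar> \<le> \<delta> \<Longrightarrow> (\<rho> \<bar>d\<bar>)\<^sup>2 * \<bar>p (d + u) - p d\<bar> \<le> \<kappa> * \<bar>u\<bar>"
    by (rule yamada_watanabe_slope[OF \<rho> osgood \<eta> \<kappa>]) (rule that)
  have cont: "continuous_on A p" for A
    by (rule lipschitz_on_continuous_on[of K], rule lipschitz_onI)
      (use p_lip K in \<open>auto simp: dist_real_def\<close>)
  define \<phi> where "\<phi> u = (LBINT y=0..u. p y)" for u :: real
  have deriv: "(\<phi> has_real_derivative p u) (at u)" for u
  proof -
    define m where "m = \<bar>u\<bar> + 1"
    have "((\<lambda>v. LBINT y=(0::real)..v. p y) has_vector_derivative p u) (at u within {- m..m})"
      by (rule interval_integral_FTC2) (auto simp: m_def cont)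
    moreover have "at u within {- m..m} = at u"
      by (rule at_within_interior) (auto simp: m_def)
    ultimately show ?thesis
      by (simp add: \<phi>_def[abs_def] has_real_derivative_iff_has_vector_derivative zero_ereal_def)
  qed
  have \<phi>0: "\<phi> 0 = 0" by (simp add: \<phi>_def zero_ereal_def)
  have lower: "\<bar>u\<bar> - \<eta> \<le> \<phi> u" for u
  proof (cases "u \<ge> 0")
    case True
    then show ?thesis using abs_minus_le_antiderivative[OF deriv \<phi>0 \<eta> p_pos p_eq] by simp
  next
    case False
    have "((\<lambda>u. \<phi> (- u)) has_real_derivative p v) (at v)" for v
    proof -
      have "((\<lambda>u. \<phi> (- u)) has_real_derivative p (- v) * (- 1)) (at v)"
        by (rule DERIV_chain2[OF deriv]) (auto intro!: derivative_eq_intros)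
      then show ?thesis by (simp add: p_odd)
    qed
    from abs_minus_le_antiderivative[OF this _ \<eta> p_pos p_eq, of "- u"] False \<phi>0 show ?thesis by simp
  qed
  have step: "\<phi> (d + a * w) \<le> \<phi> d + p d * a * w + (2 * \<kappa> + 2 * K * e\<^sup>2) * w\<^sup>2 + K / \<delta>\<^sup>2 * a ^ 4 * w ^ 4"
    if a: "\<bar>a\<bar> \<le> \<rho> \<bar>d\<bar> + e" "e \<ge> 0" for d a e w
  proof -
    define u where "u = a * w"
    \<comment> \<open>The slope \<open>p\<close> is only Lipschitz, so the remainder is written as
      \<open>u * (p (d + v) - p d)\<close> by the mean value theorem and not with a second
      derivative.\<close>
    obtain v where v: "\<bar>v\<bar> \<le> \<bar>u\<bar>" "\<phi> (d + u) - \<phi> d = u * p (d + v)"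
    proof -
      consider "u = 0" | "u > 0" | "u < 0" by linarith
      then show thesis
      proof cases
        case 1 then show ?thesis using that[of 0] by simp
      next
        case 2
        obtain z where "d < z" "z < d + u" "\<phi> (d + u) - \<phi> d = (d + u - d) * p z"
          using MVT2[of d "d + u" \<phi> p] 2 deriv by auto
        then show ?thesis using that[of "z - d"] by simp
      next
        case 3
        obtain z where "d + u < z" "z < d" "\<phi> d - \<phi> (d + u) = (d - (d + u)) * p z"
          using MVT2[of "d + u" d \<phi> p] 3 deriv by auto
        then show ?thesis using that[of "z - d"] by simp
      qed
    qed
    define D where "D = \<bar>p (d + v) - p d\<bar>"
    have D: "D \<ge> 0" "D \<le> K * \<bar>u\<bar>"
    proof -
      show "D \<le> K * \<bar>u\<bar>"
        using p_lip[of "d + v" d] mult_left_mono[OF v(1) K] by (simp add: D_def)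
    qed (simp add: D_def)
    have "\<phi> (d + u) - \<phi> d - u * p d = u * (p (d + v) - p d)" using v(2) by (simp add: algebra_simps)
    also have "\<dots> \<le> \<bar>u\<bar> * D" unfolding D_def by (metis abs_ge_self abs_mult)
    finally have 1: "\<phi> (d + u) - \<phi> d - u * p d \<le> \<bar>u\<bar> * D" .
    have nn: "0 \<le> (2 * \<kappa> + 2 * K * e\<^sup>2) * w\<^sup>2" "0 \<le> K / \<delta>\<^sup>2 * a ^ 4 * w ^ 4"
      using \<kappa> K by (auto intro!: mult_nonneg_nonneg add_nonneg_nonneg)
    have "\<bar>u\<bar> * D \<le> (2 * \<kappa> + 2 * K * e\<^sup>2) * w\<^sup>2 + K / \<delta>\<^sup>2 * a ^ 4 * w ^ 4"
    proof (cases "\<bar>u\<bar> \<le> \<delta>")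
      case True
      have "a\<^sup>2 \<le> (\<rho> \<bar>d\<bar> + e)\<^sup>2" using a(1) by (metis abs_ge_zero power2_abs power_mono)
      also have "\<dots> \<le> 2 * (\<rho> \<bar>d\<bar>)\<^sup>2 + 2 * e\<^sup>2"
        using sum_squares_bound[of "\<rho> \<bar>d\<bar>" e] by (simp add: power2_sum)
      finally have "a\<^sup>2 * D \<le> (2 * (\<rho> \<bar>d\<bar>)\<^sup>2 + 2 * e\<^sup>2) * D" using D by (intro mult_right_mono) auto
      also have "\<dots> = 2 * ((\<rho> \<bar>d\<bar>)\<^sup>2 * D) + 2 * e\<^sup>2 * D" by (simp add: algebra_simps)
      also have "\<dots> \<le> 2 * (\<kappa> * \<bar>v\<bar>) + 2 * e\<^sup>2 * (K * \<bar>u\<bar>)"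
        using p_loc[of v d] v(1) True D unfolding D_def
        by (intro add_mono mult_left_mono) auto
      also have "\<dots> \<le> 2 * (\<kappa> * \<bar>u\<bar>) + 2 * e\<^sup>2 * (K * \<bar>u\<bar>)" using v(1) \<kappa> by simp
      \<comment> \<open>Multiplying the bound on \<open>a\<^sup>2 * D\<close> by
        \<open>w\<^sup>2\<close> produces \<open>u\<^sup>2 * D\<close>. Both sides then share a
        factor \<open>\<bar>u\<bar>\<close>, which is cancelled when it is nonzero.\<close>
      finally have m: "w\<^sup>2 * (a\<^sup>2 * D) \<le> w\<^sup>2 * (2 * (\<kappa> * \<bar>u\<bar>) + 2 * e\<^sup>2 * (K * \<bar>u\<bar>))" by (intro mult_left_mono) auto
      have l: "w\<^sup>2 * (a\<^sup>2 * D) = \<bar>u\<bar> * \<bar>u\<bar> * D"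
        by (simp add: abs_mult_self_eq u_def power2_eq_square mult_ac)
      have r: "w\<^sup>2 * (2 * (\<kappa> * \<bar>u\<bar>) + 2 * e\<^sup>2 * (K * \<bar>u\<bar>)) = \<bar>u\<bar> * ((2 * \<kappa> + 2 * K * e\<^sup>2) * w\<^sup>2)"
        by (simp add: algebra_simps)
      have "\<bar>u\<bar> * (\<bar>u\<bar> * D) \<le> \<bar>u\<bar> * ((2 * \<kappa> + 2 * K * e\<^sup>2) * w\<^sup>2)"
        using m unfolding l r by (simp only: mult.assoc)
      then have "\<bar>u\<bar> * D \<le> (2 * \<kappa> + 2 * K * e\<^sup>2) * w\<^sup>2"
        using nn(1) by (cases "u = 0") (auto simp: mult_le_cancel_left)
      then show ?thesis using nn by linarith
    next
      case False
      have "\<bar>u\<bar> * D \<le> K * u\<^sup>2" using mult_left_mono[OF D(2), of "\<bar>u\<bar>"] by (simp add: power2_eq_square mult_ac)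
      \<comment> \<open>Here \<open>\<bar>u\<bar> > \<delta>\<close>, so inserting the factor
        \<open>u\<^sup>2 / \<delta>\<^sup>2 \<ge> 1\<close> raises the second power to a fourth
        one.\<close>
      also have "\<dots> \<le> K * (u\<^sup>2 * (u\<^sup>2 / \<delta>\<^sup>2))"
      proof -
        have "\<delta>\<^sup>2 \<le> u\<^sup>2" using False \<delta> by (simp add: abs_le_square_iff[symmetric])
        then have "u\<^sup>2 * 1 \<le> u\<^sup>2 * (u\<^sup>2 / \<delta>\<^sup>2)" using \<delta> by (intro mult_left_mono) auto
        then show ?thesis using K by (intro mult_left_mono) auto
      qed
      also have "\<dots> = K / \<delta>\<^sup>2 * a ^ 4 * w ^ 4" by (simp add: u_def power_mult_distrib power4_eq_xxxx power2_eq_square)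
      finally show ?thesis using nn by linarith
    qed
    then show ?thesis using 1 by (simp add: u_def mult_ac)
  qed
  show thesis by (rule that[OF K \<delta> \<phi>0 cont deriv p1 lower step])
qed

section \<open>Brownian increments and the augmented filtration\<close>

locale brownian = prob_space M for M :: "'a measure" +
  fixes T :: real and W :: "real \<Rightarrow> 'a \<Rightarrow> real"
  assumes T_pos: "T > 0" and brownian_motion: "standard_brownian_motion M T W"
begin

abbreviation \<F> :: "real \<Rightarrow> 'a measure" where "\<F> \<equiv> brownian_filtration M W"

lemma W_measurable [measurable]: "t \<in> {0..T} \<Longrightarrow> W t \<in> borel_measurable M"
  using brownian_motion by (simp add: standard_brownian_motion_def continuous_process_def)

lemma W_zero: "AE \<omega> in M. W 0 \<omega> = 0"
  using brownian_motion by (simp add: standard_brownian_motion_def)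

lemma W_increment_distributed:
  "0 \<le> s \<Longrightarrow> s < t \<Longrightarrow> t \<le> T \<Longrightarrow>
    distributed M lborel (\<lambda>\<omega>. W t \<omega> - W s \<omega>) (normal_density 0 (sqrt (t - s)))"
  using brownian_motion by (simp add: standard_brownian_motion_def)

lemma W_increments_indep:
  "(\<And>i. i \<le> n \<Longrightarrow> \<tau> i \<in> {0..T}) \<Longrightarrow> (\<And>i. i < n \<Longrightarrow> \<tau> i \<le> \<tau> (Suc i)) \<Longrightarrow>
    indep_vars (\<lambda>_. borel) (\<lambda>i \<omega>. W (\<tau> (Suc i)) \<omega> - W (\<tau> i) \<omega>) {..<n::nat}"
  using brownian_motion by (simp add: standard_brownian_motion_def)

lemma filtration_generator_subset:
  "{W s -` B \<inter> space M | s B. 0 \<le> s \<and> s \<le> t \<and> B \<in> sets borel} \<union> null_sets M \<subseteq> Pow (space M)"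
  using sets.sets_into_space by auto

lemma space_filtration [simp]: "space (\<F> t) = space M"
  unfolding brownian_filtration_def using filtration_generator_subset
  by (subst space_measure_of) auto

lemma sets_filtration:
  "sets (\<F> t) = sigma_sets (space M)
     ({W s -` B \<inter> space M | s B. 0 \<le> s \<and> s \<le> t \<and> B \<in> sets borel} \<union> null_sets M)"
  unfolding brownian_filtration_def using filtration_generator_subset
  by (subst sets_measure_of) auto

lemma filtration_mono:
  assumes "s \<le> t" shows "sets (\<F> s) \<subseteq> sets (\<F> t)"
  unfolding sets_filtration
proof (rule sigma_sets_mono', rule Un_mono[OF _ order_refl], safe)
  fix r :: real and B :: "real set" assume "0 \<le> r" "r \<le> s" "B \<in> sets borel"
  then show "\<exists>r' B'. W r -` B \<inter> space M = W r' -` B' \<inter> space M \<and> 0 \<le> r' \<and> r' \<le> t \<and> B' \<in> sets borel"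
    using order_trans[OF _ assms] by blast
qed

lemma filtration_subset:
  assumes "t \<le> T" shows "sets (\<F> t) \<subseteq> sets M"
  unfolding sets_filtration
proof (rule sets.sigma_sets_subset)
  show "{W s -` B \<inter> space M | s B. 0 \<le> s \<and> s \<le> t \<and> B \<in> sets borel} \<union> null_sets M \<subseteq> sets M"
    using assms by (auto intro!: measurable_sets[OF W_measurable])
qed

lemma measurable_filtration_mono:
  assumes "f \<in> measurable (\<F> s) N" "s \<le> t" shows "f \<in> measurable (\<F> t) N"
  using assms filtration_mono[OF assms(2)] by (auto simp: measurable_def)

lemma measurable_filtration_M:
  assumes "f \<in> measurable (\<F> s) N" "s \<le> T" shows "f \<in> measurable M N"
  using assms filtration_subset[OF assms(2)] by (auto simp: measurable_def)

lemma W_measurable_filtration: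
  assumes "0 \<le> s" "s \<le> t" shows "W s \<in> borel_measurable (\<F> t)"
proof (rule measurableI)
  fix B :: "real set" assume "B \<in> sets borel"
  then have "W s -` B \<inter> space M \<in> {W s -` B \<inter> space M | s B. 0 \<le> s \<and> s \<le> t \<and> B \<in> sets borel} \<union> null_sets M"
    using assms by blast
  then show "W s -` B \<inter> space (\<F> t) \<in> sets (\<F> t)"
    unfolding sets_filtration space_filtration by (rule sigma_sets.Basic)
qed simp

text \<open>Brownian motion is given through increments along increasing chains of times. Sorting
  \<open>J\<close> together with 0 and \<open>t\<close> and appending \<open>u\<close> makes
  \<open>W u - W t\<close> the last increment of such a chain. Telescoping expresses the values of
  \<open>W\<close> on \<open>J\<close> through the earlier increments, up to the null set where
  \<open>W 0\<close> is not zero.\<close>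

lemma cylinder_indep_increment:
  assumes J: "finite J" "J \<subseteq> {0..t}" and t: "0 \<le> t" "t < u" "u \<le> T"
    and B: "\<And>s. s \<in> J \<Longrightarrow> B s \<in> sets borel" and C: "C \<in> sets borel"
  shows "prob {\<omega> \<in> space M. (\<forall>s\<in>J. W s \<omega> \<in> B s) \<and> W u \<omega> - W t \<omega> \<in> C} =
    prob {\<omega> \<in> space M. \<forall>s\<in>J. W s \<omega> \<in> B s} * prob {\<omega> \<in> space M. W u \<omega> - W t \<omega> \<in> C}"
proof -
  define K where "K = insert 0 (insert t J)"
  define L where "L = sorted_list_of_set K"
  define n where "n = length L - 1"
  define \<tau> where "\<tau> i = (if i \<le> n then L ! i else u)" for i
  have K: "finite K" "K \<noteq> {}" "K \<subseteq> {0..t}" using J t by (auto simp: K_def)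
  have L: "sorted L" "set L = K" "L \<noteq> []" "distinct L"
    using K by (auto simp: L_def)
  have len: "length L = Suc n" using L(3) by (simp add: n_def Suc_pred')
  have ex: "\<exists>i\<le>n. \<tau> i = s" if "s \<in> K" for s
    using that len L(2) by (metis \<tau>_def in_set_conv_nth less_Suc_eq_le)
  have inK: "\<tau> i \<in> K" if "i \<le> n" for i
    using that len L(2) by (simp add: \<tau>_def less_Suc_eq_le flip: L(2))
  have mono: "\<tau> i \<le> \<tau> j" if "i \<le> j" "j \<le> n" for i j
    using that L(1) len by (auto simp: \<tau>_def intro: sorted_nth_mono)
  have \<tau>0: "\<tau> 0 = 0"
  proof -
    obtain i where "i \<le> n" "\<tau> i = 0" using ex[of 0] by (auto simp: K_def)
    then show ?thesis using mono[of 0 i] inK[of 0] K(3) by force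
  qed
  have \<tau>n: "\<tau> n = t"
  proof -
    obtain i where "i \<le> n" "\<tau> i = t" using ex[of t] by (auto simp: K_def)
    then show ?thesis using mono[of i n] inK[of n] K(3) by force
  qed
  have \<tau>Sn: "\<tau> (Suc n) = u" by (simp add: \<tau>_def)
  have rng: "\<tau> i \<in> {0..T}" if "i \<le> Suc n" for i
    using inK[of i] K(3) t that by (cases "i \<le> n") (auto simp: \<tau>Sn le_Suc_eq subset_iff)
  let ?I = "\<lambda>i \<omega>. W (\<tau> (Suc i)) \<omega> - W (\<tau> i) \<omega>"
  have "indep_vars (\<lambda>_. borel) ?I {..<Suc n}"
  proof (rule W_increments_indep)
    fix i assume "i < Suc n"
    then show "\<tau> i \<le> \<tau> (Suc i)"
      using mono[of i "Suc i"] \<tau>n \<tau>Sn t by (cases "i = n") auto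
  qed (use rng in auto)
  then have ind: "indep_var (PiM {..<n} (\<lambda>_. borel)) (\<lambda>\<omega>. restrict (\<lambda>i. ?I i \<omega>) {..<n})
      (PiM {n} (\<lambda>_. borel)) (\<lambda>\<omega>. restrict (\<lambda>i. ?I i \<omega>) {n})"
    by (rule indep_var_restrict) auto
  define A1 where "A1 = {v \<in> space (PiM {..<n} (\<lambda>_. borel :: real measure)).
      \<forall>i\<in>{i. i \<le> n \<and> \<tau> i \<in> J}. (\<Sum>j<i. v j) \<in> B (\<tau> i)}"
  define A2 where "A2 = {v \<in> space (PiM {n} (\<lambda>_. borel :: real measure)). v n \<in> C}"
  have A1: "A1 \<in> sets (PiM {..<n} (\<lambda>_. borel))"
    unfolding A1_def
  proof (rule sets.sets_Collect_finite_All)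
    fix i assume i: "i \<in> {i. i \<le> n \<and> \<tau> i \<in> J}"
    have "(\<lambda>v. \<Sum>j<i. v j) \<in> borel_measurable (PiM {..<n} (\<lambda>_. borel :: real measure))"
      using i by (intro borel_measurable_sum measurable_component_singleton) auto
    then show "{v \<in> space (PiM {..<n} (\<lambda>_. borel :: real measure)). (\<Sum>j<i. v j) \<in> B (\<tau> i)} \<in> sets (PiM {..<n} (\<lambda>_. borel))"
      by (rule measurable_sets_Collect) (use i B in auto)
  qed auto
  have A2: "A2 \<in> sets (PiM {n} (\<lambda>_. borel))"
    unfolding A2_def by (rule measurable_sets_Collect[OF measurable_component_singleton]) (use C in auto)
  have tele: "(\<Sum>j<i. ?I j \<omega>) = W (\<tau> i) \<omega> - W 0 \<omega>" for i \<omega>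
    using sum_lessThan_telescope[of "\<lambda>j. W (\<tau> j) \<omega>" i] \<tau>0 by simp
  let ?P = "\<lambda>\<omega>. restrict (\<lambda>i. ?I i \<omega>) {..<n}" and ?Q = "\<lambda>\<omega>. restrict (\<lambda>i. ?I i \<omega>) {n}"
  have P1: "?P \<omega> \<in> A1 \<longleftrightarrow> (\<forall>i\<in>{i. i \<le> n \<and> \<tau> i \<in> J}. W (\<tau> i) \<omega> - W 0 \<omega> \<in> B (\<tau> i))" for \<omega>
  proof -
    have "(\<Sum>j<i. ?P \<omega> j) = W (\<tau> i) \<omega> - W 0 \<omega>" if "i \<le> n" for i
      using that by (subst tele[symmetric]) (intro sum.cong, auto)
    then show ?thesis by (auto simp: A1_def space_PiM)
  qed
  have P: "?P \<omega> \<in> A1 \<longleftrightarrow> (\<forall>s\<in>J. W s \<omega> \<in> B s)" if "W 0 \<omega> = 0" for \<omega>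
    unfolding P1 using that ex by (auto simp: K_def)
  have Q: "?Q \<omega> \<in> A2 \<longleftrightarrow> W u \<omega> - W t \<omega> \<in> C" for \<omega>
    by (auto simp: A2_def space_PiM \<tau>n \<tau>Sn)
  have sJ: "{\<omega> \<in> space M. \<forall>s\<in>J. W s \<omega> \<in> B s} \<in> events"
  proof (rule sets.sets_Collect_finite_All)
    fix s assume "s \<in> J"
    then show "{\<omega> \<in> space M. W s \<omega> \<in> B s} \<in> events"
      using J t B by (intro measurable_sets_Collect[OF W_measurable]) auto
  qed (use J in auto)
  have su: "{\<omega> \<in> space M. W u \<omega> - W t \<omega> \<in> C} \<in> events"
    using t C by (intro measurable_sets_Collect[OF borel_measurable_diff[OF W_measurable W_measurable]]) auto
  have mP: "?P -` A1 \<inter> space M \<in> events" and mQ: "?Q -` A2 \<inter> space M \<in> events"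
    using measurable_sets[OF indep_var_rv1[OF ind] A1] measurable_sets[OF indep_var_rv2[OF ind] A2]
    by auto
  have "prob {\<omega> \<in> space M. (\<forall>s\<in>J. W s \<omega> \<in> B s) \<and> W u \<omega> - W t \<omega> \<in> C} =
      prob ((\<lambda>\<omega>. (?P \<omega>, ?Q \<omega>)) -` (A1 \<times> A2) \<inter> space M)"
  proof (rule finite_measure_eq_AE)
    show "{\<omega> \<in> space M. (\<forall>s\<in>J. W s \<omega> \<in> B s) \<and> W u \<omega> - W t \<omega> \<in> C} \<in> events"
      using sets.Int[OF sJ su] by (rule back_subst[of "\<lambda>A. A \<in> events"]) auto
    show "(\<lambda>\<omega>. (?P \<omega>, ?Q \<omega>)) -` (A1 \<times> A2) \<inter> space M \<in> events"
      using sets.Int[OF mP mQ] by (rule back_subst[of "\<lambda>A. A \<in> events"]) auto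
  qed (use W_zero in eventually_elim, use P Q in auto)
  also have "\<dots> = prob (?P -` A1 \<inter> space M) * prob (?Q -` A2 \<inter> space M)"
    by (rule indep_varD[OF ind A1 A2])
  also have "prob (?P -` A1 \<inter> space M) = prob {\<omega> \<in> space M. \<forall>s\<in>J. W s \<omega> \<in> B s}"
    by (rule finite_measure_eq_AE[OF _ mP sJ]) (use W_zero in eventually_elim, use P in auto)
  also have "prob (?Q -` A2 \<inter> space M) = prob {\<omega> \<in> space M. W u \<omega> - W t \<omega> \<in> C}"
    by (rule arg_cong[where f=prob]) (use Q in auto)
  finally show ?thesis .
qed

text \<open>The pi-system consists of the events that agree almost surely with a finite cylinder up
  to time \<open>t\<close>. Working modulo null sets lets it contain both kinds of generators, so
  the augmentation of the filtration is absorbed.\<close>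

lemma filtration_indep_increment:
  assumes t: "0 \<le> t" "t < u" "u \<le> T"
    and A: "A \<in> sets (\<F> t)" and C: "C \<in> sets borel"
  shows "prob (A \<inter> {\<omega> \<in> space M. W u \<omega> - W t \<omega> \<in> C}) =
    prob A * prob {\<omega> \<in> space M. W u \<omega> - W t \<omega> \<in> C}"
proof -
  let ?c = "\<lambda>J B. {\<omega> \<in> space M. \<forall>s\<in>J. W s \<omega> \<in> B s}"
  let ?D = "{\<omega> \<in> space M. W u \<omega> - W t \<omega> \<in> C}"
  define \<A> where "\<A> = {E \<in> events. \<exists>J B. finite J \<and> J \<subseteq> {0..t} \<and> (\<forall>s\<in>J. B s \<in> sets (borel :: real measure)) \<and>
    (AE \<omega> in M. \<omega> \<in> E \<longleftrightarrow> (\<forall>s\<in>J. W s \<omega> \<in> B s))}"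
  have \<A>I: "E \<in> \<A>" if "E \<in> events" "AE \<omega> in M. \<omega> \<in> E \<longleftrightarrow> (\<forall>s\<in>J. W s \<omega> \<in> B s)"
    "finite J" "J \<subseteq> {0..t}" "\<forall>s\<in>J. B s \<in> sets borel" for E J B
    unfolding \<A>_def using that by blast
  have su: "?D \<in> events"
    using t C by (intro measurable_sets_Collect[OF borel_measurable_diff[OF W_measurable W_measurable]]) auto
  have sJ: "?c J B \<in> events" if "finite J" "J \<subseteq> {0..t}" "\<forall>s\<in>J. B s \<in> sets borel" for J B
  proof (rule sets.sets_Collect_finite_All)
    fix s assume "s \<in> J"
    then show "{\<omega> \<in> space M. W s \<omega> \<in> B s} \<in> events"
      using that t by (intro measurable_sets_Collect[OF W_measurable]) auto
  qed (use that in auto)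
  have "indep_set \<A> {?D}"
  proof (rule indep_setI)
    fix a b assume a: "a \<in> \<A>" and "b \<in> {?D}"
    then have b: "b = ?D" by simp
    obtain J B where J: "finite J" "J \<subseteq> {0..t}" "\<forall>s\<in>J. B s \<in> sets borel"
      and ae: "AE \<omega> in M. \<omega> \<in> a \<longleftrightarrow> (\<forall>s\<in>J. W s \<omega> \<in> B s)" and aev: "a \<in> events"
      using a unfolding \<A>_def by blast
    have "prob (a \<inter> b) = prob (?c J B \<inter> ?D)"
      unfolding b
    proof (rule finite_measure_eq_AE)
      show "AE \<omega> in M. \<omega> \<in> a \<inter> ?D \<longleftrightarrow> \<omega> \<in> ?c J B \<inter> ?D" using ae by eventually_elim blast
    qed (use sJ[OF J] su aev in blast)+
    also have "?c J B \<inter> ?D = {\<omega> \<in> space M. (\<forall>s\<in>J. W s \<omega> \<in> B s) \<and> W u \<omega> - W t \<omega> \<in> C}" by auto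
    also have "prob \<dots> = prob (?c J B) * prob ?D"
      by (rule cylinder_indep_increment) (use J t C in auto)
    also have "prob (?c J B) = prob a"
    proof (rule finite_measure_eq_AE)
      show "AE \<omega> in M. \<omega> \<in> ?c J B \<longleftrightarrow> \<omega> \<in> a"
        using ae AE_space by eventually_elim blast
    qed (use sJ[OF J] aev in blast)+
    finally show "prob (a \<inter> b) = prob a * prob b" by (simp add: b)
  next
    show "\<A> \<subseteq> events" unfolding \<A>_def by blast
    show "{?D} \<subseteq> events" using su by blast
  qed
  moreover have "Int_stable \<A>"
    unfolding Int_stable_def
  proof (intro ballI)
    fix a b assume ab: "a \<in> \<A>" "b \<in> \<A>"
    obtain J B where J: "finite J" "J \<subseteq> {0..t}" "\<forall>s\<in>J. B s \<in> sets borel"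
      and ae: "AE \<omega> in M. \<omega> \<in> a \<longleftrightarrow> (\<forall>s\<in>J. W s \<omega> \<in> B s)" and aev: "a \<in> events"
      using ab(1) unfolding \<A>_def by blast
    obtain J' B' where J': "finite J'" "J' \<subseteq> {0..t}" "\<forall>s\<in>J'. B' s \<in> sets borel"
      and ae': "AE \<omega> in M. \<omega> \<in> b \<longleftrightarrow> (\<forall>s\<in>J'. W s \<omega> \<in> B' s)" and bev: "b \<in> events"
      using ab(2) unfolding \<A>_def by blast
    \<comment> \<open>A coordinate that occurs in only one of the two cylinders is left free in the
      other.\<close>
    define B'' where "B'' s = (if s \<in> J then B s else UNIV) \<inter> (if s \<in> J' then B' s else UNIV)" for s
    have "AE \<omega> in M. \<omega> \<in> a \<inter> b \<longleftrightarrow> (\<forall>s\<in>J \<union> J'. W s \<omega> \<in> B'' s)"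
      using ae ae' by eventually_elim (auto simp: B''_def)
    moreover have "\<forall>s\<in>J \<union> J'. B'' s \<in> sets borel" using J J' by (auto simp: B''_def)
    moreover have "finite (J \<union> J')" "J \<union> J' \<subseteq> {0..t}" using J J' by auto
    ultimately show "a \<inter> b \<in> \<A>" using aev bev unfolding \<A>_def by blast
  qed
  moreover have "Int_stable {?D}" by (auto simp: Int_stable_def)
  ultimately have ind: "indep_set (sigma_sets (space M) \<A>) (sigma_sets (space M) {?D})"
    by (rule indep_set_sigma_sets)
  have "{W s -` B \<inter> space M | s B. 0 \<le> s \<and> s \<le> t \<and> B \<in> sets borel} \<union> null_sets M \<subseteq> \<A>"
  proof (intro Un_least subsetI)
    fix E assume "E \<in> {W s -` B \<inter> space M | s B. 0 \<le> s \<and> s \<le> t \<and> B \<in> sets borel}"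
    then obtain s B where E: "E = W s -` B \<inter> space M" "0 \<le> s" "s \<le> t" "B \<in> sets borel" by blast
    have "E \<in> events" using E t by (auto intro!: measurable_sets[OF W_measurable])
    moreover have "AE \<omega> in M. \<omega> \<in> E \<longleftrightarrow> (\<forall>r\<in>{s}. W r \<omega> \<in> B)"
      by (rule AE_I2) (auto simp: E)
    moreover have "finite {s}" "{s} \<subseteq> {0..t}" "\<forall>r\<in>{s}. B \<in> sets borel" using E by auto
    ultimately show "E \<in> \<A>" by (intro \<A>I[of E "{s}" "\<lambda>_. B"])
  next
    fix E assume E: "E \<in> null_sets M"
    then have "E \<in> events" by auto
    \<comment> \<open>A null set agrees almost surely with the empty cylinder, described by asking
      \<open>W 0\<close> to lie in the empty set.\<close>
    moreover have "AE \<omega> in M. \<omega> \<in> E \<longleftrightarrow> (\<forall>r\<in>{0::real}. W r \<omega> \<in> {})"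
      using AE_not_in[OF E] by eventually_elim auto
    moreover have "finite {0}" "{0} \<subseteq> {0..t}" "\<forall>r\<in>{0::real}. {} \<in> sets (borel :: real measure)"
      using t by auto
    ultimately show "E \<in> \<A>" by (intro \<A>I[of E "{0}" "\<lambda>_. {}"])
  qed
  then have "sets (\<F> t) \<subseteq> sigma_sets (space M) \<A>"
    unfolding sets_filtration by (rule sigma_sets_mono')
  with A have "A \<in> sigma_sets (space M) \<A>" by (rule rev_subsetD)
  moreover have "?D \<in> sigma_sets (space M) {?D}" by (rule sigma_sets.Basic) (rule singletonI)
  ultimately show ?thesis by (rule indep_setD[OF ind])
qed

text \<open>Stated as a product law and for \<open>U\<close> with values in any space, so that it
  serves real weights as well as the whole history of a chain.\<close>

lemma indep_increment:
  assumes t: "0 \<le> t" "t < u" "u \<le> T" and U: "U \<in> measurable (\<F> t) N"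
  shows "distr M (N \<Otimes>\<^sub>M borel) (\<lambda>\<omega>. (U \<omega>, W u \<omega> - W t \<omega>)) =
    distr M N U \<Otimes>\<^sub>M distr M borel (\<lambda>\<omega>. W u \<omega> - W t \<omega>)"
proof -
  let ?D = "\<lambda>\<omega>. W u \<omega> - W t \<omega>"
  have [measurable]: "?D \<in> borel_measurable M"
    using t by (intro borel_measurable_diff W_measurable) auto
  have [measurable]: "U \<in> measurable M N" using t by (intro measurable_filtration_M[OF U]) simp
  interpret U: prob_space "distr M N U" by (rule prob_space_distr) simp
  interpret D: prob_space "distr M borel ?D" by (rule prob_space_distr) simp
  show ?thesis
  proof (rule pair_measure_eqI[symmetric])
    fix A B assume A: "A \<in> sets (distr M N U)" and B: "B \<in> sets (distr M borel ?D)"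
    have "(\<lambda>\<omega>. (U \<omega>, ?D \<omega>)) -` (A \<times> B) \<inter> space M = (U -` A \<inter> space M) \<inter> {\<omega> \<in> space M. ?D \<omega> \<in> B}"
      by auto
    moreover have "U -` A \<inter> space M \<in> sets (\<F> t)" using measurable_sets[OF U, of A] A by simp
    moreover have "?D -` B \<inter> space M = {\<omega> \<in> space M. ?D \<omega> \<in> B}" by auto
    ultimately show "emeasure (distr M N U) A * emeasure (distr M borel ?D) B =
        emeasure (distr M (N \<Otimes>\<^sub>M borel) (\<lambda>\<omega>. (U \<omega>, ?D \<omega>))) (A \<times> B)"
      using A B filtration_indep_increment[OF t, of "U -` A \<inter> space M" B]
      by (simp add: emeasure_distr emeasure_eq_measure ennreal_mult'')
  qed (auto intro: U.sigma_finite_measure_axioms D.sigma_finite_measure_axioms)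
qed

end

section \<open>Moments of increments and tail bounds for adapted sums of increments\<close>

lemma le_of_Suc_le:
  fixes p :: "nat \<Rightarrow> real"
  assumes "\<And>i. i < n \<Longrightarrow> p i \<le> p (Suc i)" "i \<le> j" "j \<le> n"
  shows "p i \<le> p j"
  using assms(2,3) by (induction j rule: dec_induct) (use assms(1) order_trans in force)+

context brownian
begin

lemma increment_measurable:
  "0 \<le> s \<Longrightarrow> s \<le> t \<Longrightarrow> t \<le> T \<Longrightarrow> (\<lambda>\<omega>. W t \<omega> - W s \<omega>) \<in> borel_measurable M"
  by (intro borel_measurable_diff W_measurable) auto

lemma increment_moments:
  assumes "0 \<le> s" "s \<le> t" "t \<le> T"
  shows integrable_increment_power: "integrable M (\<lambda>\<omega>. (W t \<omega> - W s \<omega>) ^ k)"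
    and expectation_increment: "expectation (\<lambda>\<omega>. W t \<omega> - W s \<omega>) = 0"
    and expectation_increment_square: "expectation (\<lambda>\<omega>. (W t \<omega> - W s \<omega>)\<^sup>2) = t - s"
    and expectation_increment_pow4: "expectation (\<lambda>\<omega>. (W t \<omega> - W s \<omega>) ^ 4) = 3 * (t - s)\<^sup>2"
proof -
  have "integrable M (\<lambda>\<omega>. (W t \<omega> - W s \<omega>) ^ k) \<and> expectation (\<lambda>\<omega>. W t \<omega> - W s \<omega>) = 0 \<and>
    expectation (\<lambda>\<omega>. (W t \<omega> - W s \<omega>)\<^sup>2) = t - s \<and> expectation (\<lambda>\<omega>. (W t \<omega> - W s \<omega>) ^ 4) = 3 * (t - s)\<^sup>2"
  proof (cases "s = t")
    case False
    then have st: "s < t" "0 < sqrt (t - s)" using assms by auto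
    have D: "distributed M lborel (\<lambda>\<omega>. W t \<omega> - W s \<omega>) (normal_density 0 (sqrt (t - s)))"
      using assms st by (intro W_increment_distributed)
    have E: "expectation (\<lambda>\<omega>. (W t \<omega> - W s \<omega>) ^ j) = (\<integral>x. normal_density 0 (sqrt (t - s)) x * (x - 0) ^ j \<partial>lborel)" for j
      using distributed_integral[OF D, of "\<lambda>x. x ^ j"] by simp
    have "integrable M (\<lambda>\<omega>. (W t \<omega> - W s \<omega>) ^ k)"
      using distributed_integrable[OF D, of "\<lambda>x. x ^ k"] integrable_normal_moment[OF st(2), of 0 k] by simp
    moreover have "expectation (\<lambda>\<omega>. (W t \<omega> - W s \<omega>)) = 0"
      using E[of 1] integral_normal_moment_odd[OF st(2), of 0 0] by simp
    moreover have "expectation (\<lambda>\<omega>. (W t \<omega> - W s \<omega>)\<^sup>2) = t - s"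
      using E[of 2] integral_normal_moment_even[OF st(2), of 0 1] st(1) by simp
    moreover have "expectation (\<lambda>\<omega>. (W t \<omega> - W s \<omega>) ^ 4) = 3 * (t - s)\<^sup>2"
      using E[of 4] integral_normal_moment_even[OF st(2), of 0 2] st(1)
      by (simp add: fact_numeral field_simps power2_eq_square)
    ultimately show ?thesis by blast
  qed (simp add: power_0_left)
  then show "integrable M (\<lambda>\<omega>. (W t \<omega> - W s \<omega>) ^ k)" "expectation (\<lambda>\<omega>. W t \<omega> - W s \<omega>) = 0"
    "expectation (\<lambda>\<omega>. (W t \<omega> - W s \<omega>)\<^sup>2) = t - s"
    "expectation (\<lambda>\<omega>. (W t \<omega> - W s \<omega>) ^ 4) = 3 * (t - s)\<^sup>2" by blast+
qed

text \<open>Replaces conditioning on \<open>\<F> t\<close>: a weight known at time \<open>t\<close>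
  factors out of the mean of a function of the later increment. The independence comes from pushing
  the product law forward by \<open>g\<close> in the second coordinate.\<close>

lemma
  assumes t: "0 \<le> t" "t < u" "u \<le> T"
    and U: "U \<in> borel_measurable (\<F> t)" "integrable M U"
    and g: "g \<in> borel_measurable borel" "integrable M (\<lambda>\<omega>. g (W u \<omega> - W t \<omega>))"
  shows expectation_mult_increment:
      "expectation (\<lambda>\<omega>. U \<omega> * g (W u \<omega> - W t \<omega>)) = expectation U * expectation (\<lambda>\<omega>. g (W u \<omega> - W t \<omega>) :: real)"
    and integrable_mult_increment: "integrable M (\<lambda>\<omega>. U \<omega> * g (W u \<omega> - W t \<omega>))"
proof -
  let ?D = "\<lambda>\<omega>. W u \<omega> - W t \<omega>"
  have [measurable]: "?D \<in> borel_measurable M" "U \<in> borel_measurable M" "g \<in> borel_measurable borel"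
    using t g measurable_filtration_M[OF U(1)] by (auto intro: increment_measurable)
  have eq: "distr M (borel \<Otimes>\<^sub>M borel) ((\<lambda>(x, y). (x, g y)) \<circ> (\<lambda>\<omega>. (U \<omega>, ?D \<omega>))) =
      distr (distr M borel U \<Otimes>\<^sub>M distr M borel ?D) (borel \<Otimes>\<^sub>M borel) (\<lambda>(x, y). (x, g y))"
    by (subst distr_distr[where N="borel \<Otimes>\<^sub>M borel", symmetric]) (auto simp: indep_increment[OF t U(1)])
  interpret D: prob_space "distr M borel ?D" by (rule prob_space_distr) simp
  interpret G: prob_space "distr (distr M borel ?D) borel g" by (rule D.prob_space_distr) simp
  have "distr M borel U \<Otimes>\<^sub>M distr (distr M borel ?D) borel g =
      distr (distr M borel U) borel (\<lambda>x. x) \<Otimes>\<^sub>M distr (distr M borel ?D) borel g"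
    by (simp add: distr_distr comp_def)
  also have "\<dots> = distr (distr M borel U \<Otimes>\<^sub>M distr M borel ?D) (borel \<Otimes>\<^sub>M borel) (\<lambda>(x, y). (x, g y))"
    by (rule pair_measure_distr) (auto intro: G.sigma_finite_measure_axioms)
  finally have ind: "indep_var borel U borel (\<lambda>\<omega>. g (?D \<omega>))"
    unfolding indep_var_distribution_eq using eq by (simp add: distr_distr comp_def)
  show "expectation (\<lambda>\<omega>. U \<omega> * g (W u \<omega> - W t \<omega>)) = expectation U * expectation (\<lambda>\<omega>. g (W u \<omega> - W t \<omega>))"
    by (rule indep_var_lebesgue_integral[OF ind U(2) g(2)])
  show "integrable M (\<lambda>\<omega>. U \<omega> * g (W u \<omega> - W t \<omega>))"
    by (rule indep_var_integrable[OF ind U(2) g(2)])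
qed

text \<open>Freezing the sum as soon as its bracket exceeds \<open>\<delta>\<close> keeps the weights predictable and makes
  the second moment of the frozen sum at most \<open>\<delta>\<close>.\<close>

lemma prob_increment_sum_gt:
  assumes p: "\<And>i. i \<le> n \<Longrightarrow> p i \<in> {0..T}" "\<And>i. i < n \<Longrightarrow> p i < p (Suc i)"
    and \<zeta>: "\<And>i. i < n \<Longrightarrow> \<zeta> i \<in> borel_measurable (\<F> (p i))"
    and "\<delta> \<ge> 0" "\<epsilon> > 0"
  shows "prob {\<omega> \<in> space M. \<bar>\<Sum>i<n. \<zeta> i \<omega> * (W (p (Suc i)) \<omega> - W (p i) \<omega>)\<bar> > \<epsilon>} \<le>
    prob {\<omega> \<in> space M. (\<Sum>i<n. (\<zeta> i \<omega>)\<^sup>2 * (p (Suc i) - p i)) > \<delta>} + \<delta> / \<epsilon>\<^sup>2"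
proof -
  define Q where "Q m \<omega> = (\<Sum>i<m. (\<zeta> i \<omega>)\<^sup>2 * (p (Suc i) - p i))" for m \<omega>
  \<comment> \<open>\<open>Q (Suc i)\<close> involves only weights up to index \<open>i\<close>, all
    known at time \<open>p i\<close>, so the decision to freeze is predictable. Counting the term
    \<open>i\<close> before accepting it keeps the accumulated bracket below \<open>\<delta>\<close>
    without overshoot.\<close>
  define z where "z i \<omega> = \<zeta> i \<omega> * indicator {\<omega>. Q (Suc i) \<omega> \<le> \<delta>} \<omega>" for i \<omega>
  define S where "S m \<omega> = (\<Sum>i<m. z i \<omega> * (W (p (Suc i)) \<omega> - W (p i) \<omega>))" for m \<omega>
  have pm: "p i \<le> p j" if "i \<le> j" "j \<le> n" for i j
    by (rule le_of_Suc_le[OF _ that]) (use p(2) in force)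
  have mem: "0 \<le> p i" "p i \<le> T" if "i \<le> n" for i using p(1)[OF that] by auto
  have \<zeta>': "\<zeta> i \<in> borel_measurable (\<F> (p j))" if "i \<le> j" "j < n" for i j
    using that pm[of i j] by (intro measurable_filtration_mono[OF \<zeta>]) auto
  have zF: "z i \<in> borel_measurable (\<F> (p i))" if "i < n" for i
  proof -
    have [measurable]: "Q (Suc i) \<in> borel_measurable (\<F> (p i))"
      unfolding Q_def using that \<zeta>'
      by (intro borel_measurable_sum borel_measurable_times borel_measurable_power) auto
    have [measurable]: "\<zeta> i \<in> borel_measurable (\<F> (p i))" using \<zeta> that by simp
    have "z i = (\<lambda>\<omega>. if Q (Suc i) \<omega> \<le> \<delta> then \<zeta> i \<omega> else 0)" by (auto simp: z_def)
    then show ?thesis by simp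
  qed
  have nn: "0 \<le> (\<zeta> i \<omega>)\<^sup>2 * (p (Suc i) - p i)" if "i < n" for i \<omega>
    using p(2)[OF that] by simp
  have z2: "(\<Sum>i<m. (z i \<omega>)\<^sup>2 * (p (Suc i) - p i)) \<le> min \<delta> (Q m \<omega>)" if "m \<le> n" for m \<omega>
    using that
  proof (induction m)
    case 0 then show ?case using \<open>\<delta> \<ge> 0\<close> by (simp add: Q_def)
  next
    case (Suc m)
    then have 1: "Q m \<omega> \<le> Q (Suc m) \<omega>" using nn[of m] by (simp add: Q_def)
    show ?case
      using Suc nn[of m \<omega>] 1 by (cases "Q (Suc m) \<omega> \<le> \<delta>") (auto simp: z_def Q_def)
  qed
  have zb: "(z i \<omega>)\<^sup>2 \<le> \<delta> / (p (Suc i) - p i)" if "i < n" for i \<omega>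
  proof -
    have "(z i \<omega>)\<^sup>2 * (p (Suc i) - p i) \<le> (\<Sum>i<Suc i. (z i \<omega>)\<^sup>2 * (p (Suc i) - p i))"
    proof (intro member_le_sum)
      fix j assume "j \<in> {..<Suc i} - {i}"
      then show "0 \<le> (z j \<omega>)\<^sup>2 * (p (Suc j) - p j)" using that p(2)[of j] by simp
    qed auto
    also have "\<dots> \<le> \<delta>" using z2[of "Suc i" \<omega>] that by simp
    finally show ?thesis using p(2)[OF that] by (simp add: field_simps)
  qed
  have zM: "z i \<in> borel_measurable M" if "i < n" for i
    using that mem by (intro measurable_filtration_M[OF zF]) auto
  have iz2: "integrable M (\<lambda>\<omega>. (z i \<omega>)\<^sup>2)" if "i < n" for i
    using that zM zb by (intro integrable_const_bound[of _ "\<delta> / (p (Suc i) - p i)"]) auto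
  \<comment> \<open>Orthogonality of martingale differences: \<open>S m * z m\<close> is known at
    time \<open>p m\<close>, so the cross term has mean zero.\<close>
  have S: "integrable M (\<lambda>\<omega>. (S m \<omega>)\<^sup>2) \<and> S m \<in> borel_measurable (\<F> (p m)) \<and>
      expectation (\<lambda>\<omega>. (S m \<omega>)\<^sup>2) = expectation (\<lambda>\<omega>. \<Sum>i<m. (z i \<omega>)\<^sup>2 * (p (Suc i) - p i))" if "m \<le> n" for m
    using that
  proof (induction m)
    case 0 then show ?case by (simp add: S_def)
  next
    case (Suc m)
    then have m: "m < n" and IH: "integrable M (\<lambda>\<omega>. (S m \<omega>)\<^sup>2)" "S m \<in> borel_measurable (\<F> (p m))"
      "expectation (\<lambda>\<omega>. (S m \<omega>)\<^sup>2) = expectation (\<lambda>\<omega>. \<Sum>i<m. (z i \<omega>)\<^sup>2 * (p (Suc i) - p i))" by auto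
    let ?D = "\<lambda>\<omega>. W (p (Suc m)) \<omega> - W (p m) \<omega>"
    have t: "0 \<le> p m" "p m < p (Suc m)" "p (Suc m) \<le> T" using mem m p(2) by auto
    have SM: "S m \<in> borel_measurable M" using m mem by (intro measurable_filtration_M[OF IH(2)]) auto
    have iSz: "integrable M (\<lambda>\<omega>. S m \<omega> * z m \<omega>)"
    proof (rule Bochner_Integration.integrable_bound[of M "\<lambda>\<omega>. (S m \<omega>)\<^sup>2 + (z m \<omega>)\<^sup>2"])
      show "AE \<omega> in M. norm (S m \<omega> * z m \<omega>) \<le> norm ((S m \<omega>)\<^sup>2 + (z m \<omega>)\<^sup>2)"
      proof (rule AE_I2)
        fix \<omega>
        have "2 * (\<bar>S m \<omega>\<bar> * \<bar>z m \<omega>\<bar>) \<le> (S m \<omega>)\<^sup>2 + (z m \<omega>)\<^sup>2"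
          using sum_squares_bound[of "\<bar>S m \<omega>\<bar>" "\<bar>z m \<omega>\<bar>"] by simp
        moreover have "0 \<le> \<bar>S m \<omega>\<bar> * \<bar>z m \<omega>\<bar>" by simp
        ultimately show "norm (S m \<omega> * z m \<omega>) \<le> norm ((S m \<omega>)\<^sup>2 + (z m \<omega>)\<^sup>2)"
          unfolding real_norm_def abs_mult by linarith
      qed
    qed (use IH iz2[OF m] SM zM[OF m] in auto)
    have sq: "(S (Suc m) \<omega>)\<^sup>2 = (S m \<omega>)\<^sup>2 + 2 * (S m \<omega> * z m \<omega> * ?D \<omega>) + (z m \<omega>)\<^sup>2 * (?D \<omega>)\<^sup>2" for \<omega>
      by (simp add: S_def power2_eq_square algebra_simps)
    have iD: "integrable M ?D" "integrable M (\<lambda>\<omega>. (?D \<omega>)\<^sup>2)"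
      using integrable_increment_power[of "p m" "p (Suc m)" 1] integrable_increment_power[of "p m" "p (Suc m)" 2] t by auto
    have F: "(\<lambda>\<omega>. S m \<omega> * z m \<omega>) \<in> borel_measurable (\<F> (p m))" "(\<lambda>\<omega>. (z m \<omega>)\<^sup>2) \<in> borel_measurable (\<F> (p m))"
      using IH(2) zF[OF m] by auto
    have i1: "integrable M (\<lambda>\<omega>. S m \<omega> * z m \<omega> * ?D \<omega>)" and e1: "expectation (\<lambda>\<omega>. S m \<omega> * z m \<omega> * ?D \<omega>) = 0"
      using integrable_mult_increment[OF t F(1) iSz, of "\<lambda>x. x"] expectation_mult_increment[OF t F(1) iSz, of "\<lambda>x. x"]
        iD expectation_increment[of "p m" "p (Suc m)"] t by auto
    have i2: "integrable M (\<lambda>\<omega>. (z m \<omega>)\<^sup>2 * (?D \<omega>)\<^sup>2)" and e2: "expectation (\<lambda>\<omega>. (z m \<omega>)\<^sup>2 * (?D \<omega>)\<^sup>2) =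
        expectation (\<lambda>\<omega>. (z m \<omega>)\<^sup>2) * (p (Suc m) - p m)"
      using integrable_mult_increment[OF t F(2) iz2[OF m], of "\<lambda>x. x\<^sup>2"] expectation_mult_increment[OF t F(2) iz2[OF m], of "\<lambda>x. x\<^sup>2"]
        iD expectation_increment_square[of "p m" "p (Suc m)"] t by auto
    have "expectation (\<lambda>\<omega>. (S (Suc m) \<omega>)\<^sup>2) = expectation (\<lambda>\<omega>. (S m \<omega>)\<^sup>2) + expectation (\<lambda>\<omega>. (z m \<omega>)\<^sup>2) * (p (Suc m) - p m)"
      unfolding sq using IH(1) i1 i2 e1 e2 by simp
    also have "\<dots> = expectation (\<lambda>\<omega>. \<Sum>i<Suc m. (z i \<omega>)\<^sup>2 * (p (Suc i) - p i))"
    proof -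
      have "\<And>i. i < m \<Longrightarrow> integrable M (\<lambda>\<omega>. (z i \<omega>)\<^sup>2)" using iz2 m by simp
      moreover from this have "integrable M (\<lambda>\<omega>. \<Sum>i<m. (z i \<omega>)\<^sup>2 * (p (Suc i) - p i))"
        by (intro Bochner_Integration.integrable_sum integrable_mult_left) auto
      ultimately show ?thesis unfolding IH(3) using iz2[OF m] by simp
    qed
    finally have "expectation (\<lambda>\<omega>. (S (Suc m) \<omega>)\<^sup>2) = expectation (\<lambda>\<omega>. \<Sum>i<Suc m. (z i \<omega>)\<^sup>2 * (p (Suc i) - p i))" .
    moreover have "integrable M (\<lambda>\<omega>. (S (Suc m) \<omega>)\<^sup>2)" unfolding sq using IH(1) i1 i2 by simp
    moreover have "S (Suc m) \<in> borel_measurable (\<F> (p (Suc m)))"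
    proof -
      have "S (Suc m) = (\<lambda>\<omega>. S m \<omega> + z m \<omega> * ?D \<omega>)" by (auto simp: S_def)
      moreover have "S m \<in> borel_measurable (\<F> (p (Suc m)))" "z m \<in> borel_measurable (\<F> (p (Suc m)))"
        using t IH(2) zF[OF m] by (auto intro!: measurable_filtration_mono[of _ "p m" _ "p (Suc m)"])
      moreover have "W (p m) \<in> borel_measurable (\<F> (p (Suc m)))" "W (p (Suc m)) \<in> borel_measurable (\<F> (p (Suc m)))"
        using t by (auto intro!: W_measurable_filtration)
      ultimately show ?thesis by simp
    qed
    ultimately show ?case by blast
  qed
  have Sn: "integrable M (\<lambda>\<omega>. (S n \<omega>)\<^sup>2)" "S n \<in> borel_measurable M"
    using S[of n] mem[of n] by (auto intro: measurable_filtration_M)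
  have QM: "Q n \<in> borel_measurable M"
    unfolding Q_def using mem
    by (intro borel_measurable_sum borel_measurable_times borel_measurable_power measurable_filtration_M[OF \<zeta>]) auto
  have e: "expectation (\<lambda>\<omega>. (S n \<omega>)\<^sup>2) \<le> \<delta>"
  proof -
    have "expectation (\<lambda>\<omega>. \<Sum>i<n. (z i \<omega>)\<^sup>2 * (p (Suc i) - p i)) \<le> \<delta>"
      using z2[of n] iz2 by (intro integral_le_const AE_I2 Bochner_Integration.integrable_sum) auto
    then show ?thesis using S[of n] by simp
  qed
  have "prob {\<omega> \<in> space M. \<bar>S n \<omega>\<bar> > \<epsilon>} \<le> prob {\<omega> \<in> space M. (S n \<omega>)\<^sup>2 \<ge> \<epsilon>\<^sup>2}"
    using Sn(2) \<open>\<epsilon> > 0\<close> by (intro finite_measure_mono) (auto simp: abs_le_square_iff[of \<epsilon>, symmetric])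
  also have "\<dots> \<le> expectation (\<lambda>\<omega>. (S n \<omega>)\<^sup>2) / \<epsilon>\<^sup>2"
    using Sn \<open>\<epsilon> > 0\<close> by (intro integral_Markov_inequality_measure[where A="{}"]) auto
  also have "\<dots> \<le> \<delta> / \<epsilon>\<^sup>2" using e by (simp add: divide_right_mono)
  finally have 1: "prob {\<omega> \<in> space M. \<bar>S n \<omega>\<bar> > \<epsilon>} \<le> \<delta> / \<epsilon>\<^sup>2" .
  have "prob {\<omega> \<in> space M. \<bar>\<Sum>i<n. \<zeta> i \<omega> * (W (p (Suc i)) \<omega> - W (p i) \<omega>)\<bar> > \<epsilon>} \<le>
      prob ({\<omega> \<in> space M. Q n \<omega> > \<delta>} \<union> {\<omega> \<in> space M. \<bar>S n \<omega>\<bar> > \<epsilon>})"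
  proof (rule finite_measure_mono)
    show "{\<omega> \<in> space M. Q n \<omega> > \<delta>} \<union> {\<omega> \<in> space M. \<bar>S n \<omega>\<bar> > \<epsilon>} \<in> events"
      using Sn(2) QM by measurable
    \<comment> \<open>The brackets increase with the index. If the last one is at most
      \<open>\<delta>\<close>, nothing was frozen and the two sums coincide.\<close>
    have eq: "S n \<omega> = (\<Sum>i<n. \<zeta> i \<omega> * (W (p (Suc i)) \<omega> - W (p i) \<omega>))" if "Q n \<omega> \<le> \<delta>" for \<omega>
      unfolding S_def
    proof (rule sum.cong[OF refl])
      fix i assume i: "i \<in> {..<n}"
      have "Q (Suc i) \<omega> \<le> Q n \<omega>" unfolding Q_def using i nn by (intro sum_mono2) auto
      then show "z i \<omega> * (W (p (Suc i)) \<omega> - W (p i) \<omega>) = \<zeta> i \<omega> * (W (p (Suc i)) \<omega> - W (p i) \<omega>)"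
        using that by (simp add: z_def)
    qed
    show "{\<omega> \<in> space M. \<bar>\<Sum>i<n. \<zeta> i \<omega> * (W (p (Suc i)) \<omega> - W (p i) \<omega>)\<bar> > \<epsilon>} \<subseteq>
      {\<omega> \<in> space M. Q n \<omega> > \<delta>} \<union> {\<omega> \<in> space M. \<bar>S n \<omega>\<bar> > \<epsilon>}"
    proof
      fix \<omega> assume "\<omega> \<in> {\<omega> \<in> space M. \<bar>\<Sum>i<n. \<zeta> i \<omega> * (W (p (Suc i)) \<omega> - W (p i) \<omega>)\<bar> > \<epsilon>}"
      then show "\<omega> \<in> {\<omega> \<in> space M. Q n \<omega> > \<delta>} \<union> {\<omega> \<in> space M. \<bar>S n \<omega>\<bar> > \<epsilon>}"
        using eq[of \<omega>] by (cases "Q n \<omega> \<le> \<delta>") auto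
    qed
  qed
  also have "\<dots> \<le> prob {\<omega> \<in> space M. Q n \<omega> > \<delta>} + prob {\<omega> \<in> space M. \<bar>S n \<omega>\<bar> > \<epsilon>}"
  proof (rule measure_Un_le)
    show "{\<omega> \<in> space M. Q n \<omega> > \<delta>} \<in> events" using QM by measurable
    show "{\<omega> \<in> space M. \<bar>S n \<omega>\<bar> > \<epsilon>} \<in> events" using Sn(2) by measurable
  qed
  finally show ?thesis using 1 by (simp add: Q_def)
qed

end

section \<open>Riemann sums of the Ito integral\<close>

text \<open>No grid point lies strictly inside a cell. Clamping the grid to the interval from
  \<open>a\<close> to \<open>b\<close> therefore turns each summand into an increment of
  \<open>f\<close> along the clamped grid, and the sum telescopes.\<close>

lemma telescope_indicator:
  fixes f :: "real \<Rightarrow> real" and p :: "nat \<Rightarrow> real"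
  assumes p: "\<And>l. l < r \<Longrightarrow> p l < p (Suc l)"
    and ab: "a \<le> b" "a \<in> p ` {..r}" "b \<in> p ` {..r}"
  shows "(\<Sum>l<r. (if a \<le> p l \<and> p l < b then 1 else 0) * (f (p (Suc l)) - f (p l))) = f b - f a"
proof -
  define c where "c u = max a (min b u)" for u
  have mono: "p i \<le> p j" if "i \<le> j" "j \<le> r" for i j
    by (rule le_of_Suc_le[OF _ that]) (use p in force)
  have gap: "p (Suc l) \<le> u" if u: "u \<in> p ` {..r}" "p l < u" "l < r" for l u
  proof -
    obtain k where k: "u = p k" "k \<le> r" using u(1) by auto
    have "l < k"
    proof (rule ccontr)
      assume "\<not> l < k"
      then show False using mono[of k l] k u(2,3) by simp
    qed
    then show ?thesis using mono[of "Suc l" k] k by simp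
  qed
  have "(if a \<le> p l \<and> p l < b then 1 else 0) * (f (p (Suc l)) - f (p l)) = f (c (p (Suc l))) - f (c (p l))"
    if l: "l < r" for l
  proof (cases "a \<le> p l \<and> p l < b")
    case True
    then have "c (p l) = p l" "c (p (Suc l)) = p (Suc l)"
      using gap[OF ab(3) _ l] p[OF l] ab(1) by (auto simp: c_def)
    then show ?thesis using True by simp
  next
    case False
    then have "c (p l) = c (p (Suc l))"
      using gap[OF ab(2) _ l] p[OF l] ab(1) by (auto simp: c_def min_def max_def)
    then show ?thesis using False by auto
  qed
  then have "(\<Sum>l<r. (if a \<le> p l \<and> p l < b then 1 else 0) * (f (p (Suc l)) - f (p l))) =
      (\<Sum>l<r. f (c (p (Suc l))) - f (c (p l)))" by simp
  also have "\<dots> = f (c (p r)) - f (c (p 0))" by (rule sum_lessThan_telescope)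
  also have "c (p r) = b" using ab mono by (auto simp: c_def)
  also have "c (p 0) = a" using ab mono by (auto simp: c_def)
  finally show ?thesis .
qed

lemma finite_grid_enumeration:
  fixes P :: "real set"
  assumes "finite P" "P \<noteq> {}"
  obtains p :: "nat \<Rightarrow> real" and r where "p ` {..r} = P" "\<And>l. l < r \<Longrightarrow> p l < p (Suc l)"
proof -
  let ?L = "sorted_list_of_set P"
  have L: "set ?L = P" "sorted_wrt (<) ?L" using assms by auto
  then have "?L \<noteq> []" using assms by auto
  then have len: "length ?L = Suc (length ?L - 1)" by (metis Suc_pred' length_greater_0_conv)
  show thesis
  proof (rule that[of "\<lambda>l. ?L ! l" "length ?L - 1"])
    have "{..length ?L - 1} = {..<length ?L}" using len by auto
    then show "(\<lambda>l. ?L ! l) ` {..length ?L - 1} = P"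
      using L(1) by (auto simp: set_conv_nth image_def)
    show "?L ! l < ?L ! Suc l" if "l < length ?L - 1" for l
      using L(2) that by (auto simp: sorted_wrt_nth_less)
  qed
qed

context brownian
begin

text \<open>The intervals may overlap, as they will for the difference of a Riemann sum and a simple
  integral. A common refinement of their endpoints yields adapted weights on consecutive cells. The
  event \<open>B\<close> only has to contain the outcomes with a large bracket, so the caller may
  take a convenient one.\<close>

lemma prob_step_integral_gt:
  fixes N :: nat
  assumes ab: "\<And>i. i < N \<Longrightarrow> 0 \<le> a i \<and> a i \<le> b i \<and> b i \<le> T"
    and \<xi>: "\<And>i. i < N \<Longrightarrow> \<xi> i \<in> borel_measurable (\<F> (a i))"
    and \<delta>: "\<delta> \<ge> 0" "\<epsilon> > 0" and B: "B \<in> events"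
    and sub: "\<And>\<omega>. \<omega> \<in> space M \<Longrightarrow>
      (\<integral>\<^sup>+s\<in>{0..T}. ennreal ((\<Sum>i<N. \<xi> i \<omega> * indicator {a i<..b i} s)\<^sup>2) \<partial>lborel) > ennreal \<delta> \<Longrightarrow> \<omega> \<in> B"
  shows "prob {\<omega> \<in> space M. \<bar>\<Sum>i<N. \<xi> i \<omega> * (W (b i) \<omega> - W (a i) \<omega>)\<bar> > \<epsilon>} \<le> prob B + \<delta> / \<epsilon>\<^sup>2"
proof -
  define P where "P = insert 0 (a ` {..<N} \<union> b ` {..<N})"
  have "finite P" "P \<noteq> {}" by (auto simp: P_def)
  then obtain p r where p: "p ` {..r} = P" "\<And>l. l < r \<Longrightarrow> p l < p (Suc l)"
    by (rule finite_grid_enumeration) (rule that)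
  have P: "P \<subseteq> {0..T}" using ab T_pos by (force simp: P_def)
  have mono: "p i \<le> p j" if "i \<le> j" "j \<le> r" for i j
    by (rule le_of_Suc_le[OF _ that]) (use p in force)
  have inP: "a i \<in> p ` {..r}" "b i \<in> p ` {..r}" if "i < N" for i
    using that unfolding p(1) by (auto simp: P_def)
  define J where "J l i = (if a i \<le> p l \<and> p l < b i then 1 else 0 :: real)" for l i
  define \<zeta> where "\<zeta> l \<omega> = (\<Sum>i<N. \<xi> i \<omega> * J l i)" for l \<omega>
  have pT: "p l \<in> {0..T}" if "l \<le> r" for l using p(1) P that by auto
  have \<zeta>_meas: "\<zeta> l \<in> borel_measurable (\<F> (p l))" if "l < r" for l
    unfolding \<zeta>_def
  proof (rule borel_measurable_sum)
    fix i assume "i \<in> {..<N}"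
    then show "(\<lambda>\<omega>. \<xi> i \<omega> * J l i) \<in> borel_measurable (\<F> (p l))"
      using measurable_filtration_mono[OF \<xi>, of i "p l"] by (cases "a i \<le> p l") (auto simp: J_def)
  qed
  have sum_eq: "(\<Sum>l<r. \<zeta> l \<omega> * (W (p (Suc l)) \<omega> - W (p l) \<omega>)) = (\<Sum>i<N. \<xi> i \<omega> * (W (b i) \<omega> - W (a i) \<omega>))" for \<omega>
  proof -
    have "(\<Sum>l<r. \<zeta> l \<omega> * (W (p (Suc l)) \<omega> - W (p l) \<omega>)) =
        (\<Sum>l<r. \<Sum>i<N. \<xi> i \<omega> * (J l i * (W (p (Suc l)) \<omega> - W (p l) \<omega>)))"
      by (simp add: \<zeta>_def sum_distrib_right mult.assoc)
    also have "\<dots> = (\<Sum>i<N. \<Sum>l<r. \<xi> i \<omega> * (J l i * (W (p (Suc l)) \<omega> - W (p l) \<omega>)))"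
      by (rule sum.swap)
    also have "\<dots> = (\<Sum>i<N. \<xi> i \<omega> * (\<Sum>l<r. J l i * (W (p (Suc l)) \<omega> - W (p l) \<omega>)))"
      by (simp add: sum_distrib_left)
    also have "\<dots> = (\<Sum>i<N. \<xi> i \<omega> * (W (b i) \<omega> - W (a i) \<omega>))"
    proof (intro sum.cong refl arg_cong2[where f="(*)"])
      fix i assume "i \<in> {..<N}"
      then show "(\<Sum>l<r. J l i * (W (p (Suc l)) \<omega> - W (p l) \<omega>)) = W (b i) \<omega> - W (a i) \<omega>"
        unfolding J_def using telescope_indicator[of r p "a i" "b i" "\<lambda>u. W u \<omega>"] p(2) ab inP by auto
    qed
    finally show ?thesis .
  qed
  have step: "(\<Sum>i<N. \<xi> i \<omega> * indicator {a i<..b i} s) = \<zeta> l \<omega>" if l: "l < r" and s: "s \<in> {p l<..p (Suc l)}" for l s \<omega>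
    unfolding \<zeta>_def
  proof (intro sum.cong refl arg_cong2[where f="(*)"])
    fix i assume "i \<in> {..<N}"
    then have i: "i < N" by simp
    have gap: "u \<le> p l \<or> p (Suc l) \<le> u" if u: "u \<in> p ` {..r}" for u
    proof -
      obtain k where k: "u = p k" "k \<le> r" using u by auto
      then show ?thesis using mono[of k l] mono[of "Suc l" k] l by (cases "k \<le> l") auto
    qed
    show "indicator {a i<..b i} s = J l i"
      using gap[OF inP(1)[OF i]] gap[OF inP(2)[OF i]] s p(2)[OF l] by (auto simp: J_def)
  qed
  have bracket: "ennreal (\<Sum>l<r. (\<zeta> l \<omega>)\<^sup>2 * (p (Suc l) - p l)) \<le>
      (\<integral>\<^sup>+s\<in>{0..T}. ennreal ((\<Sum>i<N. \<xi> i \<omega> * indicator {a i<..b i} s)\<^sup>2) \<partial>lborel)" for \<omega>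
  proof -
    have disj: "disjoint_family_on (\<lambda>l. {p l<..p (Suc l)}) {..<r}"
      unfolding disjoint_family_on_def
    proof (intro ballI impI)
      fix k l assume kl: "k \<in> {..<r}" "l \<in> {..<r}" "k \<noteq> l"
      then have "p (Suc k) \<le> p l \<or> p (Suc l) \<le> p k"
        using mono[of "Suc k" l] mono[of "Suc l" k] by (cases "k < l") auto
      then show "{p k<..p (Suc k)} \<inter> {p l<..p (Suc l)} = {}" by auto
    qed
    have "ennreal (\<Sum>l<r. (\<zeta> l \<omega>)\<^sup>2 * (p (Suc l) - p l)) = (\<Sum>l<r. ennreal ((\<zeta> l \<omega>)\<^sup>2) * emeasure lborel {p l<..p (Suc l)})"
      using p(2) by (subst sum_ennreal[symmetric]) (auto intro!: sum.cong mult_nonneg_nonneg simp: ennreal_mult less_imp_le)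
    also have "\<dots> = (\<integral>\<^sup>+s. (\<Sum>l<r. ennreal ((\<zeta> l \<omega>)\<^sup>2) * indicator {p l<..p (Suc l)} s) \<partial>lborel)"
      by (subst nn_integral_sum) (auto simp: nn_integral_cmult_indicator)
    also have "\<dots> \<le> (\<integral>\<^sup>+s\<in>{0..T}. ennreal ((\<Sum>i<N. \<xi> i \<omega> * indicator {a i<..b i} s)\<^sup>2) \<partial>lborel)"
    proof (rule nn_integral_mono)
      fix s
      show "(\<Sum>l<r. ennreal ((\<zeta> l \<omega>)\<^sup>2) * indicator {p l<..p (Suc l)} s) \<le>
          ennreal ((\<Sum>i<N. \<xi> i \<omega> * indicator {a i<..b i} s)\<^sup>2) * indicator {0..T} s"
      proof (cases "\<exists>l<r. s \<in> {p l<..p (Suc l)}")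
        case True
        then obtain l where l: "l < r" "s \<in> {p l<..p (Suc l)}" by blast
        have "(\<Sum>k<r. ennreal ((\<zeta> k \<omega>)\<^sup>2) * indicator {p k<..p (Suc k)} s) =
            (\<Sum>k\<in>{l}. ennreal ((\<zeta> k \<omega>)\<^sup>2) * indicator {p k<..p (Suc k)} s)"
        proof (intro sum.mono_neutral_right ballI)
          fix k assume "k \<in> {..<r} - {l}"
          then have "{p k<..p (Suc k)} \<inter> {p l<..p (Suc l)} = {}"
            using l by (intro disjoint_family_onD[OF disj]) auto
          then have "s \<notin> {p k<..p (Suc k)}" using l by blast
          then show "ennreal ((\<zeta> k \<omega>)\<^sup>2) * indicator {p k<..p (Suc k)} s = 0" by simp
        qed (use l in auto)
        also have "\<dots> = ennreal ((\<Sum>i<N. \<xi> i \<omega> * indicator {a i<..b i} s)\<^sup>2)"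
          using l step[OF l] by simp
        finally show ?thesis using l pT[of l] pT[of "Suc l"] by simp
      next
        case False
        then have "(\<Sum>l<r. ennreal ((\<zeta> l \<omega>)\<^sup>2) * indicator {p l<..p (Suc l)} s) = 0"
          by (intro sum.neutral) auto
        then show ?thesis by simp
      qed
    qed
    finally show ?thesis .
  qed
  have "prob {\<omega> \<in> space M. \<bar>\<Sum>i<N. \<xi> i \<omega> * (W (b i) \<omega> - W (a i) \<omega>)\<bar> > \<epsilon>} =
      prob {\<omega> \<in> space M. \<bar>\<Sum>l<r. \<zeta> l \<omega> * (W (p (Suc l)) \<omega> - W (p l) \<omega>)\<bar> > \<epsilon>}"
    by (simp add: sum_eq)
  also have "\<dots> \<le> prob {\<omega> \<in> space M. (\<Sum>l<r. (\<zeta> l \<omega>)\<^sup>2 * (p (Suc l) - p l)) > \<delta>} + \<delta> / \<epsilon>\<^sup>2"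
    using pT p(2) \<zeta>_meas \<delta> by (intro prob_increment_sum_gt) auto
  also have "prob {\<omega> \<in> space M. (\<Sum>l<r. (\<zeta> l \<omega>)\<^sup>2 * (p (Suc l) - p l)) > \<delta>} \<le> prob B"
  proof (rule finite_measure_mono[OF _ B], rule subsetI)
    fix \<omega> assume "\<omega> \<in> {\<omega> \<in> space M. (\<Sum>l<r. (\<zeta> l \<omega>)\<^sup>2 * (p (Suc l) - p l)) > \<delta>}"
    then have w: "\<omega> \<in> space M" "ennreal \<delta> < ennreal (\<Sum>l<r. (\<zeta> l \<omega>)\<^sup>2 * (p (Suc l) - p l))"
      using \<delta>(1) by (auto simp: ennreal_less_iff)
    then show "\<omega> \<in> B" by (intro sub order.strict_trans2[OF _ bracket])
  qed
  finally show ?thesis by simp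
qed

text \<open>The modulus of continuity of a path depends on the outcome; discarding an event of small
  probability makes it uniform. The events are defined with rational times, hence measurable, and
  increase to the whole space because the paths are uniformly continuous.\<close>

lemma continuous_process_modulus:
  assumes Z: "continuous_process M T Z" and "c > 0" "\<theta> > 0"
  obtains d E where "d > 0" "E \<in> events" "prob (space M - E) \<le> \<theta>"
    "\<And>\<omega> s t. \<omega> \<in> E \<Longrightarrow> s \<in> {0..T} \<Longrightarrow> t \<in> {0..T} \<Longrightarrow> \<bar>s - t\<bar> < d \<Longrightarrow> \<bar>Z s \<omega> - Z t \<omega>\<bar> \<le> c"
proof -
  define D where "D = \<rat> \<inter> {0..T}"
  have D: "countable D" "D \<subseteq> {0..T}" by (auto simp: D_def countable_rat)
  have Zm: "Z t \<in> borel_measurable M" if "t \<in> {0..T}" for t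
    using Z that by (auto simp: continuous_process_def)
  have Zc: "continuous_on {0..T} (\<lambda>t. Z t \<omega>)" if "\<omega> \<in> space M" for \<omega>
    using Z that by (auto simp: continuous_process_def)
  define E where "E n = {\<omega> \<in> space M. \<forall>s\<in>D. \<forall>t\<in>D. \<bar>s - t\<bar> < 1 / real (Suc n) \<longrightarrow> \<bar>Z s \<omega> - Z t \<omega>\<bar> \<le> c}" for n
  have Em: "E n \<in> events" for n
    unfolding E_def
  proof (intro sets.sets_Collect_countable_All' sets.sets_Collect_imp D(1))
    fix s t assume "s \<in> D" "t \<in> D"
    then have [measurable]: "Z s \<in> borel_measurable M" "Z t \<in> borel_measurable M" using D Zm by auto
    show "{\<omega> \<in> space M. \<bar>Z s \<omega> - Z t \<omega>\<bar> \<le> c} \<in> events" by measurable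
  qed auto
  have inc: "incseq E"
  proof (rule incseq_SucI)
    fix n
    have "1 / real (Suc (Suc n)) \<le> 1 / real (Suc n)" by (simp add: field_simps)
    then have "u < 1 / real (Suc n)" if "u < 1 / real (Suc (Suc n))" for u using that by linarith
    then show "E n \<subseteq> E (Suc n)" unfolding E_def by blast
  qed
  have "(\<Union>n. E n) = space M"
  proof (intro equalityI subsetI)
    fix \<omega> assume w: "\<omega> \<in> space M"
    have "uniformly_continuous_on {0..T} (\<lambda>t. Z t \<omega>)"
      using Zc[OF w] by (intro compact_uniformly_continuous) auto
    from this[unfolded uniformly_continuous_on_def dist_real_def, rule_format, OF \<open>c > 0\<close>]
    obtain d where d: "d > 0" "\<And>s t. s \<in> {0..T} \<Longrightarrow> t \<in> {0..T} \<Longrightarrow> \<bar>s - t\<bar> < d \<Longrightarrow> \<bar>Z s \<omega> - Z t \<omega>\<bar> < c"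
      by auto
    obtain n where "inverse (real (Suc n)) < d" using reals_Archimedean[OF d(1)] by blast
    then have "u < d" if "u < 1 / real (Suc n)" for u using that by (simp add: inverse_eq_divide)
    then have "\<omega> \<in> E n" unfolding E_def
      by (intro CollectI conjI w ballI impI less_imp_le d(2)) (use D(2) in auto)
    then show "\<omega> \<in> (\<Union>n. E n)" by blast
  qed (auto simp: E_def)
  moreover have "(\<lambda>n. prob (E n)) \<longlonglongrightarrow> prob (\<Union>n. E n)"
    by (rule finite_Lim_measure_incseq) (use Em inc in auto)
  ultimately have "(\<lambda>n. prob (E n)) \<longlonglongrightarrow> 1" by (simp add: prob_space)
  then have "\<forall>\<^sub>F n in sequentially. prob (E n) > 1 - \<theta>"
    using \<open>\<theta> > 0\<close> by (auto intro: order_tendstoD)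
  then obtain n where n: "prob (E n) > 1 - \<theta>" by (auto simp: eventually_sequentially)
  show thesis
  proof (rule that[of "1 / real (Suc n)" "E n"])
    show "prob (space M - E n) \<le> \<theta>" using n Em by (simp add: prob_compl)
    fix \<omega> s t assume w: "\<omega> \<in> E n" and st: "s \<in> {0..T}" "t \<in> {0..T}" "\<bar>s - t\<bar> < 1 / real (Suc n)"
    have w': "\<omega> \<in> space M" using w by (simp add: E_def)
    show "\<bar>Z s \<omega> - Z t \<omega>\<bar> \<le> c"
    proof (rule field_le_epsilon)
      fix e :: real assume "e > 0"
      then obtain d where d: "d > 0" "\<And>s t. s \<in> {0..T} \<Longrightarrow> t \<in> {0..T} \<Longrightarrow> \<bar>s - t\<bar> < d \<Longrightarrow> \<bar>Z s \<omega> - Z t \<omega>\<bar> < e / 2"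
        using compact_uniformly_continuous[OF Zc[OF w'] compact_Icc, unfolded uniformly_continuous_on_def
          dist_real_def, rule_format, OF half_gt_zero[OF \<open>e > 0\<close>]] by auto
      \<comment> \<open>The margin that \<open>\<bar>s - t\<bar>\<close> leaves is shared between
        rational approximants of \<open>s\<close> and \<open>t\<close>, so that their distance stays
        below \<open>1 / Suc n\<close>.\<close>
      define g where "g = min d ((1 / real (Suc n) - \<bar>s - t\<bar>) / 2)"
      have g: "g > 0" "g \<le> d" "\<bar>s - t\<bar> + 2 * g \<le> 1 / real (Suc n)"
      proof -
        have "a + 2 * g \<le> q" if "g \<le> (q - a) / 2" for a q :: real using that by (simp add: field_simps)
        moreover have "g \<le> (1 / real (Suc n) - \<bar>s - t\<bar>) / 2" unfolding g_def by (rule min.cobounded2)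
        ultimately show "\<bar>s - t\<bar> + 2 * g \<le> 1 / real (Suc n)" by blast
      qed (use d st in \<open>auto simp: g_def\<close>)
      have near: "\<exists>q\<in>D. \<bar>q - u\<bar> < g" if u: "u \<in> {0..T}" for u
      proof -
        have "max 0 (u - g) < min T (u + g)" using u g T_pos by auto
        then obtain q where "q \<in> \<rat>" "max 0 (u - g) < q" "q < min T (u + g)" using Rats_dense_in_real by blast
        then show ?thesis by (intro bexI[of _ q]) (auto simp: D_def)
      qed
      obtain q where q: "q \<in> D" "\<bar>q - s\<bar> < g" using near[OF st(1)] by blast
      obtain q' where q': "q' \<in> D" "\<bar>q' - t\<bar> < g" using near[OF st(2)] by blast
      have "\<bar>q - q'\<bar> < 1 / real (Suc n)" using q q' g by linarith
      then have "\<bar>Z q \<omega> - Z q' \<omega>\<bar> \<le> c" using w q(1) q'(1) by (auto simp: E_def)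
      moreover have "\<bar>Z q \<omega> - Z s \<omega>\<bar> < e / 2" "\<bar>Z q' \<omega> - Z t \<omega>\<bar> < e / 2"
        using q q' g(2) subsetD[OF D(2)] st by (auto intro!: d(2) simp del: less_divide_eq_numeral1)
      ultimately show "\<bar>Z s \<omega> - Z t \<omega>\<bar> \<le> c + e" by linarith
    qed
  qed (use Em in auto)
qed

end

section \<open>Uniform grids and Riemann sums of a continuous integrand\<close>

lemma sum_lessThan_add:
  fixes g :: "nat \<Rightarrow> real"
  shows "(\<Sum>l<m + i. g l) = (\<Sum>l<m. g l) + (\<Sum>j<i. g (m + j))"
  by (induction i) simp_all

lemma grid_indicator_sum:
  fixes T s :: real and n i :: nat and f :: "nat \<Rightarrow> real"
  assumes "T > 0" "n > 0" "0 < s" "s \<le> i * T / n"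
  obtains k where "k < i" "s - T / n \<le> k * T / n" "k * T / n < s"
    "(\<Sum>j<i. f j * indicator {j * T / n<..(Suc j) * T / n} s) = f k"
proof -
  define y where "y = s * n / T"
  have y: "0 < y" "y \<le> i" using assms by (auto simp: y_def field_simps)
  \<comment> \<open>Cells are open on the left and closed on the right, so the index is the ceiling
    minus one and not the floor.\<close>
  define k where "k = nat (\<lceil>y\<rceil> - 1)"
  have "\<lceil>y\<rceil> \<ge> 1" using y(1) by linarith
  then have k: "real k < y" "y \<le> real k + 1" unfolding k_def by (auto simp: of_nat_nat) linarith+
  have iff: "s \<in> {j * T / n<..(Suc j) * T / n} \<longleftrightarrow> j = k" for j :: nat
  proof -
    have "s \<in> {j * T / n<..(Suc j) * T / n} \<longleftrightarrow> real j < y \<and> y \<le> real j + 1"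
      using assms(1,2) by (auto simp: y_def field_simps)
    then show ?thesis using k by auto
  qed
  have ki: "k < i" using k y by linarith
  have s: "k * T / n < s" "s \<le> (Suc k) * T / n" using iff[of k] by auto
  show thesis
  proof (rule that[OF ki _ s(1)])
    show "s - T / n \<le> k * T / n" using s(2) by (simp add: distrib_right add_divide_distrib)
    have "(\<Sum>j<i. f j * indicator {j * T / n<..(Suc j) * T / n} s) = (\<Sum>j<i. if j = k then f j else 0)"
      using iff by (intro sum.cong) (auto simp: indicator_def)
    then show "(\<Sum>j<i. f j * indicator {j * T / n<..(Suc j) * T / n} s) = f k" using ki by simp
  qed
qed

context brownian
begin

lemma grid_mem: "i \<le> n \<Longrightarrow> n > 0 \<Longrightarrow> real i * T / real n \<in> {0..T}"
  using T_pos by (auto simp: field_simps)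

lemma grid_mono: "i \<le> j \<Longrightarrow> real i * T / real n \<le> real j * T / real n"
  using T_pos by (intro divide_right_mono mult_right_mono) auto

text \<open>The Riemann sum minus an approximating simple integral is a single step integral, whose
  bracket is estimated through \<open>H\<close>: the simple integrand is close to \<open>H\<close>
  by the choice of \<open>k\<close>, the Riemann integrand by the modulus of continuity of
  \<open>H\<close>. Since \<open>k\<close> is fixed first and the modulus holds for all times,
  \<open>n0\<close> is uniform in \<open>i\<close>.\<close>

lemma ito_integral_grid:
  assumes ito: "ito_integral M \<F> T W H I" and Hc: "continuous_process M T H" and Had: "adapted \<F> T H"
    and "\<epsilon> > 0" "\<theta> > 0"
  shows "\<exists>n0::nat. \<forall>n\<ge>n0. n > 0 \<longrightarrow> (\<forall>i\<le>n. prob {\<omega> \<in> space M.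
    \<bar>(\<Sum>j<i. H (j * T / n) \<omega> * (W (Suc j * T / n) \<omega> - W (j * T / n) \<omega>)) - I (i * T / n) \<omega>\<bar> > \<epsilon>} \<le> \<theta>)"
proof -
  \<comment> \<open>Half of \<open>\<epsilon>\<close> goes to the step integral and half to the
    distance between the simple integral and \<open>I\<close>. The bracket budget
    \<open>\<delta>\<close> is split evenly between \<open>2 * c\<^sup>2 * T\<close> and twice the
    error of the simple integrand. The term \<open>\<delta> / e\<^sup>2\<close> is one quarter of
    \<open>\<theta>\<close>; three exceptional events take the rest.\<close>
  define e where "e = \<epsilon> / 2"
  define \<delta> where "\<delta> = \<theta> / 4 * e\<^sup>2"
  define c where "c = sqrt (\<delta> / (4 * T))"
  have pos: "e > 0" "\<delta> > 0" "c > 0" using \<open>\<epsilon> > 0\<close> \<open>\<theta> > 0\<close> T_pos by (auto simp: e_def \<delta>_def c_def)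
  have c2: "c\<^sup>2 = \<delta> / (4 * T)" using pos T_pos by (simp add: c_def)
  obtain S where S: "\<forall>k. simple_integrand M \<F> T (S k)"
    and S1: "null_in_probability M (\<lambda>k \<omega>. \<integral>\<^sup>+s\<in>{0..T}. ennreal ((simple_process (S k) s \<omega> - H s \<omega>)\<^sup>2) \<partial>lborel)"
    and S2: "null_in_probability M (\<lambda>k \<omega>. SUP t\<in>{0..T}. ennreal \<bar>simple_integral W (S k) t \<omega> - I t \<omega>\<bar>)"
    using ito unfolding ito_integral_def by blast
  define Y where "Y k \<omega> = (\<integral>\<^sup>+s\<in>{0..T}. ennreal ((simple_process (S k) s \<omega> - H s \<omega>)\<^sup>2) \<partial>lborel)" for k \<omega>
  define V where "V k \<omega> = (SUP t\<in>{0..T}. ennreal \<bar>simple_integral W (S k) t \<omega> - I t \<omega>\<bar>)" for k \<omega>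
  have [measurable]: "Y k \<in> borel_measurable M" "V k \<in> borel_measurable M" for k
    using S1 S2 unfolding null_in_probability_def Y_def[symmetric] V_def[symmetric] by auto
  have "(\<lambda>k. prob {\<omega> \<in> space M. Y k \<omega> > ennreal (\<delta> / 4)}) \<longlonglongrightarrow> 0"
    using S1 pos unfolding null_in_probability_def Y_def[symmetric] by auto
  moreover have "(\<lambda>k. prob {\<omega> \<in> space M. V k \<omega> > ennreal e}) \<longlonglongrightarrow> 0"
    using S2 pos unfolding null_in_probability_def V_def[symmetric] by auto
  ultimately have "\<forall>\<^sub>F k in sequentially. prob {\<omega> \<in> space M. Y k \<omega> > ennreal (\<delta> / 4)} < \<theta> / 4 \<and>
      prob {\<omega> \<in> space M. V k \<omega> > ennreal e} < \<theta> / 4"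
    using \<open>\<theta> > 0\<close> by (intro eventually_conj order_tendstoD) auto
  then obtain k where k: "prob {\<omega> \<in> space M. Y k \<omega> > ennreal (\<delta> / 4)} < \<theta> / 4"
      "prob {\<omega> \<in> space M. V k \<omega> > ennreal e} < \<theta> / 4"
    by (auto simp: eventually_sequentially)
  obtain m \<tau> \<xi> where Sk: "S k = (m, \<tau>, \<xi>)" by (metis prod_cases3)
  have \<tau>: "\<And>i. i \<le> m \<Longrightarrow> \<tau> i \<in> {0..T}" "\<And>i. i < m \<Longrightarrow> \<tau> i \<le> \<tau> (Suc i)"
    and \<xi>: "\<And>i. i < m \<Longrightarrow> \<xi> i \<in> borel_measurable (\<F> (\<tau> i))"
    using S[rule_format, of k] by (auto simp: Sk simple_integrand_def)
  obtain d E where d: "d > 0" and E: "E \<in> events" "prob (space M - E) \<le> \<theta> / 4"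
    and mod: "\<And>\<omega> s t. \<omega> \<in> E \<Longrightarrow> s \<in> {0..T} \<Longrightarrow> t \<in> {0..T} \<Longrightarrow> \<bar>s - t\<bar> < d \<Longrightarrow> \<bar>H s \<omega> - H t \<omega>\<bar> \<le> c"
    by (rule continuous_process_modulus[OF Hc pos(3), of "\<theta> / 4"]) (use \<open>\<theta> > 0\<close> that in auto)
  obtain n0 :: nat where n0: "T / d < real n0" using reals_Archimedean2 by blast
  define B where "B = (space M - E) \<union> {\<omega> \<in> space M. Y k \<omega> > ennreal (\<delta> / 4)}"
  have B: "B \<in> events" using E unfolding B_def by auto
  have PB: "prob B \<le> \<theta> / 2"
  proof -
    have "prob B \<le> prob (space M - E) + prob {\<omega> \<in> space M. Y k \<omega> > ennreal (\<delta> / 4)}"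
      unfolding B_def using E by (intro measure_Un_le) auto
    then show ?thesis using k E by simp
  qed
  show ?thesis
  proof (intro exI[of _ n0] allI impI)
    fix n i assume n: "n \<ge> n0" "n > 0" and i: "i \<le> n"
    define t where "t = real i * T / real n"
    have t: "t \<in> {0..T}" unfolding t_def by (rule grid_mem[OF i n(2)])
    have Tn: "T / n < d"
    proof -
      have "T / d < real n" using n0 n(1) by linarith
      then show ?thesis using d n(2) by (simp add: field_simps)
    qed
    \<comment> \<open>The first \<open>m\<close> indices carry the negated simple integrand stopped
      at \<open>t\<close>, the next \<open>i\<close> the cells of the Riemann sum. A weight with
      \<open>\<tau> l > t\<close> is replaced by zero, since it need not be known at the stopped
      time \<open>t\<close>; its stopped interval is empty.\<close>
    define a where "a l = (if l < m then min (\<tau> l) t else real (l - m) * T / n)" for l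
    define b where "b l = (if l < m then min (\<tau> (Suc l)) t else real (Suc (l - m)) * T / n)" for l
    define z where "z l = (if l < m then (if \<tau> l \<le> t then (\<lambda>\<omega>. - \<xi> l \<omega>) else (\<lambda>_. 0)) else H (real (l - m) * T / n))" for l
    have ab: "0 \<le> a l \<and> a l \<le> b l \<and> b l \<le> T" if l: "l < m + i" for l
    proof (cases "l < m")
      case True
      then show ?thesis using \<tau>(1)[of l] \<tau>(1)[of "Suc l"] \<tau>(2)[of l] t by (auto simp: a_def b_def)
    next
      case False
      then have "Suc (l - m) \<le> n" using l i by linarith
      then show ?thesis using False grid_mem[of "Suc (l - m)" n] grid_mem[of "l - m" n] grid_mono[of "l - m" "Suc (l - m)" n] n(2)
        by (auto simp: a_def b_def)
    qed
    have zF: "z l \<in> borel_measurable (\<F> (a l))" if l: "l < m + i" for l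
    proof (cases "l < m")
      case True
      then show ?thesis using \<xi>[OF True] by (auto simp: z_def a_def)
    next
      case False
      then have "l - m \<le> n" using l i by linarith
      then show ?thesis using False Had grid_mem[of "l - m" n] n(2) by (auto simp: z_def a_def adapted_def)
    qed
    have sum_split: "(\<Sum>l<m + i. z l \<omega> * f (a l) (b l)) =
        (\<Sum>j<i. H (j * T / n) \<omega> * f (j * T / n) (Suc j * T / n)) -
        (\<Sum>l<m. (if \<tau> l \<le> t then \<xi> l \<omega> else 0) * f (min (\<tau> l) t) (min (\<tau> (Suc l)) t))" for \<omega> f
    proof -
      have "(\<Sum>l<m. z l \<omega> * f (a l) (b l)) = (\<Sum>l<m. - ((if \<tau> l \<le> t then \<xi> l \<omega> else 0) * f (min (\<tau> l) t) (min (\<tau> (Suc l)) t)))"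
        by (intro sum.cong) (auto simp: z_def a_def b_def)
      moreover have "(\<Sum>j<i. z (m + j) \<omega> * f (a (m + j)) (b (m + j))) = (\<Sum>j<i. H (j * T / n) \<omega> * f (j * T / n) (Suc j * T / n))"
        by (intro sum.cong) (auto simp: z_def a_def b_def)
      ultimately show ?thesis unfolding sum_lessThan_add by (simp add: sum_negf)
    qed
    have sum_W: "(\<Sum>l<m + i. z l \<omega> * (W (b l) \<omega> - W (a l) \<omega>)) =
        (\<Sum>j<i. H (j * T / n) \<omega> * (W (Suc j * T / n) \<omega> - W (j * T / n) \<omega>)) - simple_integral W (S k) t \<omega>" for \<omega>
    proof -
      have "(\<Sum>l<m. (if \<tau> l \<le> t then \<xi> l \<omega> else 0) * (W (min (\<tau> (Suc l)) t) \<omega> - W (min (\<tau> l) t) \<omega>)) =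
          simple_integral W (S k) t \<omega>"
        unfolding Sk simple_integral_def prod.case
      proof (rule sum.cong[OF refl])
        fix l assume "l \<in> {..<m}"
        then have "\<tau> l \<le> \<tau> (Suc l)" using \<tau>(2) by simp
        then show "(if \<tau> l \<le> t then \<xi> l \<omega> else 0) * (W (min (\<tau> (Suc l)) t) \<omega> - W (min (\<tau> l) t) \<omega>) =
            \<xi> l \<omega> * (W (min (\<tau> (Suc l)) t) \<omega> - W (min (\<tau> l) t) \<omega>)" by (auto simp: min_def)
      qed
      then show ?thesis using sum_split[of \<omega> "\<lambda>a b. W b \<omega> - W a \<omega>"] by simp
    qed
    have bound: "(\<Sum>l<m + i. z l \<omega> * indicator {a l<..b l} s)\<^sup>2 \<le> 2 * c\<^sup>2 + 2 * (simple_process (S k) s \<omega> - H s \<omega>)\<^sup>2"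
      if w: "\<omega> \<in> E" and s: "s \<in> {0..T}" for \<omega> s
    proof (cases "0 < s \<and> s \<le> t")
      case False
      have "(\<Sum>l<m + i. z l \<omega> * indicator {a l<..b l} s) = 0"
      proof (rule sum.neutral, rule ballI)
        fix l assume "l \<in> {..<m + i}"
        then have l: "l < m + i" by simp
        have "b l \<le> t" using grid_mono[of "Suc (l - m)" i n] l by (auto simp: b_def t_def)
        then have "s \<notin> {a l<..b l}" using False s ab[OF l] by auto
        then show "z l \<omega> * indicator {a l<..b l} s = 0" by simp
      qed
      then show ?thesis by simp
    next
      case True
      obtain j where j: "j < i" "s - T / n \<le> j * T / n" "j * T / n < s"
        "(\<Sum>j<i. H (j * T / n) \<omega> * indicator {j * T / n<..(Suc j) * T / n} s) = H (j * T / n) \<omega>"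
        by (rule grid_indicator_sum[OF T_pos n(2), of s i "\<lambda>j. H (j * T / n) \<omega>"]) (use True that in \<open>auto simp: t_def\<close>)
      have "(\<Sum>l<m. (if \<tau> l \<le> t then \<xi> l \<omega> else 0) * indicator {min (\<tau> l) t<..min (\<tau> (Suc l)) t} s) = simple_process (S k) s \<omega>"
        unfolding Sk simple_process_def using True by (auto intro!: sum.cong simp: indicator_def)
      then have eq: "(\<Sum>l<m + i. z l \<omega> * indicator {a l<..b l} s) = H (j * T / n) \<omega> - simple_process (S k) s \<omega>"
        using sum_split[of \<omega> "\<lambda>a b. indicator {a<..b} s"] j(4) by simp
      have "real j * T / n \<in> {0..T}" using grid_mem[of j n] j(1) i n(2) by simp
      then have "\<bar>H (j * T / n) \<omega> - H s \<omega>\<bar> \<le> c" using mod[OF w _ s] j(2,3) Tn by auto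
      then have "(H (j * T / n) \<omega> - H s \<omega>)\<^sup>2 \<le> c\<^sup>2" using pos by (metis abs_ge_zero power2_abs power_mono)
      moreover have "(p + q)\<^sup>2 \<le> 2 * p\<^sup>2 + 2 * q\<^sup>2" for p q :: real
        using sum_squares_bound[of p q] by (simp add: power2_sum)
      from this[of "H (j * T / n) \<omega> - H s \<omega>" "H s \<omega> - simple_process (S k) s \<omega>"]
      have "(H (j * T / n) \<omega> - simple_process (S k) s \<omega>)\<^sup>2 \<le>
          2 * (H (j * T / n) \<omega> - H s \<omega>)\<^sup>2 + 2 * (simple_process (S k) s \<omega> - H s \<omega>)\<^sup>2"
        by (simp add: power2_commute)
      ultimately show ?thesis unfolding eq by linarith
    qed
    have sub: "\<omega> \<in> B" if w: "\<omega> \<in> space M"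
      and big: "(\<integral>\<^sup>+s\<in>{0..T}. ennreal ((\<Sum>l<m + i. z l \<omega> * indicator {a l<..b l} s)\<^sup>2) \<partial>lborel) > ennreal \<delta>" for \<omega>
    proof (rule ccontr)
      assume "\<omega> \<notin> B"
      then have wE: "\<omega> \<in> E" and Yk: "Y k \<omega> \<le> ennreal (\<delta> / 4)" using w by (auto simp: B_def)
      have Hm: "(\<lambda>s. H s \<omega> * indicator {0..T} s) \<in> borel_measurable borel"
        using Hc w borel_measurable_continuous_on_indicator[of "{0..T}" "\<lambda>s. H s \<omega>"]
        by (simp add: continuous_process_def mult.commute)
      have Sm: "(\<lambda>s. simple_process (S k) s \<omega>) \<in> borel_measurable borel"
        unfolding Sk simple_process_def prod.case
        by (intro borel_measurable_sum borel_measurable_times borel_measurable_const borel_measurable_indicator) auto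
      have meas: "(\<lambda>s. ennreal ((simple_process (S k) s \<omega> - H s \<omega>)\<^sup>2) * indicator {0..T} s) \<in> borel_measurable lborel"
      proof -
        have "(\<lambda>s. ennreal ((simple_process (S k) s \<omega> - H s \<omega>)\<^sup>2) * indicator {0..T} s) =
            (\<lambda>s. ennreal ((simple_process (S k) s \<omega> - H s \<omega> * indicator {0..T} s)\<^sup>2) * indicator {0..T} s)"
          by (auto simp: indicator_def)
        moreover have "\<dots> \<in> borel_measurable borel" using Hm Sm by measurable
        ultimately show ?thesis by simp
      qed
      have "(\<integral>\<^sup>+s\<in>{0..T}. ennreal ((\<Sum>l<m + i. z l \<omega> * indicator {a l<..b l} s)\<^sup>2) \<partial>lborel) \<le>
          (\<integral>\<^sup>+s. ennreal (2 * c\<^sup>2) * indicator {0..T} s + 2 * (ennreal ((simple_process (S k) s \<omega> - H s \<omega>)\<^sup>2) * indicator {0..T} s) \<partial>lborel)"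
      proof (rule nn_integral_mono)
        fix s
        have "ennreal ((\<Sum>l<m + i. z l \<omega> * indicator {a l<..b l} s)\<^sup>2) \<le> ennreal (2 * c\<^sup>2) + 2 * ennreal ((simple_process (S k) s \<omega> - H s \<omega>)\<^sup>2)"
          if "s \<in> {0..T}"
        proof -
          have "ennreal ((\<Sum>l<m + i. z l \<omega> * indicator {a l<..b l} s)\<^sup>2) \<le> ennreal (2 * c\<^sup>2 + 2 * (simple_process (S k) s \<omega> - H s \<omega>)\<^sup>2)"
            by (intro ennreal_leI bound wE that)
          also have "\<dots> = ennreal (2 * c\<^sup>2) + ennreal 2 * ennreal ((simple_process (S k) s \<omega> - H s \<omega>)\<^sup>2)"
            by (subst ennreal_mult[symmetric]) (auto simp: ennreal_plus)
          finally show ?thesis by simp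
        qed
        then show "ennreal ((\<Sum>l<m + i. z l \<omega> * indicator {a l<..b l} s)\<^sup>2) * indicator {0..T} s \<le>
          ennreal (2 * c\<^sup>2) * indicator {0..T} s + 2 * (ennreal ((simple_process (S k) s \<omega> - H s \<omega>)\<^sup>2) * indicator {0..T} s)"
          by (cases "s \<in> {0..T}") auto
      qed
      also have "\<dots> = ennreal (2 * c\<^sup>2) * ennreal T + 2 * Y k \<omega>"
        unfolding Y_def using meas T_pos
        by (subst nn_integral_add) (auto simp: nn_integral_cmult nn_integral_cmult_indicator)
      also have "\<dots> \<le> ennreal (2 * c\<^sup>2) * ennreal T + ennreal 2 * ennreal (\<delta> / 4)"
        using Yk by (intro add_left_mono) (simp add: mult_left_mono)
      also have "\<dots> = ennreal (2 * c\<^sup>2 * T + 2 * (\<delta> / 4))"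
      proof -
        have "ennreal (2 * c\<^sup>2 * T + 2 * (\<delta> / 4)) = ennreal (2 * c\<^sup>2 * T) + ennreal (2 * (\<delta> / 4))"
          using pos T_pos by (intro ennreal_plus) auto
        also have "ennreal (2 * c\<^sup>2 * T) = ennreal (2 * c\<^sup>2) * ennreal T" using T_pos by (intro ennreal_mult) auto
        also have "ennreal (2 * (\<delta> / 4)) = ennreal 2 * ennreal (\<delta> / 4)" using pos by (intro ennreal_mult) auto
        finally show ?thesis by (rule sym)
      qed
      also have "2 * c\<^sup>2 * T + 2 * (\<delta> / 4) = \<delta>" using T_pos by (simp add: c2)
      finally show False using big by simp
    qed
    have p1: "prob {\<omega> \<in> space M. \<bar>\<Sum>l<m + i. z l \<omega> * (W (b l) \<omega> - W (a l) \<omega>)\<bar> > e} \<le> prob B + \<delta> / e\<^sup>2"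
      by (rule prob_step_integral_gt[OF ab zF _ pos(1) B sub]) (use pos in auto)
    have zM: "(\<lambda>\<omega>. \<Sum>l<m + i. z l \<omega> * (W (b l) \<omega> - W (a l) \<omega>)) \<in> borel_measurable M"
    proof (intro borel_measurable_sum borel_measurable_times increment_measurable)
      fix l assume "l \<in> {..<m + i}"
      then show "z l \<in> borel_measurable M" "0 \<le> a l" "a l \<le> b l" "b l \<le> T"
        using ab[of l] measurable_filtration_M[OF zF, of l] by auto
    qed
    have "prob {\<omega> \<in> space M. \<bar>(\<Sum>j<i. H (j * T / n) \<omega> * (W (Suc j * T / n) \<omega> - W (j * T / n) \<omega>)) - I t \<omega>\<bar> > \<epsilon>} \<le>
        prob ({\<omega> \<in> space M. \<bar>\<Sum>l<m + i. z l \<omega> * (W (b l) \<omega> - W (a l) \<omega>)\<bar> > e} \<union> {\<omega> \<in> space M. V k \<omega> > ennreal e})"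
    proof (rule finite_measure_mono)
      show "{\<omega> \<in> space M. \<bar>\<Sum>l<m + i. z l \<omega> * (W (b l) \<omega> - W (a l) \<omega>)\<bar> > e} \<union> {\<omega> \<in> space M. V k \<omega> > ennreal e} \<in> events"
        using zM by measurable
      show "{\<omega> \<in> space M. \<bar>(\<Sum>j<i. H (j * T / n) \<omega> * (W (Suc j * T / n) \<omega> - W (j * T / n) \<omega>)) - I t \<omega>\<bar> > \<epsilon>} \<subseteq>
          {\<omega> \<in> space M. \<bar>\<Sum>l<m + i. z l \<omega> * (W (b l) \<omega> - W (a l) \<omega>)\<bar> > e} \<union> {\<omega> \<in> space M. V k \<omega> > ennreal e}"
      proof
        fix \<omega> assume w: "\<omega> \<in> {\<omega> \<in> space M. \<bar>(\<Sum>j<i. H (j * T / n) \<omega> * (W (Suc j * T / n) \<omega> - W (j * T / n) \<omega>)) - I t \<omega>\<bar> > \<epsilon>}"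
        then have "\<bar>\<Sum>l<m + i. z l \<omega> * (W (b l) \<omega> - W (a l) \<omega>)\<bar> > e \<or> \<bar>simple_integral W (S k) t \<omega> - I t \<omega>\<bar> > e"
          unfolding sum_W e_def mem_Collect_eq by linarith
        moreover have "ennreal \<bar>simple_integral W (S k) t \<omega> - I t \<omega>\<bar> \<le> V k \<omega>"
          unfolding V_def by (rule SUP_upper) (rule t)
        moreover have "ennreal e < ennreal r" if "e < r" for r using that pos by (simp add: ennreal_less_iff)
        ultimately show "\<omega> \<in> {\<omega> \<in> space M. \<bar>\<Sum>l<m + i. z l \<omega> * (W (b l) \<omega> - W (a l) \<omega>)\<bar> > e} \<union> {\<omega> \<in> space M. V k \<omega> > ennreal e}"
          using w by (auto intro: order.strict_trans2)
      qed
    qed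
    also have "\<dots> \<le> prob {\<omega> \<in> space M. \<bar>\<Sum>l<m + i. z l \<omega> * (W (b l) \<omega> - W (a l) \<omega>)\<bar> > e} + prob {\<omega> \<in> space M. V k \<omega> > ennreal e}"
    proof (rule measure_Un_le)
      show "{\<omega> \<in> space M. \<bar>\<Sum>l<m + i. z l \<omega> * (W (b l) \<omega> - W (a l) \<omega>)\<bar> > e} \<in> events" using zM by measurable
    qed measurable
    also have "\<dots> \<le> \<theta>" using p1 PB k(2) pos by (simp add: \<delta>_def)
    finally show "prob {\<omega> \<in> space M. \<bar>(\<Sum>j<i. H (j * T / n) \<omega> * (W (Suc j * T / n) \<omega> - W (j * T / n) \<omega>)) - I (i * T / n) \<omega>\<bar> > \<epsilon>} \<le> \<theta>"
      by (simp add: t_def)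
  qed
qed

end

section \<open>Consistency of the Euler sums along a solution\<close>

lemma drift_grid_error:
  fixes z :: "real \<Rightarrow> real" and T :: real and n i :: nat
  assumes T: "T > 0" and z: "continuous_on {0..T} z" and n: "n > 0" "i \<le> n"
    and mod: "\<And>s t. s \<in> {0..T} \<Longrightarrow> t \<in> {0..T} \<Longrightarrow> \<bar>s - t\<bar> \<le> T / n \<Longrightarrow> \<bar>z s - z t\<bar> \<le> c"
  shows "\<bar>(LBINT s:{0..i * T / n}. z s) - (\<Sum>j<i. z (j * T / n) * (T / n))\<bar> \<le> c * T"
proof -
  have c: "c \<ge> 0" using mod[of 0 0] T by simp
  have int: "z integrable_on {u..v}" if "0 \<le> u" "v \<le> T" for u v
    by (rule integrable_continuous_real, rule continuous_on_subset[OF z]) (use that in auto)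
  have "\<bar>integral {0..i * T / n} z - (\<Sum>j<i. z (j * T / n) * (T / n))\<bar> \<le> i * (c * (T / n))"
    using n(2)
  proof (induction i)
    case (Suc i)
    let ?u = "i * T / n" and ?v = "Suc i * T / n"
    have "?v - ?u = T / n" by (simp add: distrib_right add_divide_distrib)
    moreover have "?v \<le> T"
      using mult_right_mono[of "real (Suc i)" "real n" T] Suc.prems T n(1) by (simp add: pos_divide_le_eq mult.commute)
    moreover have "0 \<le> ?u" "0 \<le> T / n" using T by auto
    ultimately have uv: "0 \<le> ?u" "?u \<le> ?v" "?v \<le> T" "?v - ?u = T / n" by linarith+
    have "integral {0..?v} z = integral {0..?u} z + integral {?u..?v} z"
      by (rule Henstock_Kurzweil_Integration.integral_combine[symmetric]) (use uv int in auto)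
    moreover have "\<bar>integral {?u..?v} z - z ?u * (T / n)\<bar> \<le> c * (T / n)"
    proof -
      have "integral {?u..?v} z - z ?u * (T / n) = integral {?u..?v} (\<lambda>s. z s - z ?u)"
        using int uv by (subst Henstock_Kurzweil_Integration.integral_diff) auto
      moreover have "norm (integral {?u..?v} (\<lambda>s. z s - z ?u)) \<le> c * (?v - ?u)"
        using uv by (intro integral_bound continuous_intros continuous_on_subset[OF z]) (auto intro!: mod)
      ultimately show ?thesis using uv(4) by simp
    qed
    ultimately have "\<bar>integral {0..?v} z - (\<Sum>j<Suc i. z (j * T / n) * (T / n))\<bar> \<le> i * (c * (T / n)) + c * (T / n)"
      using Suc by simp
    moreover have "real (Suc i) * (c * (T / n)) = i * (c * (T / n)) + c * (T / n)"
      by (simp add: distrib_right add_divide_distrib)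
    ultimately show ?case by (simp only:)
  qed simp
  also have "i * (c * (T / n)) \<le> n * (c * (T / n))" using n c T by (intro mult_right_mono) auto
  also have "\<dots> = c * T" using n by simp
  finally have "\<bar>integral {0..i * T / n} z - (\<Sum>j<i. z (j * T / n) * (T / n))\<bar> \<le> c * T" .
  moreover have "(LBINT s:{0..i * T / n}. z s) = integral {0..i * T / n} z"
  proof (rule set_borel_integral_eq_integral)
    have "i * T / n \<le> T" using T n by (simp add: field_simps)
    then show "set_integrable lborel {0..i * T / n} z"
      by (intro borel_integrable_atLeastAtMost' continuous_on_subset[OF z]) auto
  qed
  ultimately show ?thesis by simp
qed

lemma continuous_on_section:
  assumes "continuous_on ({0..T} \<times> UNIV) (\<lambda>(t, y). f t y)" "t \<in> {0..T}"
  shows "continuous_on UNIV (f t)"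
proof -
  have "continuous_on UNIV ((\<lambda>(t, y). f t y) \<circ> (\<lambda>y. (t, y)))"
    by (rule continuous_on_compose)
      (use assms(2) in \<open>auto intro!: continuous_intros continuous_on_subset[OF assms(1)]\<close>)
  then show ?thesis by (simp add: comp_def)
qed

context brownian
begin

lemma coefficient_process:
  fixes f :: "real \<Rightarrow> real \<Rightarrow> real"
  assumes f: "continuous_on ({0..T} \<times> UNIV) (\<lambda>(t, y). f t y)"
    and X: "continuous_process M T X" "adapted \<F> T X"
  shows "continuous_process M T (\<lambda>t \<omega>. f t (X t \<omega>))" "adapted \<F> T (\<lambda>t \<omega>. f t (X t \<omega>))"
proof -
  have m: "f t \<in> borel_measurable borel" if "t \<in> {0..T}" for t
    by (rule borel_measurable_continuous_onI[OF continuous_on_section[OF f that]])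
  have "continuous_on {0..T} (\<lambda>t. f t (X t \<omega>))" if "\<omega> \<in> space M" for \<omega>
  proof -
    have "continuous_on {0..T} (\<lambda>t. X t \<omega>)" using X that by (simp add: continuous_process_def)
    then have "continuous_on {0..T} ((\<lambda>(t, y). f t y) \<circ> (\<lambda>t. (t, X t \<omega>)))"
      by (intro continuous_on_compose continuous_intros continuous_on_subset[OF f]) auto
    then show ?thesis by (simp add: comp_def)
  qed
  then show "continuous_process M T (\<lambda>t \<omega>. f t (X t \<omega>))"
    using X m by (auto simp: continuous_process_def intro: measurable_compose)
  show "adapted \<F> T (\<lambda>t \<omega>. f t (X t \<omega>))"
    using X m by (auto simp: adapted_def intro: measurable_compose)
qed

text \<open>The form in which the equation enters the comparison: \<open>X\<close> almost satisfies
  the Euler recursion with coefficients taken along its own path. The probability is bounded at each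
  grid time separately, not for the maximum over the grid.\<close>

lemma sde_solution_grid:
  assumes b: "continuous_on ({0..T} \<times> UNIV) (\<lambda>(t, y). b t y)"
    and \<sigma>: "continuous_on ({0..T} \<times> UNIV) (\<lambda>(t, y). \<sigma> t y)"
    and X: "sde_solution M \<F> T W b \<sigma> x X" and "\<epsilon> > 0" "\<theta> > 0"
  shows "\<exists>n0::nat. \<forall>n\<ge>n0. n > 0 \<longrightarrow> (\<forall>i\<le>n. prob {\<omega> \<in> space M.
    \<bar>x + (\<Sum>j<i. b (j * T / n) (X (j * T / n) \<omega>) * (T / n) +
        \<sigma> (j * T / n) (X (j * T / n) \<omega>) * (W (Suc j * T / n) \<omega> - W (j * T / n) \<omega>)) - X (i * T / n) \<omega>\<bar> > \<epsilon>} \<le> \<theta>)"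
proof -
  have Xc: "continuous_process M T X" and Xa: "adapted \<F> T X" using X by (auto simp: sde_solution_def)
  obtain I where I: "ito_integral M \<F> T W (\<lambda>s \<omega>. \<sigma> s (X s \<omega>)) I"
    and eq: "AE \<omega> in M. \<forall>t\<in>{0..T}. X t \<omega> = x + (LBINT s:{0..t}. b s (X s \<omega>)) + I t \<omega>"
    using X unfolding sde_solution_def by blast
  note s = coefficient_process[OF \<sigma> Xc Xa] and bp = coefficient_process[OF b Xc Xa]
  let ?S = "\<lambda>(n::nat) (i::nat) \<omega>. \<Sum>j<i. \<sigma> (j * T / n) (X (j * T / n) \<omega>) * (W (Suc j * T / n) \<omega> - W (j * T / n) \<omega>)"
  let ?B = "\<lambda>(n::nat) (i::nat) \<omega>. \<Sum>j<i. b (real j * T / n) (X (real j * T / n) \<omega>) * (T / n)"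
  obtain n1 :: nat where n1: "\<And>n i. n \<ge> n1 \<Longrightarrow> n > 0 \<Longrightarrow> i \<le> n \<Longrightarrow>
      prob {\<omega> \<in> space M. \<bar>?S n i \<omega> - I (i * T / n) \<omega>\<bar> > \<epsilon> / 2} \<le> \<theta> / 2"
    using ito_integral_grid[OF I s, of "\<epsilon> / 2" "\<theta> / 2"] \<open>\<epsilon> > 0\<close> \<open>\<theta> > 0\<close> by auto
  define c where "c = \<epsilon> / (2 * T)"
  have c: "c > 0" "c * T = \<epsilon> / 2" using \<open>\<epsilon> > 0\<close> T_pos by (auto simp: c_def)
  obtain d E where d: "d > 0" and E: "E \<in> events" "prob (space M - E) \<le> \<theta> / 2"
    and mod: "\<And>\<omega> s t. \<omega> \<in> E \<Longrightarrow> s \<in> {0..T} \<Longrightarrow> t \<in> {0..T} \<Longrightarrow> \<bar>s - t\<bar> < d \<Longrightarrow> \<bar>b s (X s \<omega>) - b t (X t \<omega>)\<bar> \<le> c"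
    by (rule continuous_process_modulus[OF bp(1) c(1), of "\<theta> / 2"]) (use \<open>\<theta> > 0\<close> that in auto)
  obtain n2 :: nat where n2: "T / d < real n2" using reals_Archimedean2 by blast
  show ?thesis
  proof (intro exI[of _ "max n1 n2"] allI impI)
    fix n i :: nat assume n: "max n1 n2 \<le> n" "0 < n" "i \<le> n"
    have "T / d < real n" using n2 n(1) by linarith
    then have Tn: "T / n < d" using d n(2) by (simp add: field_simps)
    have grid: "j * T / n \<in> {0..T}" if "j \<le> n" for j :: nat using grid_mem[OF that n(2)] .
    have Im: "I (i * T / n) \<in> borel_measurable M"
      using I grid[OF n(3)] by (auto simp: ito_integral_def continuous_process_def)
    have Sm: "?S n i \<in> borel_measurable M"
    proof (intro borel_measurable_sum borel_measurable_times increment_measurable)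
      fix j assume "j \<in> {..<i}"
      then have "j < n" using n by simp
      then show "(\<lambda>\<omega>. \<sigma> (j * T / n) (X (j * T / n) \<omega>)) \<in> borel_measurable M"
          "0 \<le> j * T / n" "Suc j * T / n \<le> T" "j * T / n \<le> Suc j * T / n"
        using s(1) grid[of j] grid[of "Suc j"] grid_mono[of j "Suc j" n] by (auto simp: continuous_process_def)
    qed
    have "prob {\<omega> \<in> space M. \<bar>x + (?B n i \<omega> + ?S n i \<omega>) - X (i * T / n) \<omega>\<bar> > \<epsilon>} \<le>
      prob ((space M - E) \<union> {\<omega> \<in> space M. \<bar>?S n i \<omega> - I (i * T / n) \<omega>\<bar> > \<epsilon> / 2})"
    proof (rule finite_measure_mono_AE)
      show "(space M - E) \<union> {\<omega> \<in> space M. \<bar>?S n i \<omega> - I (i * T / n) \<omega>\<bar> > \<epsilon> / 2} \<in> events"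
        using E Im Sm by measurable
      show "AE \<omega> in M. \<omega> \<in> {\<omega> \<in> space M. \<bar>x + (?B n i \<omega> + ?S n i \<omega>) - X (i * T / n) \<omega>\<bar> > \<epsilon>} \<longrightarrow>
          \<omega> \<in> (space M - E) \<union> {\<omega> \<in> space M. \<bar>?S n i \<omega> - I (i * T / n) \<omega>\<bar> > \<epsilon> / 2}"
        using eq
      proof eventually_elim
        case (elim \<omega>)
        show ?case
        proof (intro impI, rule ccontr)
          assume w: "\<omega> \<in> {\<omega> \<in> space M. \<bar>x + (?B n i \<omega> + ?S n i \<omega>) - X (i * T / n) \<omega>\<bar> > \<epsilon>}"
            and neg: "\<omega> \<notin> (space M - E) \<union> {\<omega> \<in> space M. \<bar>?S n i \<omega> - I (i * T / n) \<omega>\<bar> > \<epsilon> / 2}"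
          have wE: "\<omega> \<in> E" and S2: "\<bar>?S n i \<omega> - I (i * T / n) \<omega>\<bar> \<le> \<epsilon> / 2" using w neg by auto
          have "\<bar>(LBINT s:{0..i * T / n}. b s (X s \<omega>)) - ?B n i \<omega>\<bar> \<le> c * T"
            using bp(1) w n mod[OF wE] Tn
            by (intro drift_grid_error[OF T_pos, where z="\<lambda>s. b s (X s \<omega>)"]) (auto simp: continuous_process_def)
          moreover have "X (i * T / n) \<omega> = x + (LBINT s:{0..i * T / n}. b s (X s \<omega>)) + I (i * T / n) \<omega>"
            using elim grid[OF n(3)] by blast
          ultimately show False using w S2 c(2) unfolding mem_Collect_eq by linarith
        qed
      qed
    qed
    also have "\<dots> \<le> prob (space M - E) + prob {\<omega> \<in> space M. \<bar>?S n i \<omega> - I (i * T / n) \<omega>\<bar> > \<epsilon> / 2}"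
    proof (rule measure_Un_le)
      show "{\<omega> \<in> space M. \<bar>?S n i \<omega> - I (i * T / n) \<omega>\<bar> > \<epsilon> / 2} \<in> events" using Im Sm by measurable
    qed (use E in auto)
    also have "\<dots> \<le> \<theta>" using n1[of n i] n E by simp
    finally show "prob {\<omega> \<in> space M.
      \<bar>x + (\<Sum>j<i. b (j * T / n) (X (j * T / n) \<omega>) * (T / n) +
        \<sigma> (j * T / n) (X (j * T / n) \<omega>) * (W (Suc j * T / n) \<omega> - W (j * T / n) \<omega>)) - X (i * T / n) \<omega>\<bar> > \<epsilon>} \<le> \<theta>"
      by (simp only: sum.distrib)
  qed
qed

text \<open>One \<open>R\<close> has to serve all grids, because the ball is fixed before the number
  of steps. All grid times are rational multiples of \<open>T\<close>, which makes the event a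
  countable intersection.\<close>

lemma continuous_process_tight:
  assumes Z: "continuous_process M T Z" and "\<theta> > 0"
  obtains R E where "R > 0" "E \<in> events" "prob (space M - E) \<le> \<theta>"
    "\<And>\<omega> i n. \<omega> \<in> E \<Longrightarrow> i \<le> n \<Longrightarrow> n > (0::nat) \<Longrightarrow> \<bar>Z (real i * T / real n) \<omega>\<bar> \<le> R"
proof -
  define D where "D = (\<lambda>q. q * T) ` (\<rat> \<inter> {0..1})"
  have D: "countable D" "D \<subseteq> {0..T}" using T_pos by (auto simp: D_def countable_rat mult_le_cancel_right2)
  define E where "E k = {\<omega> \<in> space M. \<forall>t\<in>D. \<bar>Z t \<omega>\<bar> \<le> real (Suc k)}" for k
  have Em: "E k \<in> events" for k
    unfolding E_def
  proof (intro sets.sets_Collect_countable_All' D(1))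
    fix t assume "t \<in> D"
    then have [measurable]: "Z t \<in> borel_measurable M" using D Z by (auto simp: continuous_process_def)
    show "{\<omega> \<in> space M. \<bar>Z t \<omega>\<bar> \<le> real (Suc k)} \<in> events" by measurable
  qed
  have "incseq E" by (rule incseq_SucI) (force simp: E_def)
  moreover have "(\<Union>k. E k) = space M"
  proof (intro equalityI subsetI)
    fix \<omega> assume w: "\<omega> \<in> space M"
    have "continuous_on {0..T} (\<lambda>t. Z t \<omega>)" using Z w by (simp add: continuous_process_def)
    then have "bounded ((\<lambda>t. Z t \<omega>) ` {0..T})" by (intro compact_imp_bounded compact_continuous_image) auto
    then obtain B where B: "\<forall>t\<in>{0..T}. \<bar>Z t \<omega>\<bar> \<le> B" by (auto simp: bounded_iff)
    obtain k :: nat where "B \<le> real k" using real_arch_simple by blast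
    then have "\<omega> \<in> E k" using w B D(2) by (force simp: E_def)
    then show "\<omega> \<in> (\<Union>k. E k)" by blast
  qed (auto simp: E_def)
  moreover have "(\<lambda>k. prob (E k)) \<longlonglongrightarrow> prob (\<Union>k. E k)"
    by (rule finite_Lim_measure_incseq) (use Em calculation in auto)
  ultimately have "(\<lambda>k. prob (E k)) \<longlonglongrightarrow> 1" by (simp add: prob_space)
  then have "\<forall>\<^sub>F k in sequentially. prob (E k) > 1 - \<theta>"
    using \<open>\<theta> > 0\<close> by (auto intro: order_tendstoD)
  then obtain k where k: "prob (E k) > 1 - \<theta>" by (auto simp: eventually_sequentially)
  show thesis
  proof (rule that[of "real (Suc k)" "E k"])
    show "prob (space M - E k) \<le> \<theta>" using k Em by (simp add: prob_compl)
    fix \<omega> and i n :: nat assume w: "\<omega> \<in> E k" and i: "i \<le> n" "n > 0"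
    have "real i / real n \<in> \<rat> \<inter> {0..1}" using i by auto
    then have "i * T / n \<in> D" unfolding D_def by (intro image_eqI[of _ _ "real i / real n"]) auto
    then show "\<bar>Z (i * T / n) \<omega>\<bar> \<le> real (Suc k)" using w by (auto simp: E_def)
  qed (use Em in auto)
qed

end

text \<open>Points farther than \<open>2 * C / \<Lambda>\<close> from \<open>y\<close> cannot lower
  the infimum below \<open>f y\<close>, because the penalty exceeds the oscillation of
  \<open>f\<close>. Nearer points lower it by at most \<open>\<rho> (2 * C / \<Lambda>)\<close>. The
  modulus of continuity thus becomes the uniform error of a Lipschitz approximation.\<close>

lemma inf_convolution:
  fixes f :: "real \<Rightarrow> real"
  assumes f: "\<And>y. \<bar>f y\<bar> \<le> C" "\<And>y z. \<bar>f y - f z\<bar> \<le> \<rho> \<bar>y - z\<bar>" and \<rho>: "mono \<rho>" "\<rho> 0 = 0" and \<Lambda>: "\<Lambda> > 0"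
  obtains g where "\<And>y. \<bar>g y\<bar> \<le> C" "\<And>y z. \<bar>g y - g z\<bar> \<le> \<Lambda> * \<bar>y - z\<bar>" "\<And>y. \<bar>f y - g y\<bar> \<le> \<rho> (2 * C / \<Lambda>)"
proof -
  have C: "C \<ge> 0" using f(1)[of 0] by linarith
  define g where "g y = (INF z. f z + \<Lambda> * \<bar>y - z\<bar>)" for y
  have bdd: "bdd_below (range (\<lambda>z. f z + \<Lambda> * \<bar>y - z\<bar>))" for y
  proof (rule bdd_belowI2[where m="- C"])
    fix z show "- C \<le> f z + \<Lambda> * \<bar>y - z\<bar>" using f(1)[of z] \<Lambda> by (simp add: abs_le_iff add_increasing2)
  qed
  have le: "g y \<le> f z + \<Lambda> * \<bar>y - z\<bar>" for y z unfolding g_def by (rule cINF_lower[OF bdd]) simp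
  have ge: "m \<le> g y" if "\<And>z. m \<le> f z + \<Lambda> * \<bar>y - z\<bar>" for m y
    unfolding g_def by (rule cINF_greatest) (use that in auto)
  have lip: "g y \<le> g z + \<Lambda> * \<bar>y - z\<bar>" for y z
  proof -
    have "g y - \<Lambda> * \<bar>y - z\<bar> \<le> g z"
    proof (rule ge)
      fix w
      have "\<Lambda> * \<bar>y - w\<bar> \<le> \<Lambda> * (\<bar>y - z\<bar> + \<bar>z - w\<bar>)" using \<Lambda> by (intro mult_left_mono) auto
      then show "g y - \<Lambda> * \<bar>y - z\<bar> \<le> f w + \<Lambda> * \<bar>z - w\<bar>" using le[of y w] by (simp add: distrib_left)
    qed
    then show ?thesis by simp
  qed
  have fg: "g y \<le> f y" for y using le[of y y] by simp
  have gf: "f y - \<rho> (2 * C / \<Lambda>) \<le> g y" for y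
  proof (rule ge)
    fix z
    have \<rho>0: "\<rho> (2 * C / \<Lambda>) \<ge> 0" using monoD[OF \<rho>(1), of 0 "2 * C / \<Lambda>"] \<rho>(2) C \<Lambda> by simp
    show "f y - \<rho> (2 * C / \<Lambda>) \<le> f z + \<Lambda> * \<bar>y - z\<bar>"
    proof (cases "\<bar>y - z\<bar> \<le> 2 * C / \<Lambda>")
      case True
      have "0 \<le> \<Lambda> * \<bar>y - z\<bar>" using \<Lambda> by simp
      then show ?thesis using f(2)[of y z] monoD[OF \<rho>(1) True] by linarith
    next
      case False
      then have "2 * C \<le> \<Lambda> * \<bar>y - z\<bar>" using \<Lambda> by (simp add: field_simps)
      then show ?thesis using f(1)[of y] f(1)[of z] \<rho>0 by linarith
    qed
  qed
  show thesis
  proof (rule that[of g])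
    show "\<bar>g y\<bar> \<le> C" for y
    proof -
      have "- C \<le> g y" by (rule ge) (use f(1) \<Lambda> in \<open>auto simp: abs_le_iff minus_le_iff intro!: add_increasing2\<close>)
      then show ?thesis using fg[of y] f(1)[of y] by linarith
    qed
    show "\<bar>g y - g z\<bar> \<le> \<Lambda> * \<bar>y - z\<bar>" for y z
      using lip[of y z] lip[of z y] by (simp add: abs_minus_commute abs_le_iff)
    show "\<bar>f y - g y\<bar> \<le> \<rho> (2 * C / \<Lambda>)" for y using fg[of y] gf[of y] by linarith
  qed
qed

section \<open>The discrete Yamada--Watanabe estimate\<close>

text \<open>The induction runs on the right-hand side of the hypothesis and not on
  \<open>u m\<close>, since only that quantity has a one-step recursion.\<close>

lemma discrete_gronwall:
  fixes u :: "nat \<Rightarrow> real"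
  assumes u: "\<And>m. m \<le> n \<Longrightarrow> u m \<le> Q + a * (\<Sum>i<m. u i)" and a: "a \<ge> 0" and m: "m \<le> n"
  shows "u m \<le> Q * (1 + a) ^ m"
proof -
  have bound: "Q + a * (\<Sum>i<m. u i) \<le> Q * (1 + a) ^ m" if "m \<le> n" for m
    using that
  proof (induction m)
    case (Suc m)
    have "Q + a * (\<Sum>i<Suc m. u i) = (Q + a * (\<Sum>i<m. u i)) + a * u m" by (simp add: algebra_simps)
    also have "\<dots> \<le> (Q + a * (\<Sum>i<m. u i)) + a * (Q + a * (\<Sum>i<m. u i))"
      using u[of m] Suc.prems a by (intro add_left_mono mult_left_mono) auto
    also have "\<dots> = (1 + a) * (Q + a * (\<Sum>i<m. u i))" by (simp add: algebra_simps)
    also have "\<dots> \<le> (1 + a) * (Q * (1 + a) ^ m)" using Suc a by (intro mult_left_mono) auto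
    finally show ?case by (simp add: mult_ac)
  qed simp
  show ?thesis using u[OF m] bound[OF m] by linarith
qed

lemma one_plus_power_le_exp:
  assumes "0 \<le> a" "a * real n \<le> c" "m \<le> n" shows "(1 + a) ^ m \<le> exp c"
proof -
  have "(1 + a) ^ m \<le> exp a ^ m" using assms by (intro power_mono exp_ge_add_one_self) auto
  also have "\<dots> = exp (real m * a)" by (simp add: exp_of_nat_mult)
  also have "real m * a \<le> real n * a" using assms by (intro mult_right_mono) auto
  then have "exp (real m * a) \<le> exp c" using assms(2) by (simp add: mult.commute)
  finally show ?thesis .
qed

context brownian
begin

text \<open>\<open>D\<close> abstracts the difference of two schemes, with drift
  \<open>\<beta>\<close>, noise coefficient \<open>a\<close> and a remainder \<open>r\<close> of
  order \<open>h\<^sup>2\<close> in mean. The additive errors \<open>e\<close> and \<open>g\<close>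
  allow the coefficients to be compared at displaced points. Smoothing absorbs the noise and
  Gronwall's inequality only the drift, so that no Lipschitz constant of a diffusion coefficient
  appears in the exponential.\<close>

lemma euler_difference:
  fixes \<phi> p \<rho> :: "real \<Rightarrow> real" and n :: nat and D a \<beta> e g r :: "nat \<Rightarrow> 'a \<Rightarrow> real"
  defines "h \<equiv> T / n" and "dW \<equiv> \<lambda>i \<omega>. W (real (Suc i) * T / n) \<omega> - W (real i * T / n) \<omega>"
  assumes n: "n > 0"
    and K: "K \<ge> 0" and \<kappa>: "\<kappa> \<ge> 0" and \<phi>0: "\<phi> 0 = 0" and p: "continuous_on UNIV p"
    and \<phi>: "\<And>u. (\<phi> has_real_derivative p u) (at u)" and p1: "\<And>u. \<bar>p u\<bar> \<le> 1"
    and \<phi>_lower: "\<And>u. \<bar>u\<bar> - \<eta> \<le> \<phi> u"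
    and step: "\<And>d a e w. \<bar>a\<bar> \<le> \<rho> \<bar>d\<bar> + e \<Longrightarrow> e \<ge> 0 \<Longrightarrow>
       \<phi> (d + a * w) \<le> \<phi> d + p d * a * w + (2 * \<kappa> + 2 * K * e\<^sup>2) * w\<^sup>2 + K / \<delta>\<^sup>2 * a ^ 4 * w ^ 4"
    and D0: "\<And>\<omega>. D 0 \<omega> = 0"
    and DS: "\<And>i \<omega>. i < n \<Longrightarrow> D (Suc i) \<omega> = D i \<omega> + h * \<beta> i \<omega> + a i \<omega> * dW i \<omega> + r i \<omega>"
    and adp: "\<And>i. i < n \<Longrightarrow> D i \<in> borel_measurable (\<F> (real i * T / n))"
      "\<And>i. i < n \<Longrightarrow> a i \<in> borel_measurable (\<F> (real i * T / n))"
      "\<And>i. i < n \<Longrightarrow> e i \<in> borel_measurable (\<F> (real i * T / n))"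
    and meas: "\<And>i. i < n \<Longrightarrow> \<beta> i \<in> borel_measurable M" "\<And>i. i < n \<Longrightarrow> r i \<in> borel_measurable M"
      "\<And>i. i < n \<Longrightarrow> g i \<in> borel_measurable M"
    and a: "\<And>i \<omega>. i < n \<Longrightarrow> \<omega> \<in> space M \<Longrightarrow> \<bar>a i \<omega>\<bar> \<le> \<rho> \<bar>D i \<omega>\<bar> + e i \<omega>" "\<And>i \<omega>. \<bar>a i \<omega>\<bar> \<le> A"
    and e: "\<And>i \<omega>. 0 \<le> e i \<omega>" "\<And>i \<omega>. e i \<omega> \<le> A" "\<And>i. i < n \<Longrightarrow> expectation (\<lambda>\<omega>. (e i \<omega>)\<^sup>2) \<le> e2"
    and \<beta>: "\<And>i \<omega>. i < n \<Longrightarrow> \<omega> \<in> space M \<Longrightarrow> \<bar>\<beta> i \<omega>\<bar> \<le> L * \<bar>D i \<omega>\<bar> + g i \<omega>" "\<And>i \<omega>. \<bar>\<beta> i \<omega>\<bar> \<le> A"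
    and g: "\<And>i \<omega>. \<bar>g i \<omega>\<bar> \<le> A" "\<And>i. i < n \<Longrightarrow> expectation (g i) \<le> g1" and L: "L \<ge> 0" "g1 \<ge> 0" "e2 \<ge> 0"
    and r: "\<And>i \<omega>. i < n \<Longrightarrow> \<bar>r i \<omega>\<bar> \<le> G * (dW i \<omega>) ^ 4" and G: "G \<ge> 0"
    and m: "m \<le> n"
  shows "integrable M (D m)"
    and "expectation (\<lambda>\<omega>. \<bar>D m \<omega>\<bar>) \<le>
      (\<eta> + T * (g1 + 2 * \<kappa> + 2 * K * e2) + 3 * T * h * (K / \<delta>\<^sup>2 * A ^ 4 + G)) * exp (L * T)"
proof -
  have h: "h > 0" "real n * h = T" using T_pos n by (auto simp: h_def)
  have A: "A \<ge> 0" using e(1,2)[of 0] order_trans by blast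
  have t: "0 \<le> real i * T / n" "real i * T / n < real (Suc i) * T / n" "real (Suc i) * T / n \<le> T" if "i < n" for i
    using grid_mem[of i n] grid_mem[of "Suc i" n] that n T_pos by (auto simp: field_simps)
  have hd: "real (Suc i) * T / n - real i * T / n = h" for i
    by (simp add: h_def distrib_right add_divide_distrib)
  have M: "D i \<in> borel_measurable M" "a i \<in> borel_measurable M" "e i \<in> borel_measurable M" if "i < n" for i
    using adp[OF that] t[OF that] by (auto intro: measurable_filtration_M[of _ "real i * T / n"])
  have dWi: "integrable M (\<lambda>\<omega>. (dW i \<omega>) ^ k)" if "i < n" for i k
    unfolding dW_def using t[OF that] by (intro integrable_increment_power) auto
  have dWm: "dW i \<in> borel_measurable M" if "i < n" for i
    unfolding dW_def using t[OF that] by (intro increment_measurable) auto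
  have moments: "expectation (dW i) = 0" "expectation (\<lambda>\<omega>. (dW i \<omega>)\<^sup>2) = h" "expectation (\<lambda>\<omega>. (dW i \<omega>) ^ 4) = 3 * h\<^sup>2"
    if "i < n" for i
    using t[OF that] hd[of i] expectation_increment[of "real i * T / n" "real (Suc i) * T / n"]
      expectation_increment_square[of "real i * T / n" "real (Suc i) * T / n"]
      expectation_increment_pow4[of "real i * T / n" "real (Suc i) * T / n"] unfolding dW_def by auto
  have mult: "integrable M (\<lambda>\<omega>. U \<omega> * f (dW i \<omega>))"
      "expectation (\<lambda>\<omega>. U \<omega> * f (dW i \<omega>)) = expectation U * expectation (\<lambda>\<omega>. f (dW i \<omega>))"
    if "i < n" "U \<in> borel_measurable (\<F> (real i * T / n))" "integrable M U"
      "f \<in> borel_measurable borel" "integrable M (\<lambda>\<omega>. f (dW i \<omega>))" for U :: "'a \<Rightarrow> real" and f :: "real \<Rightarrow> real" and i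
    using integrable_mult_increment[OF t[OF that(1)] that(2-4)] expectation_mult_increment[OF t[OF that(1)] that(2-4)]
      that(5) unfolding dW_def by blast+
  have bd: "integrable M f" if "f \<in> borel_measurable M" "\<And>\<omega>. \<bar>f \<omega>\<bar> \<le> B" for f :: "'a \<Rightarrow> real" and B
    using that by (intro integrable_const_bound[of f B]) auto
  have ia: "integrable M (\<lambda>\<omega>. a i \<omega> * dW i \<omega>)" if "i < n" for i
    using mult(1)[OF that adp(2)[OF that] bd[of _ A], of "\<lambda>x. x"] M(2)[OF that] a(2) dWi[OF that, of 1] by simp
  have ir: "integrable M (r i)" if "i < n" for i
    by (rule Bochner_Integration.integrable_bound[OF integrable_mult_right[OF dWi[OF that, of 4], of G]])
      (use r[OF that] meas(2)[OF that] in \<open>auto simp: G abs_mult intro!: AE_I2 order_trans[OF r[OF that]]\<close>)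
  have i\<beta>: "integrable M (\<beta> i)" if "i < n" for i using meas(1)[OF that] \<beta>(2) by (rule bd)
  have iD: "integrable M (D i)" if "i \<le> n" for i
    using that
  proof (induction i)
    case 0
    have "D 0 = (\<lambda>_. 0)" by (rule ext) (rule D0)
    then show ?case by simp
  next
    case (Suc i)
    then have i: "i < n" by simp
    have "integrable M (\<lambda>\<omega>. D i \<omega> + h * \<beta> i \<omega> + a i \<omega> * dW i \<omega> + r i \<omega>)"
      using Suc i ia[OF i] ir[OF i] i\<beta>[OF i] by (intro Bochner_Integration.integrable_add integrable_mult_right) auto
    moreover have "D (Suc i) = (\<lambda>\<omega>. D i \<omega> + h * \<beta> i \<omega> + a i \<omega> * dW i \<omega> + r i \<omega>)"
      by (rule ext) (rule DS[OF i])
    ultimately show ?case by simp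
  qed
  then show "integrable M (D m)" using m by blast
  have lip: "\<phi> v \<le> \<phi> u + \<bar>v - u\<bar>" for u v
  proof -
    have "\<bar>\<phi> v - \<phi> u\<bar> \<le> 1 * \<bar>v - u\<bar>"
      using field_differentiable_bound[of UNIV \<phi> p 1 u v] \<phi> p1 by simp
    then show ?thesis by (simp add: abs_le_iff algebra_simps)
  qed
  have \<phi>m: "\<phi> \<in> borel_measurable borel"
    by (rule borel_measurable_continuous_onI, rule DERIV_continuous_on) (use \<phi> in auto)
  have pm: "p \<in> borel_measurable borel" by (rule borel_measurable_continuous_onI[OF p])
  have i\<phi>: "integrable M (\<lambda>\<omega>. \<phi> (D i \<omega>))" if "i \<le> n" for i
  proof (rule Bochner_Integration.integrable_bound[OF iD[OF that]])
    show "(\<lambda>\<omega>. \<phi> (D i \<omega>)) \<in> borel_measurable M"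
      using borel_measurable_integrable[OF iD[OF that]] \<phi>m by (rule measurable_compose)
    have "\<bar>\<phi> u\<bar> \<le> \<bar>u\<bar>" for u using lip[of u 0] lip[of 0 u] \<phi>0 by auto
    then show "AE \<omega> in M. norm (\<phi> (D i \<omega>)) \<le> norm (D i \<omega>)" by simp
  qed
  define u where "u i = expectation (\<lambda>\<omega>. \<bar>D i \<omega>\<bar>)" for i
  define B where "B = 2 * \<kappa> * h + 2 * K * e2 * h + 3 * h\<^sup>2 * (K / \<delta>\<^sup>2 * A ^ 4 + G)"
  have step_exp: "expectation (\<lambda>\<omega>. \<phi> (D (Suc i) \<omega>)) \<le> expectation (\<lambda>\<omega>. \<phi> (D i \<omega>)) + (h * (L * u i + g1) + B)"
    if i: "i < n" for i
  proof -
    have i': "i \<le> n" using i by simp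
    \<comment> \<open>Arranged so that every term is an adapted factor times a function of the
      increment, or contains no increment; its expectation is then computed term by term.\<close>
    let ?R = "\<lambda>\<omega>. \<phi> (D i \<omega>) + (p (D i \<omega>) * a i \<omega>) * dW i \<omega> + 2 * \<kappa> * (dW i \<omega>)\<^sup>2 + 2 * K * ((e i \<omega>)\<^sup>2 * (dW i \<omega>)\<^sup>2)
        + (K / \<delta>\<^sup>2 * A ^ 4 + G) * (dW i \<omega>) ^ 4 + h * (L * \<bar>D i \<omega>\<bar> + g i \<omega>)"
    have pa: "(\<lambda>\<omega>. p (D i \<omega>) * a i \<omega>) \<in> borel_measurable (\<F> (real i * T / n))"
      using measurable_compose[OF adp(1)[OF i] pm] adp(2)[OF i] by (rule borel_measurable_times)
    have paM: "(\<lambda>\<omega>. p (D i \<omega>) * a i \<omega>) \<in> borel_measurable M"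
      using measurable_compose[OF M(1)[OF i] pm] M(2)[OF i] by (rule borel_measurable_times)
    have pab: "\<bar>p (D i \<omega>) * a i \<omega>\<bar> \<le> A" for \<omega>
      using mult_mono[OF p1[of "D i \<omega>"] a(2)[of i \<omega>]] by (simp add: abs_mult)
    have e2b: "\<bar>(e i \<omega>)\<^sup>2\<bar> \<le> A\<^sup>2" for \<omega> using power_mono[OF e(2)[of i \<omega>] e(1)[of i \<omega>], of 2] by simp
    have ie: "integrable M (\<lambda>\<omega>. (e i \<omega>)\<^sup>2)" using M(3)[OF i] e2b by (intro bd[of _ "A\<^sup>2"]) auto
    have 1: "integrable M (\<lambda>\<omega>. (p (D i \<omega>) * a i \<omega>) * dW i \<omega>)" "expectation (\<lambda>\<omega>. (p (D i \<omega>) * a i \<omega>) * dW i \<omega>) = 0"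
      using mult[OF i pa bd[OF paM pab], of "\<lambda>x. x"] dWi[OF i, of 1] moments(1)[OF i] by auto
    have 2: "integrable M (\<lambda>\<omega>. (e i \<omega>)\<^sup>2 * (dW i \<omega>)\<^sup>2)"
      "expectation (\<lambda>\<omega>. (e i \<omega>)\<^sup>2 * (dW i \<omega>)\<^sup>2) = expectation (\<lambda>\<omega>. (e i \<omega>)\<^sup>2) * h"
      using mult[OF i _ ie, of "\<lambda>x. x\<^sup>2"] adp(3)[OF i] dWi[OF i, of 2] moments(2)[OF i] by auto
    have ig: "integrable M (g i)" by (rule bd[OF meas(3)[OF i] g(1)])
    have iR: "integrable M ?R"
      using i\<phi>[OF i'] 1(1) 2(1) ig iD[OF i'] dWi[OF i] by (intro Bochner_Integration.integrable_add integrable_mult_right integrable_abs) auto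
    have "expectation (\<lambda>\<omega>. \<phi> (D (Suc i) \<omega>)) \<le> expectation ?R"
    proof (rule integral_mono[OF i\<phi> iR])
      show "Suc i \<le> n" using i by simp
      fix \<omega> assume w: "\<omega> \<in> space M"
      have a4: "K / \<delta>\<^sup>2 * (a i \<omega>) ^ 4 * (dW i \<omega>) ^ 4 \<le> K / \<delta>\<^sup>2 * A ^ 4 * (dW i \<omega>) ^ 4"
      proof (intro mult_right_mono mult_left_mono)
        have "\<bar>a i \<omega>\<bar> ^ 4 \<le> A ^ 4" using a(2) by (intro power_mono) auto
        then show "(a i \<omega>) ^ 4 \<le> A ^ 4" by (simp add: power_even_abs)
      qed (use K in auto)
      have hb: "\<bar>h * \<beta> i \<omega>\<bar> \<le> h * (L * \<bar>D i \<omega>\<bar> + g i \<omega>)"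
        using h \<beta>(1)[OF i w] by (simp add: abs_mult)
      \<comment> \<open>\<open>\<phi>\<close> has slope at most one, so drift and remainder are
        split off before the expansion, which sees only the noise.\<close>
      have "\<phi> (D (Suc i) \<omega>) \<le> \<phi> (D i \<omega> + a i \<omega> * dW i \<omega>) + \<bar>h * \<beta> i \<omega> + r i \<omega>\<bar>"
        using lip[of "D (Suc i) \<omega>" "D i \<omega> + a i \<omega> * dW i \<omega>"] unfolding DS[OF i] by (simp add: add_ac)
      also have "\<dots> \<le> \<phi> (D i \<omega> + a i \<omega> * dW i \<omega>) + \<bar>h * \<beta> i \<omega>\<bar> + \<bar>r i \<omega>\<bar>" by simp
      finally have "\<phi> (D (Suc i) \<omega>) \<le> \<phi> (D i \<omega>) + p (D i \<omega>) * a i \<omega> * dW i \<omega> + (2 * \<kappa> + 2 * K * (e i \<omega>)\<^sup>2) * (dW i \<omega>)\<^sup>2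
          + K / \<delta>\<^sup>2 * A ^ 4 * (dW i \<omega>) ^ 4 + h * (L * \<bar>D i \<omega>\<bar> + g i \<omega>) + G * (dW i \<omega>) ^ 4"
        using step[OF a(1)[OF i w] e(1)[of i \<omega>], of "dW i \<omega>"] a4 hb r[OF i, of \<omega>] by linarith
      then show "\<phi> (D (Suc i) \<omega>) \<le> ?R \<omega>" by (simp add: algebra_simps)
    qed
    also have "expectation ?R = expectation (\<lambda>\<omega>. \<phi> (D i \<omega>)) + 2 * \<kappa> * h + 2 * K * (expectation (\<lambda>\<omega>. (e i \<omega>)\<^sup>2) * h)
        + (K / \<delta>\<^sup>2 * A ^ 4 + G) * (3 * h\<^sup>2) + h * (L * u i + expectation (g i))"
      using i\<phi>[OF i'] 1 2 ig iD[OF i'] dWi[OF i] moments[OF i] by (simp add: u_def)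
    also have "\<dots> \<le> expectation (\<lambda>\<omega>. \<phi> (D i \<omega>)) + 2 * \<kappa> * h + 2 * K * (e2 * h)
        + (K / \<delta>\<^sup>2 * A ^ 4 + G) * (3 * h\<^sup>2) + h * (L * u i + g1)"
      using e(3)[OF i] g(2)[OF i] h K by (intro add_mono mult_left_mono mult_right_mono order_refl) auto
    finally show ?thesis by (simp add: B_def algebra_simps)
  qed
  have sum_exp: "expectation (\<lambda>\<omega>. \<phi> (D i \<omega>)) \<le> (h * L) * (\<Sum>j<i. u j) + real i * (h * g1 + B)" if "i \<le> n" for i
    using that
  proof (induction i)
    case 0
    then show ?case by (simp add: D0 \<phi>0)
  next
    case (Suc i)
    then show ?case using step_exp[of i] by (simp add: algebra_simps)
  qed
  have B0: "0 \<le> h * g1 + B"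
    unfolding B_def using h K L \<kappa> G A by (intro add_nonneg_nonneg mult_nonneg_nonneg) auto
  define Q where "Q = \<eta> + T * (g1 + 2 * \<kappa> + 2 * K * e2) + 3 * T * h * (K / \<delta>\<^sup>2 * A ^ 4 + G)"
  have Q_eq: "\<eta> + real n * (h * g1 + B) = Q"
  proof -
    have "real n * (h * g1 + B) = (real n * h) * (g1 + 2 * \<kappa> + 2 * K * e2) + 3 * (real n * h) * h * (K / \<delta>\<^sup>2 * A ^ 4 + G)"
      by (simp add: B_def power2_eq_square algebra_simps)
    then show ?thesis by (simp add: Q_def h(2))
  qed
  \<comment> \<open>The lower bound on \<open>\<phi>\<close> closes the loop: the mean of
    \<open>\<phi> (D i)\<close>, bounded through the earlier values of \<open>u\<close>, controls
    \<open>u i\<close> up to \<open>\<eta>\<close>.\<close>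
  have gr: "u i \<le> Q + (h * L) * (\<Sum>j<i. u j)" if "i \<le> n" for i
  proof -
    have "u i \<le> expectation (\<lambda>\<omega>. \<eta> + \<phi> (D i \<omega>))"
      unfolding u_def using iD[OF that] i\<phi>[OF that] \<phi>_lower by (intro integral_mono) (auto simp: algebra_simps)
    also have "\<dots> = \<eta> + expectation (\<lambda>\<omega>. \<phi> (D i \<omega>))" using i\<phi>[OF that] by (simp add: prob_space)
    also have "\<dots> \<le> \<eta> + ((h * L) * (\<Sum>j<i. u j) + real i * (h * g1 + B))" using sum_exp[OF that] by simp
    also have "real i * (h * g1 + B) \<le> real n * (h * g1 + B)" using that B0 by (intro mult_right_mono) auto
    finally show ?thesis using Q_eq by simp
  qed
  have "u m \<le> Q * (1 + h * L) ^ m"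
    by (rule discrete_gronwall[OF gr _ m]) (use h L in auto)
  also have "\<dots> \<le> Q * exp (L * T)"
  proof (rule mult_left_mono)
    show "(1 + h * L) ^ m \<le> exp (L * T)"
      using h L m by (intro one_plus_power_le_exp[of _ n]) (auto simp: mult_ac)
    show "0 \<le> Q" using gr[of 0] by (simp add: u_def D0)
  qed
  finally show "expectation (\<lambda>\<omega>. \<bar>D m \<omega>\<bar>) \<le>
      (\<eta> + T * (g1 + 2 * \<kappa> + 2 * K * e2) + 3 * T * h * (K / \<delta>\<^sup>2 * A ^ 4 + G)) * exp (L * T)"
    by (simp add: u_def Q_def)
qed

end

section \<open>Association of monotone Markov chains\<close>

context prob_space
begin

lemma integrable_bounded:
  fixes f :: "'a \<Rightarrow> real"
  assumes "f \<in> borel_measurable M" "\<And>x. \<bar>f x\<bar> \<le> C"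
  shows "integrable M f"
  using assms by (intro integrable_const_bound[of f C]) auto

text \<open>Integrating \<open>co\<close> over an independent copy \<open>z'\<close> and then over
  \<open>z\<close> gives twice the covariance.\<close>

lemma chebyshev_association:
  fixes u v :: "'a \<Rightarrow> real"
  assumes [measurable]: "u \<in> borel_measurable M" "v \<in> borel_measurable M"
    and b: "\<And>z. \<bar>u z\<bar> \<le> A" "\<And>z. \<bar>v z\<bar> \<le> B"
    and co: "\<And>z z'. 0 \<le> (u z - u z') * (v z - v z')"
  shows "expectation u * expectation v \<le> expectation (\<lambda>z. u z * v z)"
proof -
  have A: "A \<ge> 0" "B \<ge> 0" using b[of undefined] by linarith+
  have i[simp]: "integrable M u" "integrable M v" "integrable M (\<lambda>z. u z * v z)"
    using b A integrable_bounded[of u A] integrable_bounded[of v B] integrable_bounded[of "\<lambda>z. u z * v z" "A * B"]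
    by (auto simp: abs_mult mult_mono)
  have "0 \<le> u z * v z - u z * expectation v - v z * expectation u + expectation (\<lambda>z. u z * v z)" for z
  proof -
    have "0 \<le> expectation (\<lambda>z'. (u z - u z') * (v z - v z'))" by (intro Bochner_Integration.integral_nonneg co)
    also have "\<dots> = expectation (\<lambda>z'. (u z * v z - u z * v z' - v z * u z') + u z' * v z')"
      by (rule Bochner_Integration.integral_cong) (auto simp: algebra_simps)
    also have "\<dots> = u z * v z - u z * expectation v - v z * expectation u + expectation (\<lambda>z. u z * v z)"
      by (simp add: prob_space)
    finally show ?thesis .
  qed
  then have "0 \<le> expectation (\<lambda>z. u z * v z - u z * expectation v - v z * expectation u + expectation (\<lambda>z. u z * v z))"
    by (rule Bochner_Integration.integral_nonneg)
  also have "\<dots> = 2 * (expectation (\<lambda>z. u z * v z) - expectation u * expectation v)"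
    by (simp add: prob_space algebra_simps)
  finally show ?thesis by simp
qed

lemma expectation_indep_pair:
  fixes H :: "'b \<times> 'c \<Rightarrow> real"
  assumes [measurable]: "U \<in> measurable M N" "Z \<in> measurable M L"
    and ind: "distr M (N \<Otimes>\<^sub>M L) (\<lambda>\<omega>. (U \<omega>, Z \<omega>)) = distr M N U \<Otimes>\<^sub>M distr M L Z"
    and H[measurable]: "H \<in> borel_measurable (N \<Otimes>\<^sub>M L)"
    and b: "\<And>x. \<bar>H x\<bar> \<le> C"
  shows "expectation (\<lambda>\<omega>. H (U \<omega>, Z \<omega>)) = expectation (\<lambda>\<omega>. \<integral>z. H (U \<omega>, z) \<partial>distr M L Z)"
proof -
  interpret U: prob_space "distr M N U" by (rule prob_space_distr) simp
  interpret Z: prob_space "distr M L Z" by (rule prob_space_distr) simp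
  interpret P: pair_prob_space "distr M N U" "distr M L Z" ..
  have "expectation (\<lambda>\<omega>. H (U \<omega>, Z \<omega>)) = (\<integral>x. H x \<partial>distr M (N \<Otimes>\<^sub>M L) (\<lambda>\<omega>. (U \<omega>, Z \<omega>)))"
    by (simp add: integral_distr)
  also have "distr M (N \<Otimes>\<^sub>M L) (\<lambda>\<omega>. (U \<omega>, Z \<omega>)) = distr M N U \<Otimes>\<^sub>M distr M L Z"
    by (rule ind)
  also have "(\<integral>x. H x \<partial>\<dots>) = (\<integral>u. \<integral>z. H (u, z) \<partial>distr M L Z \<partial>distr M N U)"
    by (rule P.integral_fst'[symmetric], rule P.integrable_bounded[where C=C]) (use b in auto)
  also have "\<dots> = expectation (\<lambda>\<omega>. \<integral>z. H (U \<omega>, z) \<partial>distr M L Z)"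
    by (subst integral_distr) (auto intro!: Z.borel_measurable_lebesgue_integral)
  finally show ?thesis .
qed

definition positively_correlated :: "('a \<Rightarrow> 'b) \<Rightarrow> ('b \<Rightarrow> real) \<Rightarrow> ('b \<Rightarrow> real) \<Rightarrow> bool" where
  "positively_correlated V F G \<longleftrightarrow>
     expectation (\<lambda>\<omega>. F (V \<omega>)) * expectation (\<lambda>\<omega>. G (V \<omega>)) \<le> expectation (\<lambda>\<omega>. F (V \<omega>) * G (V \<omega>))"

text \<open>Conditionally on the states up to time \<open>n\<close>, the functionals depend monotonically on the single
  real state at time \<open>n + 1\<close>, hence are positively correlated; their conditional expectations are again
  monotone because the transition maps are.\<close>

lemma monotone_chain_association:
  fixes Y Z :: "nat \<Rightarrow> 'a \<Rightarrow> real" and f :: "nat \<Rightarrow> real \<Rightarrow> real \<Rightarrow> real"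
    and F G :: "(nat \<Rightarrow> real) \<Rightarrow> real"
  assumes Y0: "\<And>\<omega>. Y 0 \<omega> = x" and YS: "\<And>i \<omega>. i < N \<Longrightarrow> Y (Suc i) \<omega> = f i (Y i \<omega>) (Z i \<omega>)"
    and f_mono: "\<And>i z. i < N \<Longrightarrow> mono (\<lambda>y. f i y z)"
    and f_meas: "\<And>i. i < N \<Longrightarrow> (\<lambda>(y, z). f i y z) \<in> borel_measurable (borel \<Otimes>\<^sub>M borel)"
    and Y_meas: "\<And>i. i < N \<Longrightarrow> (\<lambda>\<omega> j. Y (min j i) \<omega>) \<in> measurable M (PiM UNIV (\<lambda>_. borel))"
    and Z_meas: "\<And>i. i < N \<Longrightarrow> Z i \<in> borel_measurable M"
    and ind: "\<And>i. i < N \<Longrightarrow>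
      distr M (PiM UNIV (\<lambda>_. borel) \<Otimes>\<^sub>M borel) (\<lambda>\<omega>. (\<lambda>j. Y (min j i) \<omega>, Z i \<omega>)) =
      distr M (PiM UNIV (\<lambda>_. borel)) (\<lambda>\<omega> j. Y (min j i) \<omega>) \<Otimes>\<^sub>M distr M borel (Z i)"
    and "n \<le> N"
    and F: "F \<in> borel_measurable (PiM UNIV (\<lambda>_. borel))" "mono F" "\<And>s. \<bar>F s\<bar> \<le> A"
    and G: "G \<in> borel_measurable (PiM UNIV (\<lambda>_. borel))" "mono G" "\<And>s. \<bar>G s\<bar> \<le> B"
  shows "positively_correlated (\<lambda>\<omega> j. Y (min j n) \<omega>) F G"
  using \<open>n \<le> N\<close> F G
proof (induction n arbitrary: F G)
  case 0
  then show ?case by (simp add: positively_correlated_def Y0 prob_space)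
next
  case (Suc n)
  let ?S = "PiM UNIV (\<lambda>_. borel) :: (nat \<Rightarrow> real) measure" and ?\<mu> = "distr M borel (Z n)"
  \<comment> \<open>Histories are encoded as whole sequences, constant from time \<open>n\<close>
    on, so that all \<open>n\<close> share one product space. \<open>e\<close> replaces the constant
    tail by the next state.\<close>
  define e where "e s z = (\<lambda>j. if j \<le> n then s j else f n (s n) z)" for s :: "nat \<Rightarrow> real" and z
  note n = Suc_le_lessD[OF Suc.prems(1)]
  note ind = ind[OF Suc_le_lessD[OF Suc.prems(1)]]
  have U[measurable]: "(\<lambda>\<omega> j. Y (min j n) \<omega>) \<in> measurable M ?S" and [measurable]: "Z n \<in> borel_measurable M"
    using Y_meas[OF n] Z_meas[OF n] .
  interpret Z: prob_space ?\<mu> by (rule prob_space_distr) simp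
  have e_mono: "e s z \<le> e s' z" if "s \<le> s'" for s s' z
    using that f_mono[OF n, of z] by (auto simp: e_def le_fun_def mono_def)
  have e_meas[measurable]: "(\<lambda>(s, z). e s z) \<in> measurable (?S \<Otimes>\<^sub>M borel) ?S"
  proof (rule measurable_PiM_single')
    fix j :: nat
    have "(\<lambda>x. (fst x n, snd x)) \<in> measurable (?S \<Otimes>\<^sub>M borel) (borel \<Otimes>\<^sub>M borel)"
      by measurable
    from measurable_compose[OF this f_meas[OF n]]
    have "(\<lambda>x. f n (fst x n) (snd x)) \<in> borel_measurable (?S \<Otimes>\<^sub>M borel)" by simp
    moreover have "(\<lambda>x. fst x j) \<in> borel_measurable (?S \<Otimes>\<^sub>M borel)" by measurable
    ultimately show "(\<lambda>x. (case x of (s, z) \<Rightarrow> e s z) j) \<in> borel_measurable (?S \<Otimes>\<^sub>M borel)"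
      by (simp add: e_def case_prod_beta)
  qed auto
  have Y_eq: "(\<lambda>j. Y (min j (Suc n)) \<omega>) = e (\<lambda>j. Y (min j n) \<omega>) (Z n \<omega>)" for \<omega>
  proof
    fix j
    show "Y (min j (Suc n)) \<omega> = e (\<lambda>j. Y (min j n) \<omega>) (Z n \<omega>) j"
      using YS[OF n] by (cases "j \<le> n") (auto simp: e_def min_absorb1 min_absorb2)
  qed
  have meas_e: "(\<lambda>z. H (e s z)) \<in> borel_measurable borel"
    if "H \<in> borel_measurable ?S" for H :: "(nat \<Rightarrow> real) \<Rightarrow> real" and s
  proof -
    have "(\<lambda>z. (s, z)) \<in> measurable borel (?S \<Otimes>\<^sub>M borel)" by (simp add: space_PiM)
    from measurable_compose[OF this measurable_compose[OF e_meas that]] show ?thesis by simp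
  qed
  define E where "E H s = (\<integral>z. H (e s z) \<partial>?\<mu>)" for H :: "(nat \<Rightarrow> real) \<Rightarrow> real" and s
  have E_meas: "E H \<in> borel_measurable ?S" if [measurable]: "H \<in> borel_measurable ?S" for H :: "(nat \<Rightarrow> real) \<Rightarrow> real"
  proof -
    have "(\<lambda>(s, z). H (e s z)) \<in> borel_measurable (?S \<Otimes>\<^sub>M ?\<mu>)"
      using measurable_compose[OF e_meas that] by (simp add: case_prod_beta')
    then show ?thesis unfolding E_def by (rule Z.borel_measurable_lebesgue_integral)
  qed
  have E_int: "integrable ?\<mu> (\<lambda>z. H (e s z))"
    if "H \<in> borel_measurable ?S" "\<And>s. \<bar>H s\<bar> \<le> C" for H :: "(nat \<Rightarrow> real) \<Rightarrow> real" and C s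
    using meas_e[OF that(1)] that(2) by (intro Z.integrable_bounded[where C=C]) auto
  have E_bound: "\<bar>E H s\<bar> \<le> C" if "H \<in> borel_measurable ?S" "\<And>s. \<bar>H s\<bar> \<le> C" for H :: "(nat \<Rightarrow> real) \<Rightarrow> real" and C s
  proof -
    have "\<bar>E H s\<bar> \<le> (\<integral>z. \<bar>H (e s z)\<bar> \<partial>?\<mu>)" unfolding E_def by (rule integral_abs_bound)
    also have "\<dots> \<le> C" by (intro Z.integral_le_const integrable_abs E_int[OF that]) (use that in auto)
    finally show ?thesis .
  qed
  have E_mono: "mono (E H)" if "H \<in> borel_measurable ?S" "\<And>s. \<bar>H s\<bar> \<le> C" "mono H" for H :: "(nat \<Rightarrow> real) \<Rightarrow> real" and C
  proof (rule monoI)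
    fix s s' :: "nat \<Rightarrow> real" assume "s \<le> s'"
    then show "E H s \<le> E H s'" unfolding E_def
      by (intro integral_mono E_int[OF that(1,2)] monoD[OF that(3)] e_mono)
  qed
  have E_exp: "expectation (\<lambda>\<omega>. H (\<lambda>j. Y (min j (Suc n)) \<omega>)) = expectation (\<lambda>\<omega>. E H (\<lambda>j. Y (min j n) \<omega>))"
    if "H \<in> borel_measurable ?S" "\<And>s. \<bar>H s\<bar> \<le> C" for H :: "(nat \<Rightarrow> real) \<Rightarrow> real" and C
  proof -
    have "(\<lambda>(s, z). H (e s z)) \<in> borel_measurable (?S \<Otimes>\<^sub>M borel)"
      using measurable_compose[OF e_meas that(1)] by (simp add: case_prod_beta')
    moreover have "\<bar>case x of (s, z) \<Rightarrow> H (e s z)\<bar> \<le> C" for x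
      using that(2) by (simp add: case_prod_beta)
    ultimately show ?thesis
      unfolding Y_eq E_def using expectation_indep_pair[OF U _ ind, of _ C] by force
  qed
  have int: "integrable M (\<lambda>\<omega>. H (\<lambda>j. Y (min j n) \<omega>))"
    if "H \<in> borel_measurable ?S" "\<And>s. \<bar>H s\<bar> \<le> C" for H :: "(nat \<Rightarrow> real) \<Rightarrow> real" and C
    using measurable_compose[OF U that(1)] that(2) by (rule integrable_bounded)
  have A: "A \<ge> 0" using Suc.prems(4)[of undefined] by linarith
  have FG: "(\<lambda>s. F s * G s) \<in> borel_measurable ?S" "\<And>s. \<bar>F s * G s\<bar> \<le> A * B"
    using Suc.prems A by (auto simp: abs_mult intro!: mult_mono)
  have 1: "expectation (\<lambda>\<omega>. F (\<lambda>j. Y (min j (Suc n)) \<omega>)) * expectation (\<lambda>\<omega>. G (\<lambda>j. Y (min j (Suc n)) \<omega>)) =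
      expectation (\<lambda>\<omega>. E F (\<lambda>j. Y (min j n) \<omega>)) * expectation (\<lambda>\<omega>. E G (\<lambda>j. Y (min j n) \<omega>))"
    using E_exp[OF Suc.prems(2,4)] E_exp[OF Suc.prems(5,7)] by simp
  have 2: "expectation (\<lambda>\<omega>. E F (\<lambda>j. Y (min j n) \<omega>)) * expectation (\<lambda>\<omega>. E G (\<lambda>j. Y (min j n) \<omega>))
      \<le> expectation (\<lambda>\<omega>. E F (\<lambda>j. Y (min j n) \<omega>) * E G (\<lambda>j. Y (min j n) \<omega>))"
  proof -
    have "positively_correlated (\<lambda>\<omega> j. Y (min j n) \<omega>) (E F) (E G)"
      by (rule Suc.IH) (use Suc.prems in \<open>auto intro!: E_meas E_mono E_bound\<close>)
    then show ?thesis unfolding positively_correlated_def .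
  qed
  have 3: "expectation (\<lambda>\<omega>. E F (\<lambda>j. Y (min j n) \<omega>) * E G (\<lambda>j. Y (min j n) \<omega>))
      \<le> expectation (\<lambda>\<omega>. E (\<lambda>s. F s * G s) (\<lambda>j. Y (min j n) \<omega>))"
  proof (rule integral_mono)
    show "integrable M (\<lambda>\<omega>. E (\<lambda>s. F s * G s) (\<lambda>j. Y (min j n) \<omega>))"
      by (rule int[OF E_meas E_bound[of _ "A * B"]]) (use FG in auto)
    show "integrable M (\<lambda>\<omega>. E F (\<lambda>j. Y (min j n) \<omega>) * E G (\<lambda>j. Y (min j n) \<omega>))"
    proof (rule int[of "\<lambda>s. E F s * E G s" "A * B"])
      show "(\<lambda>s. E F s * E G s) \<in> borel_measurable ?S" using Suc.prems E_meas by auto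
      show "\<bar>E F s * E G s\<bar> \<le> A * B" for s
        using E_bound[OF Suc.prems(2,4)] E_bound[OF Suc.prems(5,7)] A by (auto simp: abs_mult intro!: mult_mono)
    qed
    fix \<omega>
    have "E F s * E G s \<le> E (\<lambda>s. F s * G s) s" for s
      unfolding E_def
    proof (rule Z.chebyshev_association)
      fix z z'
      \<comment> \<open>Two continuations of one history differ only in a single repeated real
        number, so they are always comparable. This is where the state space being one-dimensional
        is essential.\<close>
      have "e s z \<le> e s z' \<or> e s z' \<le> e s z"
        using linear[of "f n (s n) z" "f n (s n) z'"] by (auto simp: e_def le_fun_def)
      then show "0 \<le> (F (e s z) - F (e s z')) * (G (e s z) - G (e s z'))"
        using monoD[OF Suc.prems(3), of "e s z" "e s z'"] monoD[OF Suc.prems(3), of "e s z'" "e s z"]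
          monoD[OF Suc.prems(6), of "e s z" "e s z'"] monoD[OF Suc.prems(6), of "e s z'" "e s z"]
        by (auto simp: zero_le_mult_iff)
    next
      show "(\<lambda>z. F (e s z)) \<in> borel_measurable ?\<mu>" "(\<lambda>z. G (e s z)) \<in> borel_measurable ?\<mu>"
        using meas_e[OF Suc.prems(2)] meas_e[OF Suc.prems(5)] by simp_all
    qed (rule Suc.prems)+
    then show "E F (\<lambda>j. Y (min j n) \<omega>) * E G (\<lambda>j. Y (min j n) \<omega>) \<le> E (\<lambda>s. F s * G s) (\<lambda>j. Y (min j n) \<omega>)" .
  qed
  have 4: "expectation (\<lambda>\<omega>. F (\<lambda>j. Y (min j (Suc n)) \<omega>) * G (\<lambda>j. Y (min j (Suc n)) \<omega>)) =
      expectation (\<lambda>\<omega>. E (\<lambda>s. F s * G s) (\<lambda>j. Y (min j n) \<omega>))"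
    by (rule E_exp[of "\<lambda>s. F s * G s" "A * B"]) (use FG in auto)
  show ?case unfolding positively_correlated_def 1 4 by (rule order_trans[OF 2 3])
qed

end

section \<open>Monotone Euler schemes\<close>

lemma quadratic_sum_le: "(p + q)\<^sup>2 \<le> 2 * p\<^sup>2 + 2 * q\<^sup>2" for p q :: real
  using sum_squares_bound[of p q] by (simp add: power2_sum)

definition clamp_to :: "real \<Rightarrow> real \<Rightarrow> real" where "clamp_to c y = max (- c) (min c y)"

lemma clamp_to_lipschitz: "\<bar>clamp_to c y - clamp_to c z\<bar> \<le> \<bar>y - z\<bar>"
  unfolding clamp_to_def by linarith

lemma clamp_to_bound: "c \<ge> 0 \<Longrightarrow> \<bar>clamp_to c y\<bar> \<le> c"
  unfolding clamp_to_def by linarith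

lemma clamp_to_eq: "\<bar>y\<bar> \<le> c \<Longrightarrow> clamp_to c y = y"
  unfolding clamp_to_def by linarith

lemma continuous_clamp_to: "continuous_on A (clamp_to c)"
  unfolding clamp_to_def by (intro continuous_intros)

text \<open>The fourth power has mean \<open>3 * h\<^sup>2\<close> for an increment over a step
  \<open>h\<close>, so with \<open>c\<close> fixed the truncation errors of all steps add up to
  order \<open>h\<close>.\<close>

lemma clamp_to_error:
  assumes "c > 0" shows "\<bar>w - clamp_to c w\<bar> \<le> w ^ 4 / c ^ 3"
proof (cases "\<bar>w\<bar> \<le> c")
  case True
  then show ?thesis using assms by (simp add: clamp_to_eq)
next
  case False
  have "\<bar>w - clamp_to c w\<bar> \<le> \<bar>w\<bar>" using False assms unfolding clamp_to_def by linarith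
  also have "\<bar>w\<bar> * c ^ 3 \<le> \<bar>w\<bar> * \<bar>w\<bar> ^ 3" using False assms by (intro mult_left_mono power_mono) auto
  then have "\<bar>w\<bar> \<le> \<bar>w\<bar> * \<bar>w\<bar> ^ 3 / c ^ 3" using assms by (simp add: field_simps)
  also have "\<bar>w\<bar> * \<bar>w\<bar> ^ 3 = \<bar>w\<bar> ^ 4" by (simp add: power4_eq_xxxx power3_eq_cube mult.assoc)
  also have "\<dots> = w ^ 4" by (rule power_even_abs) simp
  finally show ?thesis .
qed

text \<open>Drift and noise can each take back at most half of the gap \<open>z - y\<close>.\<close>

lemma euler_map_mono:
  fixes \<beta> s :: "real \<Rightarrow> real"
  assumes "\<And>y z. \<bar>\<beta> y - \<beta> z\<bar> \<le> L * \<bar>y - z\<bar>" "\<And>y z. \<bar>s y - s z\<bar> \<le> \<Lambda> * \<bar>y - z\<bar>"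
    and "h \<ge> 0" "h * L \<le> 1 / 2" "\<Lambda> * c \<le> 1 / 2" "c \<ge> 0"
  shows "mono (\<lambda>y. y + h * \<beta> y + s y * clamp_to c w)"
proof (rule monoI)
  fix y z :: real assume yz: "y \<le> z"
  have "h * \<bar>\<beta> y - \<beta> z\<bar> \<le> h * (L * (z - y))" using assms(1)[of y z] assms(3) yz by (intro mult_left_mono) auto
  also have "\<dots> = (h * L) * (z - y)" by simp
  also have "\<dots> \<le> 1 / 2 * (z - y)" using assms(4) yz by (intro mult_right_mono) auto
  finally have "h * \<bar>\<beta> y - \<beta> z\<bar> \<le> (z - y) / 2" by simp
  then have 1: "\<bar>h * \<beta> y - h * \<beta> z\<bar> \<le> (z - y) / 2" using assms(3) by (simp add: abs_mult flip: right_diff_distrib)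
  have "\<bar>(s y - s z) * clamp_to c w\<bar> \<le> (\<Lambda> * (z - y)) * c"
    unfolding abs_mult using assms(2)[of y z] yz clamp_to_bound[OF assms(6), of w] by (intro mult_mono) auto
  also have "\<dots> = (\<Lambda> * c) * (z - y)" by simp
  also have "\<dots> \<le> 1 / 2 * (z - y)" using assms(5) yz by (intro mult_right_mono) auto
  finally have "\<bar>s y * clamp_to c w - s z * clamp_to c w\<bar> \<le> (z - y) / 2" by (simp add: left_diff_distrib)
  from abs_le_D1[OF this] abs_le_D1[OF 1]
  show "y + h * \<beta> y + s y * clamp_to c w \<le> z + h * \<beta> z + s z * clamp_to c w" by simp
qed

lemma truncated_coefficient_bounded:
  fixes f :: "real \<Rightarrow> real \<Rightarrow> real"
  assumes "continuous_on ({0..T} \<times> UNIV) (\<lambda>(t, y). f t y)" "R \<ge> 0"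
  shows "\<exists>C. \<forall>t\<in>{0..T}. \<forall>y. \<bar>f t (clamp_to R y)\<bar> \<le> C"
proof -
  have "continuous_on ({0..T} \<times> {- R..R}) (\<lambda>(t, y). f t y)"
    by (rule continuous_on_subset[OF assms(1)]) auto
  then have "compact ((\<lambda>(t, y). f t y) ` ({0..T} \<times> {- R..R}))"
    by (intro compact_continuous_image compact_Times) auto
  then obtain C where C: "\<forall>z\<in>(\<lambda>(t, y). f t y) ` ({0..T} \<times> {- R..R}). norm z \<le> C"
    by (meson bounded_iff compact_imp_bounded)
  have "\<bar>f t (clamp_to R y)\<bar> \<le> C" if "t \<in> {0..T}" for t y
  proof -
    have "clamp_to R y \<in> {- R..R}" using clamp_to_bound[OF assms(2), of y] by (auto simp: abs_le_iff)
    then show ?thesis using C that by force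
  qed
  then show ?thesis by blast
qed

section \<open>Construction of the scheme and its comparison with the solution\<close>

locale sde = brownian M T W for M :: "'a measure" and T W +
  fixes x L :: real and b \<sigma> :: "real \<Rightarrow> real \<Rightarrow> real" and \<rho> :: "real \<Rightarrow> real" and X :: "real \<Rightarrow> 'a \<Rightarrow> real"
  assumes b_cont: "continuous_on ({0..T} \<times> UNIV) (\<lambda>(t, y). b t y)"
    and L: "L \<ge> 0" and b_lip: "\<And>t y z. t \<in> {0..T} \<Longrightarrow> \<bar>b t y - b t z\<bar> \<le> L * \<bar>y - z\<bar>"
    and \<sigma>_cont: "continuous_on ({0..T} \<times> UNIV) (\<lambda>(t, y). \<sigma> t y)"
    and \<sigma>_mod: "\<And>t y z. t \<in> {0..T} \<Longrightarrow> \<bar>\<sigma> t y - \<sigma> t z\<bar> \<le> \<rho> \<bar>y - z\<bar>"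
    and \<rho>: "strict_mono \<rho>" "\<rho> 0 = 0"
    and osgood: "\<forall>\<epsilon>>0. (\<integral>\<^sup>+u\<in>{0<..<\<epsilon>}. ennreal (1 / (\<rho> u)\<^sup>2) \<partial>lborel) = \<infinity>"
    and sol: "sde_solution M \<F> T W b \<sigma> x X"
begin

lemma X_cont: "continuous_process M T X" and X_adapted: "adapted \<F> T X"
  using sol by (auto simp: sde_solution_def)

lemma \<rho>_mono: "u \<le> v \<Longrightarrow> \<rho> u \<le> \<rho> v"
  using \<rho>(1) by (simp add: strict_mono_less_eq)

text \<open>An Euler scheme with coefficients frozen outside a ball, Lipschitz diffusion coefficient and
  truncated noise: its transition maps are monotone for small steps, and it is compared with
  \<open>X\<close> through the Euler sum \<open>Xt\<close> along the path of \<open>X\<close> itself.\<close>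

lemma monotone_scheme_approximation:
  assumes "\<epsilon> > 0" "\<theta> > 0"
  shows "\<exists>n0::nat. \<forall>n\<ge>n0. n > 0 \<longrightarrow> (\<exists>Y :: nat \<Rightarrow> 'a \<Rightarrow> real.
    (\<forall>i\<le>n. Y i \<in> borel_measurable M) \<and>
    (\<forall>i\<le>n. prob {\<omega> \<in> space M. \<bar>Y i \<omega> - X (real i * T / n) \<omega>\<bar> > \<epsilon>} \<le> \<theta>) \<and>
    (\<forall>F G A B. F \<in> borel_measurable (PiM UNIV (\<lambda>_. borel)) \<and> mono F \<and> (\<forall>s. \<bar>F s\<bar> \<le> A) \<and>
       G \<in> borel_measurable (PiM UNIV (\<lambda>_. borel)) \<and> mono G \<and> (\<forall>s. \<bar>G s\<bar> \<le> B) \<longrightarrow>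
       positively_correlated (\<lambda>\<omega> j. Y (min j n) \<omega>) F G))"
proof -
  obtain R E where R: "R > 0" and E: "E \<in> events" "prob (space M - E) \<le> \<theta> / 4"
    and XR: "\<And>\<omega> i n. \<omega> \<in> E \<Longrightarrow> i \<le> n \<Longrightarrow> n > (0::nat) \<Longrightarrow> \<bar>X (real i * T / real n) \<omega>\<bar> \<le> R"
    by (rule continuous_process_tight[OF X_cont, of "\<theta> / 4"]) (use \<open>\<theta> > 0\<close> that in auto)
  define bR where "bR t y = b t (clamp_to R y)" for t y
  define sR where "sR t y = \<sigma> t (clamp_to R y)" for t y
  obtain C1 where "\<forall>t\<in>{0..T}. \<forall>y. \<bar>bR t y\<bar> \<le> C1"
    using truncated_coefficient_bounded[OF b_cont less_imp_le[OF R]] unfolding bR_def ..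
  moreover obtain C2 where "\<forall>t\<in>{0..T}. \<forall>y. \<bar>sR t y\<bar> \<le> C2"
    using truncated_coefficient_bounded[OF \<sigma>_cont less_imp_le[OF R]] unfolding sR_def ..
  moreover define C where "C = max 1 (max C1 C2)"
  ultimately have C: "C \<ge> 1" and bC: "\<And>t y. t \<in> {0..T} \<Longrightarrow> \<bar>bR t y\<bar> \<le> C" and sC: "\<And>t y. t \<in> {0..T} \<Longrightarrow> \<bar>sR t y\<bar> \<le> C"
    by (auto simp: le_max_iff_disj)
  have bR_lip: "\<bar>bR t y - bR t z\<bar> \<le> L * \<bar>y - z\<bar>" if "t \<in> {0..T}" for t y z
    unfolding bR_def
    by (rule order_trans[OF b_lip[OF that] mult_left_mono[OF clamp_to_lipschitz L]])
  have sR_mod: "\<bar>sR t y - sR t z\<bar> \<le> \<rho> \<bar>y - z\<bar>" if "t \<in> {0..T}" for t y z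
    unfolding sR_def
    by (rule order_trans[OF \<sigma>_mod[OF that] \<rho>_mono[OF clamp_to_lipschitz]])
  have \<rho>_nonneg: "\<rho> u \<ge> 0" if "u \<ge> 0" for u using \<rho>_mono[OF that] \<rho>(2) by simp

  \<comment> \<open>The target for the factor in front of \<open>exp (L * T)\<close> in the mean
    error. The mean is then at most \<open>\<epsilon> * \<theta> / 8\<close>, and Markov's
    inequality at level \<open>\<epsilon> / 2\<close> costs \<open>\<theta> / 4\<close>. Five
    contributions receive \<open>q / 5\<close> each: the smoothing error, \<open>g1\<close>,
    \<open>\<kappa>\<close>, \<open>e2\<close> and the terms of higher order in
    \<open>h\<close>.\<close>
  define q where "q = \<epsilon> * \<theta> / 8 * exp (- (L * T))"
  have q: "q > 0" using \<open>\<epsilon> > 0\<close> \<open>\<theta> > 0\<close> by (simp add: q_def)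
  define \<kappa> where "\<kappa> = q / (10 * T)"
  have \<kappa>: "\<kappa> > 0" using q T_pos by (simp add: \<kappa>_def)
  obtain \<phi> p :: "real \<Rightarrow> real" and K \<delta> where K: "K \<ge> 0" "\<delta> > 0" "\<phi> 0 = 0" "continuous_on UNIV p"
    "\<And>u. (\<phi> has_real_derivative p u) (at u)" "\<And>u. \<bar>p u\<bar> \<le> 1" "\<And>u. \<bar>u\<bar> - q / 5 \<le> \<phi> u"
    "\<And>d a e w. \<bar>a\<bar> \<le> \<rho> \<bar>d\<bar> + e \<Longrightarrow> e \<ge> 0 \<Longrightarrow>
       \<phi> (d + a * w) \<le> \<phi> d + p d * a * w + (2 * \<kappa> + 2 * K * e\<^sup>2) * w\<^sup>2 + K / \<delta>\<^sup>2 * a ^ 4 * w ^ 4"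
    by (rule yamada_watanabe_function[OF \<rho> osgood _ \<kappa>, of "q / 5"]) (use q in simp, rule that)
  \<comment> \<open>Chosen after \<open>K\<close>, which multiplies it in the estimate;
    \<open>K + 1\<close> keeps the quotient defined when \<open>K\<close> is zero.\<close>
  define e2 where "e2 = q / (10 * T * (K + 1))"
  have e2: "e2 > 0" using q T_pos K by (simp add: e2_def)
  define s where "s = sqrt (e2 / 16)"
  have s: "s > 0" "16 * s\<^sup>2 = e2" using e2 by (auto simp: s_def)
  \<comment> \<open>A probability level, not an outcome: it bounds the exceptional sets
    \<open>N i\<close>. It has to fit into the final union bound and to keep the share of
    \<open>N i\<close> in the means of \<open>(e i)\<^sup>2\<close> and \<open>g i\<close> within
    half of their budgets.\<close>
  define \<omega>0 where "\<omega>0 = min (\<theta> / 4) (min (e2 / (16 * C\<^sup>2)) (q / (20 * C * T)))"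
  have \<omega>0: "\<omega>0 > 0" "\<omega>0 \<le> \<theta> / 4" "16 * C\<^sup>2 * \<omega>0 \<le> e2" "20 * C * T * \<omega>0 \<le> q"
  proof -
    show "\<omega>0 > 0" using \<open>\<theta> > 0\<close> e2 C q T_pos by (simp add: \<omega>0_def)
    have "\<omega>0 \<le> e2 / (16 * C\<^sup>2)" "\<omega>0 \<le> q / (20 * C * T)" by (auto simp: \<omega>0_def)
    then show "16 * C\<^sup>2 * \<omega>0 \<le> e2" "20 * C * T * \<omega>0 \<le> q" using C T_pos by (auto simp: field_simps)
  qed (simp add: \<omega>0_def)
  obtain d where d: "d > 0" "\<rho> d < s" using osgood_small[OF \<rho> osgood s(1)] by blast
  \<comment> \<open>The tolerance between the Euler sum and \<open>X\<close>. It enters the final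
    error through \<open>\<epsilon> / 2\<close>, the diffusion error through
    \<open>\<rho> v \<le> s\<close> and the drift error through \<open>L * v\<close>.\<close>
  define v where "v = min d (min (\<epsilon> / 2) (q / (10 * T * (L + 1))))"
  have v: "v > 0" "v \<le> \<epsilon> / 2" "\<rho> v \<le> s" "10 * T * (L * v) \<le> q"
  proof -
    show "v > 0" using d \<open>\<epsilon> > 0\<close> q T_pos L by (simp add: v_def)
    show "\<rho> v \<le> s" using \<rho>_mono[of v d] d by (simp add: v_def)
    have "v \<le> q / (10 * T * (L + 1))" "0 < 10 * T * (L + 1)" using T_pos L by (auto simp: v_def)
    then have "10 * T * (L + 1) * v \<le> q" by (metis mult.commute pos_le_divide_eq)
    moreover have "10 * T * (L * v) \<le> 10 * T * (L + 1) * v" using T_pos \<open>v > 0\<close> by (simp add: algebra_simps)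
    ultimately show "10 * T * (L * v) \<le> q" by linarith
  qed (simp add: v_def)
  \<comment> \<open>Makes the error of the inf-convolution equal to \<open>\<rho> d\<close>, which
    is below \<open>s\<close>.\<close>
  define \<Lambda> where "\<Lambda> = 2 * C / d"
  have \<Lambda>: "\<Lambda> > 0" "2 * C / \<Lambda> = d" using C d by (auto simp: \<Lambda>_def)
  define c where "c = 1 / (2 * \<Lambda>)"
  have c: "c > 0" "\<Lambda> * c \<le> 1 / 2" using \<Lambda> by (auto simp: c_def)
  have "\<forall>t\<in>{0..T}. \<exists>g. (\<forall>y. \<bar>g y\<bar> \<le> C) \<and> (\<forall>y z. \<bar>g y - g z\<bar> \<le> \<Lambda> * \<bar>y - z\<bar>) \<and> (\<forall>y. \<bar>sR t y - g y\<bar> \<le> s)"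
  proof
    fix t assume t: "t \<in> {0..T}"
    obtain g where "\<And>y. \<bar>g y\<bar> \<le> C" "\<And>y z. \<bar>g y - g z\<bar> \<le> \<Lambda> * \<bar>y - z\<bar>" "\<And>y. \<bar>sR t y - g y\<bar> \<le> \<rho> (2 * C / \<Lambda>)"
      by (rule inf_convolution[OF sC[OF t] sR_mod[OF t] strict_mono_mono[OF \<rho>(1)] \<rho>(2) \<Lambda>(1)]) (rule that)
    then show "\<exists>g. (\<forall>y. \<bar>g y\<bar> \<le> C) \<and> (\<forall>y z. \<bar>g y - g z\<bar> \<le> \<Lambda> * \<bar>y - z\<bar>) \<and> (\<forall>y. \<bar>sR t y - g y\<bar> \<le> s)"
      unfolding \<Lambda>(2) using order_trans[OF _ less_imp_le[OF d(2)]] by blast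
  qed
  from bchoice[OF this] obtain sL where "\<forall>t\<in>{0..T}. (\<forall>y. \<bar>sL t y\<bar> \<le> C) \<and>
      (\<forall>y z. \<bar>sL t y - sL t z\<bar> \<le> \<Lambda> * \<bar>y - z\<bar>) \<and> (\<forall>y. \<bar>sR t y - sL t y\<bar> \<le> s)" ..
  then have sL: "\<And>t y. t \<in> {0..T} \<Longrightarrow> \<bar>sL t y\<bar> \<le> C"
    "\<And>t y z. t \<in> {0..T} \<Longrightarrow> \<bar>sL t y - sL t z\<bar> \<le> \<Lambda> * \<bar>y - z\<bar>" "\<And>t y. t \<in> {0..T} \<Longrightarrow> \<bar>sR t y - sL t y\<bar> \<le> s"
    by blast+
  define G where "G = C / c ^ 3"
  define A where "A = 2 * s + 2 * C + L * v"
  have G: "G \<ge> 0" using C c by (simp add: G_def)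
  define Zc where "Zc = 3 * T * (K / \<delta>\<^sup>2 * A ^ 4 + G)"
  from sde_solution_grid[OF b_cont \<sigma>_cont sol v(1) \<omega>0(1)]
  obtain n1 :: nat where n1: "\<forall>n\<ge>n1. n > 0 \<longrightarrow> (\<forall>i\<le>n. prob {\<omega> \<in> space M.
    \<bar>x + (\<Sum>j<i. b (j * T / n) (X (j * T / n) \<omega>) * (T / n) +
        \<sigma> (j * T / n) (X (j * T / n) \<omega>) * (W (Suc j * T / n) \<omega> - W (j * T / n) \<omega>)) - X (i * T / n) \<omega>\<bar> > v} \<le> \<omega>0)" ..
  \<comment> \<open>With all other constants fixed, the remaining demands on the step are
    \<open>h * Zc \<le> q / 5\<close> for the higher-order terms and
    \<open>h * L \<le> 1 / 2\<close> for monotonicity.\<close>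
  obtain n2 :: nat where n2: "max (5 * (T * Zc) / q) (2 * (L * T)) < real n2" using reals_Archimedean2 by blast
  show ?thesis
  proof (intro exI[of _ "max n1 n2"] allI impI)
    fix n :: nat assume "max n1 n2 \<le> n" and n: "0 < n"
    then have nn: "n1 \<le> n" "5 * (T * Zc) / q < real n" "2 * (L * T) < real n" using n2 by auto
    define h where "h = T / n"
    have h: "h > 0" "h * Zc \<le> q / 5" "h * L \<le> 1 / 2"
      using nn(2,3) n T_pos q by (auto simp: h_def field_simps)
    define tm where "tm i = real i * T / real n" for i
    define dW where "dW i \<omega> = W (real (Suc i) * T / n) \<omega> - W (real i * T / n) \<omega>" for i \<omega>
    have tm: "tm i \<in> {0..T}" if "i \<le> n" for i unfolding tm_def by (rule grid_mem[OF that n])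
    have tm_mono: "tm i \<le> tm j" if "i \<le> j" for i j unfolding tm_def by (rule grid_mono[OF that])
    define f where "f i y w = y + h * bR (tm i) y + sL (tm i) y * clamp_to c w" for i y w
    define Y where "Y i \<omega> = rec_nat x (\<lambda>i y. f i y (dW i \<omega>)) i" for i \<omega>
    have Y0: "Y 0 \<omega> = x" and YS: "Y (Suc i) \<omega> = f i (Y i \<omega>) (dW i \<omega>)" for i \<omega> by (simp_all add: Y_def)
    define Xt where "Xt i \<omega> = x + (\<Sum>j<i. b (tm j) (X (tm j) \<omega>) * h + \<sigma> (tm j) (X (tm j) \<omega>) * dW j \<omega>)" for i \<omega>
    define N where "N i = {\<omega> \<in> space M. \<bar>Xt i \<omega> - X (tm i) \<omega>\<bar> > v}" for i
    have PN: "prob (N i) \<le> \<omega>0" if "i \<le> n" for i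
      using n1[rule_format, OF nn(1) n that] unfolding N_def Xt_def tm_def dW_def h_def .
    have bm: "b t \<in> borel_measurable borel" "\<sigma> t \<in> borel_measurable borel" "bR t \<in> borel_measurable borel"
        "sR t \<in> borel_measurable borel" "sL t \<in> borel_measurable borel" if "t \<in> {0..T}" for t
    proof -
      note bt = continuous_on_section[OF b_cont that] and st = continuous_on_section[OF \<sigma>_cont that]
      show "b t \<in> borel_measurable borel" "\<sigma> t \<in> borel_measurable borel"
        by (rule borel_measurable_continuous_onI[OF bt], rule borel_measurable_continuous_onI[OF st])
      show "bR t \<in> borel_measurable borel" "sR t \<in> borel_measurable borel"
        unfolding bR_def sR_def
        by (rule borel_measurable_continuous_onI, rule continuous_on_compose2[OF bt continuous_clamp_to], simp,
            rule borel_measurable_continuous_onI, rule continuous_on_compose2[OF st continuous_clamp_to], simp)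
      have "continuous_on UNIV (sL t)"
        by (rule lipschitz_on_continuous_on[of \<Lambda>], rule lipschitz_onI)
          (use sL(2)[OF that] \<Lambda> in \<open>auto simp: dist_real_def\<close>)
      then show "sL t \<in> borel_measurable borel" by (rule borel_measurable_continuous_onI)
    qed
    have cm: "clamp_to c \<in> borel_measurable borel" by (rule borel_measurable_continuous_onI[OF continuous_clamp_to])
    have Xm: "X (tm j) \<in> borel_measurable (\<F> (tm i))" if "j \<le> i" "i \<le> n" for i j
    proof (rule measurable_filtration_mono[OF _ tm_mono[OF that(1)]])
      have "tm j \<in> {0..T}" using that by (intro tm) simp
      then show "X (tm j) \<in> borel_measurable (\<F> (tm j))" using X_adapted unfolding adapted_def by blast
    qed
    have dWm: "dW j \<in> borel_measurable (\<F> (tm i))" if "j < i" "i \<le> n" for i j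
    proof -
      have t: "0 \<le> tm j" "0 \<le> tm (Suc j)" "tm j \<le> tm i" "tm (Suc j) \<le> tm i"
        using tm[of j] tm[of "Suc j"] tm_mono[of j i] tm_mono[of "Suc j" i] that by simp_all
      have eq: "dW j = (\<lambda>\<omega>. W (tm (Suc j)) \<omega> - W (tm j) \<omega>)" by (rule ext) (simp only: dW_def tm_def)
      show ?thesis unfolding eq
        by (rule borel_measurable_diff[OF W_measurable_filtration[OF t(2,4)] W_measurable_filtration[OF t(1,3)]])
    qed
    have Ym: "Y j \<in> borel_measurable (\<F> (tm i))" if "j \<le> i" "i \<le> n" for i j
      using that(1)
    proof (induction j)
      case 0
      have "Y 0 = (\<lambda>_. x)" by (rule ext) (rule Y0)
      then show ?case by simp
    next
      case (Suc j)
      then have j: "j \<le> i" "j < i" and t: "tm j \<in> {0..T}" using that tm by auto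
      note yj = Suc.IH[OF j(1)]
      have eq: "Y (Suc j) = (\<lambda>\<omega>. Y j \<omega> + h * bR (tm j) (Y j \<omega>) + sL (tm j) (Y j \<omega>) * clamp_to c (dW j \<omega>))"
        by (rule ext) (simp add: YS f_def)
      show ?case unfolding eq
        by (intro borel_measurable_add borel_measurable_times borel_measurable_const yj
            measurable_compose[OF yj bm(3)[OF t]] measurable_compose[OF yj bm(5)[OF t]]
            measurable_compose[OF dWm[OF j(2) that(2)] cm])
    qed
    have Xtm: "Xt i \<in> borel_measurable (\<F> (tm i))" if "i \<le> n" for i
      unfolding Xt_def
    proof (intro borel_measurable_add borel_measurable_sum borel_measurable_times borel_measurable_const)
      fix j assume "j \<in> {..<i}"
      then have j: "j \<le> i" "j < i" and t: "tm j \<in> {0..T}" using that tm by auto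
      show "(\<lambda>\<omega>. b (tm j) (X (tm j) \<omega>)) \<in> borel_measurable (\<F> (tm i))"
        "(\<lambda>\<omega>. \<sigma> (tm j) (X (tm j) \<omega>)) \<in> borel_measurable (\<F> (tm i))" "dW j \<in> borel_measurable (\<F> (tm i))"
        using measurable_compose[OF Xm[OF j(1) that] bm(1)[OF t]] measurable_compose[OF Xm[OF j(1) that] bm(2)[OF t]]
          dWm[OF j(2) that] by auto
    qed
    have toM: "u \<in> borel_measurable M" if "u \<in> borel_measurable (\<F> (tm i))" "i \<le> n" for u :: "'a \<Rightarrow> real" and i
      using tm[OF that(2)] by (intro measurable_filtration_M[OF that(1)]) auto
    have NF: "N i \<in> sets (\<F> (tm i))" if "i \<le> n" for i
    proof -
      have "{\<omega> \<in> space (\<F> (tm i)). \<bar>Xt i \<omega> - X (tm i) \<omega>\<bar> > v} \<in> sets (\<F> (tm i))"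
        using Xtm[OF that] Xm[OF order_refl that] by measurable
      then show ?thesis by (simp add: N_def)
    qed
    \<comment> \<open>This event is known at time \<open>tm i\<close>, so multiplying the
      coefficients by its indicator stops the difference process once \<open>X\<close> has left the
      ball, without losing adaptedness. The clause \<open>i < n\<close> makes the bounds below hold
      for every index.\<close>
    define GS where "GS i = {\<omega> \<in> space M. i < n \<and> (\<forall>j\<le>i. \<bar>X (tm j) \<omega>\<bar> \<le> R)}" for i
    have GF: "GS i \<in> sets (\<F> (tm i))" if "i < n" for i
    proof -
      have "{\<omega> \<in> space (\<F> (tm i)). \<forall>j\<in>{..i}. \<bar>X (tm j) \<omega>\<bar> \<le> R} \<in> sets (\<F> (tm i))"
      proof (rule sets.sets_Collect_finite_All)
        fix j assume "j \<in> {..i}"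
        then have [measurable]: "X (tm j) \<in> borel_measurable (\<F> (tm i))" using that by (intro Xm) auto
        show "{\<omega> \<in> space (\<F> (tm i)). \<bar>X (tm j) \<omega>\<bar> \<le> R} \<in> sets (\<F> (tm i))" by measurable
      qed simp
      moreover have "GS i = {\<omega> \<in> space (\<F> (tm i)). \<forall>j\<in>{..i}. \<bar>X (tm j) \<omega>\<bar> \<le> R}" using that by (auto simp: GS_def)
      ultimately show ?thesis by simp
    qed
    define a where "a i \<omega> = indicator (GS i) \<omega> * (sR (tm i) (X (tm i) \<omega>) - sL (tm i) (Y i \<omega>))" for i \<omega>
    define \<beta> where "\<beta> i \<omega> = indicator (GS i) \<omega> * (bR (tm i) (X (tm i) \<omega>) - bR (tm i) (Y i \<omega>))" for i \<omega>
    \<comment> \<open>The expansion of \<open>\<phi>\<close> needs the full increment, so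
      \<open>a\<close> multiplies \<open>dW\<close> itself and the truncated part of the noise is
      collected here.\<close>
    define r where "r i \<omega> = indicator (GS i) \<omega> * (sL (tm i) (Y i \<omega>) * (dW i \<omega> - clamp_to c (dW i \<omega>)))" for i \<omega>
    define e where "e i \<omega> = 2 * s + 2 * C * indicator (N i) \<omega>" for i \<omega>
    define g where "g i \<omega> = L * v + 2 * C * indicator (N i) \<omega>" for i \<omega>
    define D where "D i \<omega> = (\<Sum>j<i. h * \<beta> j \<omega> + a j \<omega> * dW j \<omega> + r j \<omega>)" for i \<omega>
    have F: "a j \<in> borel_measurable (\<F> (tm i))" "\<beta> j \<in> borel_measurable (\<F> (tm i))" "e j \<in> borel_measurable (\<F> (tm i))"
        "g j \<in> borel_measurable (\<F> (tm i))" if "j \<le> i" "j < n" "i \<le> n" for i j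
    proof -
      have t: "tm j \<in> {0..T}" using that tm by auto
      have [measurable]: "GS j \<in> sets (\<F> (tm i))" "N j \<in> sets (\<F> (tm i))"
        using GF[of j] NF[of j] that filtration_mono[OF tm_mono[OF that(1)]] by auto
      have [measurable]: "(\<lambda>\<omega>. sR (tm j) (X (tm j) \<omega>)) \<in> borel_measurable (\<F> (tm i))"
        "(\<lambda>\<omega>. bR (tm j) (X (tm j) \<omega>)) \<in> borel_measurable (\<F> (tm i))"
        "(\<lambda>\<omega>. sL (tm j) (Y j \<omega>)) \<in> borel_measurable (\<F> (tm i))"
        "(\<lambda>\<omega>. bR (tm j) (Y j \<omega>)) \<in> borel_measurable (\<F> (tm i))"
        using measurable_compose[OF Xm[OF that(1,3)] bm(4)[OF t]] measurable_compose[OF Xm[OF that(1,3)] bm(3)[OF t]]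
          measurable_compose[OF Ym[OF that(1,3)] bm(5)[OF t]] measurable_compose[OF Ym[OF that(1,3)] bm(3)[OF t]] by auto
      show "a j \<in> borel_measurable (\<F> (tm i))" unfolding a_def by measurable
      show "\<beta> j \<in> borel_measurable (\<F> (tm i))" unfolding \<beta>_def by measurable
      show "e j \<in> borel_measurable (\<F> (tm i))" unfolding e_def by measurable
      show "g j \<in> borel_measurable (\<F> (tm i))" unfolding g_def by measurable
    qed
    have rF: "r j \<in> borel_measurable (\<F> (tm i))" if "j < i" "i \<le> n" for i j
    proof -
      have t: "tm j \<in> {0..T}" and ji: "j \<le> i" "j < n" using that tm by auto
      have [measurable]: "GS j \<in> sets (\<F> (tm i))"
        using GF[of j] ji filtration_mono[OF tm_mono[OF ji(1)]] by auto
      have [measurable]: "(\<lambda>\<omega>. sL (tm j) (Y j \<omega>)) \<in> borel_measurable (\<F> (tm i))"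
        "(\<lambda>\<omega>. clamp_to c (dW j \<omega>)) \<in> borel_measurable (\<F> (tm i))" "dW j \<in> borel_measurable (\<F> (tm i))"
        using measurable_compose[OF Ym[OF ji(1) that(2)] bm(5)[OF t]] measurable_compose[OF dWm[OF that] cm] dWm[OF that] by auto
      show ?thesis unfolding r_def by measurable
    qed
    have DF: "D i \<in> borel_measurable (\<F> (tm i))" if "i \<le> n" for i
      unfolding D_def
    proof (rule borel_measurable_sum)
      fix j assume "j \<in> {..<i}"
      then have j: "j \<le> i" "j < n" "j < i" using that by auto
      note [measurable] = F(1,2)[OF j(1,2) that] rF[OF j(3) that] dWm[OF j(3) that]
      show "(\<lambda>\<omega>. h * \<beta> j \<omega> + a j \<omega> * dW j \<omega> + r j \<omega>) \<in> borel_measurable (\<F> (tm i))" by measurable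
    qed
    \<comment> \<open>Only the indicators before \<open>i\<close> enter \<open>D i\<close>, hence
      the identity reaches the final index \<open>n\<close>, although \<open>GS n\<close> is
      empty.\<close>
    have D_eq: "D i \<omega> = Xt i \<omega> - Y i \<omega>" if "i \<le> n" "\<And>j. j < i \<Longrightarrow> \<omega> \<in> GS j" for i \<omega>
      using that
    proof (induction i)
      case 0
      then show ?case by (simp add: D_def Xt_def Y0)
    next
      case (Suc i)
      have "\<omega> \<in> GS i" using Suc.prems(2) by simp
      then have "clamp_to R (X (tm i) \<omega>) = X (tm i) \<omega>" "\<omega> \<in> GS i" by (auto simp: GS_def intro: clamp_to_eq)
      moreover have "D i \<omega> = Xt i \<omega> - Y i \<omega>" using Suc by simp
      ultimately show ?case
        by (simp add: D_def Xt_def YS f_def \<beta>_def a_def r_def bR_def sR_def algebra_simps)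
    qed
    have near: "\<bar>Xt i \<omega> - X (tm i) \<omega>\<bar> \<le> v \<or> \<omega> \<in> N i" if "\<omega> \<in> space M" for i \<omega>
      using that by (auto simp: N_def)
    have GS_D: "D i \<omega> = Xt i \<omega> - Y i \<omega>" if "\<omega> \<in> GS i" for i \<omega>
      by (rule D_eq) (use that in \<open>auto simp: GS_def\<close>)
    have tG: "tm i \<in> {0..T}" if "\<omega> \<in> GS i" for i \<omega> using that tm[of i] by (auto simp: GS_def)
    \<comment> \<open>Three moves: from \<open>X\<close> to \<open>Xt i\<close> costs
      \<open>s\<close>, or \<open>2 * C\<close> on \<open>N i\<close>; from \<open>Xt i\<close> to
      \<open>Y i\<close> costs \<open>\<rho> \<bar>D i \<omega>\<bar>\<close>; replacing
      \<open>sR\<close> by \<open>sL\<close> costs another \<open>s\<close>.\<close>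
    have a1: "\<bar>a i \<omega>\<bar> \<le> \<rho> \<bar>D i \<omega>\<bar> + e i \<omega>" if w: "\<omega> \<in> space M" for i \<omega>
    proof (cases "\<omega> \<in> GS i")
      case True
      note t = tG[OF True]
      have "\<bar>sR (tm i) (X (tm i) \<omega>) - sR (tm i) (Xt i \<omega>)\<bar> \<le> s + 2 * C * indicator (N i) \<omega>"
      proof (cases "\<omega> \<in> N i")
        case True
        then show ?thesis using sC[OF t, of "X (tm i) \<omega>"] sC[OF t, of "Xt i \<omega>"] s(1) by simp
      next
        case False
        then have "\<rho> \<bar>X (tm i) \<omega> - Xt i \<omega>\<bar> \<le> \<rho> v" using near[OF w, of i] by (intro \<rho>_mono) (auto simp: abs_minus_commute)
        then show ?thesis using sR_mod[OF t, of "X (tm i) \<omega>" "Xt i \<omega>"] v(3) False by simp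
      qed
      moreover have "\<bar>sR (tm i) (Xt i \<omega>) - sR (tm i) (Y i \<omega>)\<bar> \<le> \<rho> \<bar>D i \<omega>\<bar>"
        using sR_mod[OF t, of "Xt i \<omega>" "Y i \<omega>"] by (simp add: GS_D[OF True])
      moreover have "\<bar>sR (tm i) (Y i \<omega>) - sL (tm i) (Y i \<omega>)\<bar> \<le> s" by (rule sL(3)[OF t])
      moreover have "a i \<omega> = sR (tm i) (X (tm i) \<omega>) - sL (tm i) (Y i \<omega>)" using True by (simp add: a_def)
      ultimately show ?thesis unfolding e_def by linarith
    next
      case False
      then show ?thesis using \<rho>_nonneg[of "\<bar>D i \<omega>\<bar>"] s C by (simp add: a_def e_def)
    qed
    have b1: "\<bar>\<beta> i \<omega>\<bar> \<le> L * \<bar>D i \<omega>\<bar> + g i \<omega>" if w: "\<omega> \<in> space M" for i \<omega>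
    proof (cases "\<omega> \<in> GS i")
      case True
      note t = tG[OF True]
      have "\<bar>bR (tm i) (X (tm i) \<omega>) - bR (tm i) (Xt i \<omega>)\<bar> \<le> L * v + 2 * C * indicator (N i) \<omega>"
      proof (cases "\<omega> \<in> N i")
        case True
        have "0 \<le> L * v" using L v by simp
        then show ?thesis using bC[OF t, of "X (tm i) \<omega>"] bC[OF t, of "Xt i \<omega>"] True by simp
      next
        case False
        then have "L * \<bar>X (tm i) \<omega> - Xt i \<omega>\<bar> \<le> L * v" using near[OF w, of i] L by (intro mult_left_mono) (auto simp: abs_minus_commute)
        then show ?thesis using bR_lip[OF t, of "X (tm i) \<omega>" "Xt i \<omega>"] False by simp
      qed
      moreover have "\<bar>bR (tm i) (Xt i \<omega>) - bR (tm i) (Y i \<omega>)\<bar> \<le> L * \<bar>D i \<omega>\<bar>"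
        using bR_lip[OF t, of "Xt i \<omega>" "Y i \<omega>"] by (simp add: GS_D[OF True])
      moreover have "\<beta> i \<omega> = bR (tm i) (X (tm i) \<omega>) - bR (tm i) (Y i \<omega>)" using True by (simp add: \<beta>_def)
      ultimately show ?thesis unfolding g_def by linarith
    next
      case False
      then show ?thesis using L C v by (simp add: \<beta>_def g_def)
    qed
    have r1: "\<bar>r i \<omega>\<bar> \<le> G * (dW i \<omega>) ^ 4" for i \<omega>
    proof (cases "\<omega> \<in> GS i")
      case True
      have "\<bar>r i \<omega>\<bar> = \<bar>sL (tm i) (Y i \<omega>)\<bar> * \<bar>dW i \<omega> - clamp_to c (dW i \<omega>)\<bar>" using True by (simp add: r_def abs_mult)
      also have "\<dots> \<le> C * ((dW i \<omega>) ^ 4 / c ^ 3)"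
        using C by (intro mult_mono sL(1) tG[OF True] clamp_to_error c) auto
      finally show ?thesis by (simp add: G_def)
    qed (use G in \<open>simp add: r_def\<close>)
    have bounds: "\<bar>a i \<omega>\<bar> \<le> A" "\<bar>\<beta> i \<omega>\<bar> \<le> A" "0 \<le> e i \<omega>" "e i \<omega> \<le> A" "\<bar>g i \<omega>\<bar> \<le> A" for i \<omega>
    proof -
      have Lv: "0 \<le> L * v" using L v by simp
      have "\<bar>a i \<omega>\<bar> \<le> 2 * C"
        using sC[OF tG, of \<omega> i "X (tm i) \<omega>"] sL(1)[OF tG, of \<omega> i "Y i \<omega>"] C by (cases "\<omega> \<in> GS i") (auto simp: a_def)
      then show "\<bar>a i \<omega>\<bar> \<le> A" using s Lv by (simp add: A_def)
      have "\<bar>\<beta> i \<omega>\<bar> \<le> 2 * C"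
        using bC[OF tG, of \<omega> i "X (tm i) \<omega>"] bC[OF tG, of \<omega> i "Y i \<omega>"] C by (cases "\<omega> \<in> GS i") (auto simp: \<beta>_def)
      then show "\<bar>\<beta> i \<omega>\<bar> \<le> A" using s Lv by (simp add: A_def)
      show "0 \<le> e i \<omega>" "e i \<omega> \<le> A" "\<bar>g i \<omega>\<bar> \<le> A"
        using s Lv C by (auto simp: e_def g_def A_def indicator_def)
    qed
    have iN: "integrable M (indicat_real (N i))" "expectation (indicat_real (N i)) = prob (N i)" if "i < n" for i
      using filtration_subset[of "tm i"] tm[of i] NF[of i] that by (auto simp: less_top[symmetric])
    have Ee: "expectation (\<lambda>\<omega>. (e i \<omega>)\<^sup>2) \<le> e2" if "i < n" for i
    proof -
      have ptw: "(e i \<omega>)\<^sup>2 \<le> 8 * s\<^sup>2 + 8 * C\<^sup>2 * indicator (N i) \<omega>" for \<omega>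
        using quadratic_sum_le[of "2 * s" "2 * C"]
        by (cases "\<omega> \<in> N i") (simp_all add: e_def power_mult_distrib)
      have em: "e i \<in> borel_measurable M" using F(3)[of i i] that by (intro toM[of _ i]) auto
      have "expectation (\<lambda>\<omega>. (e i \<omega>)\<^sup>2) \<le> expectation (\<lambda>\<omega>. 8 * s\<^sup>2 + 8 * C\<^sup>2 * indicator (N i) \<omega>)"
      proof (rule integral_mono)
        show "integrable M (\<lambda>\<omega>. (e i \<omega>)\<^sup>2)"
          using em bounds(3,4) by (intro integrable_const_bound[of _ "A\<^sup>2"]) (auto intro!: power_mono)
      qed (use iN[OF that] ptw in auto)
      also have "\<dots> = 8 * s\<^sup>2 + 8 * C\<^sup>2 * prob (N i)" using iN[OF that] by (simp add: prob_space)
      also have "8 * C\<^sup>2 * prob (N i) \<le> 8 * C\<^sup>2 * \<omega>0" using PN[of i] that by (intro mult_left_mono) auto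
      finally show ?thesis using s(2) \<omega>0(3) by linarith
    qed
    define g1 where "g1 = q / (5 * T)"
    have Eg: "expectation (g i) \<le> g1" if "i < n" for i
    proof -
      have "expectation (g i) = L * v + 2 * C * prob (N i)" unfolding g_def using iN[OF that] by (simp add: prob_space)
      also have "2 * C * prob (N i) \<le> 2 * C * \<omega>0" using PN[of i] that C by (intro mult_left_mono) auto
      finally have "T * expectation (g i) \<le> T * (L * v + 2 * C * \<omega>0)" using T_pos by simp
      also have "\<dots> \<le> q / 5" using v(4) \<omega>0(4) by (simp add: algebra_simps)
      finally show ?thesis using T_pos by (simp add: g1_def field_simps)
    qed
    have ED: "integrable M (D i)" "expectation (\<lambda>\<omega>. \<bar>D i \<omega>\<bar>) \<le> \<epsilon> * \<theta> / 8" if i: "i \<le> n" for i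
    proof -
      have D0: "D 0 \<omega> = 0" for \<omega> by (simp add: D_def)
      have DS: "D (Suc j) \<omega> = D j \<omega> + T / n * \<beta> j \<omega> +
          a j \<omega> * (W (real (Suc j) * T / n) \<omega> - W (real j * T / n) \<omega>) + r j \<omega>" if "j < n" for j \<omega>
        by (simp add: D_def h_def dW_def)
      have adp: "D j \<in> borel_measurable (\<F> (real j * T / n))" "a j \<in> borel_measurable (\<F> (real j * T / n))"
          "e j \<in> borel_measurable (\<F> (real j * T / n))" if "j < n" for j
        using DF[of j] F(1)[of j j] F(3)[of j j] that unfolding tm_def by auto
      have meas: "\<beta> j \<in> borel_measurable M" "r j \<in> borel_measurable M" "g j \<in> borel_measurable M" if "j < n" for j
        using toM[OF F(2)[of j j]] toM[OF rF[of j "Suc j"]] toM[OF F(4)[of j j]] that by auto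
      have a1': "\<bar>a j \<omega>\<bar> \<le> \<rho> \<bar>D j \<omega>\<bar> + e j \<omega>" if "j < n" "\<omega> \<in> space M" for j \<omega> by (rule a1[OF that(2)])
      have b1': "\<bar>\<beta> j \<omega>\<bar> \<le> L * \<bar>D j \<omega>\<bar> + g j \<omega>" if "j < n" "\<omega> \<in> space M" for j \<omega> by (rule b1[OF that(2)])
      have r1': "\<bar>r j \<omega>\<bar> \<le> G * (W (real (Suc j) * T / n) \<omega> - W (real j * T / n) \<omega>) ^ 4" if "j < n" for j \<omega>
        using r1[of j \<omega>] by (simp add: dW_def)
      have g1_nonneg: "g1 \<ge> 0" "e2 \<ge> 0" using q T_pos e2 by (auto simp: g1_def)
      note est = euler_difference[where n=n and K=K and \<kappa>=\<kappa> and \<phi>=\<phi> and p=p and \<eta>="q / 5" and \<rho>=\<rho>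
          and \<delta>=\<delta> and D=D and \<beta>=\<beta> and a=a and r=r and e=e and g=g and A=A and ?e2.0=e2 and L=L and ?g1.0=g1
          and G=G and m=i, OF n K(1) less_imp_le[OF \<kappa>] K(3,4,5,6,7,8) D0 DS adp(1) adp(2) adp(3)
          meas(1) meas(2) meas(3) a1' bounds(1) bounds(3) bounds(4) Ee b1' bounds(2) bounds(5) Eg L g1_nonneg r1' G i]
      show "integrable M (D i)" by (rule est(1))
      have "T * g1 = q / 5" "T * (2 * \<kappa>) = q / 5" using T_pos by (auto simp: g1_def \<kappa>_def)
      moreover have "T * (2 * K * e2) \<le> q / 5"
      proof -
        have "T * (2 * K * e2) = q / 5 * (K / (K + 1))" using T_pos by (simp add: e2_def)
        also have "\<dots> \<le> q / 5 * 1" using K(1) q by (intro mult_left_mono) auto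
        finally show ?thesis by simp
      qed
      moreover have "3 * T * (T / n) * (K / \<delta>\<^sup>2 * A ^ 4 + G) \<le> q / 5" using h(2) by (simp add: Zc_def h_def mult_ac)
      ultimately have "q / 5 + T * (g1 + 2 * \<kappa> + 2 * K * e2) + 3 * T * (T / n) * (K / \<delta>\<^sup>2 * A ^ 4 + G) \<le> q"
        unfolding distrib_left by linarith
      then have "expectation (\<lambda>\<omega>. \<bar>D i \<omega>\<bar>) \<le> q * exp (L * T)"
        by (intro order_trans[OF est(2)] mult_right_mono) auto
      also have "\<dots> = \<epsilon> * \<theta> / 8" by (simp add: q_def exp_minus)
      finally show "expectation (\<lambda>\<omega>. \<bar>D i \<omega>\<bar>) \<le> \<epsilon> * \<theta> / 8" .
    qed
    have PY: "prob {\<omega> \<in> space M. \<bar>Y i \<omega> - X (tm i) \<omega>\<bar> > \<epsilon>} \<le> \<theta>" if i: "i \<le> n" for i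
    proof -
      let ?S = "{\<omega> \<in> space M. \<bar>D i \<omega>\<bar> \<ge> \<epsilon> / 2}"
      have ev: "?S \<in> events" "N i \<in> events" "space M - E \<in> events"
        using borel_measurable_integrable[OF ED(1)[OF i]] E(1) NF[OF i] filtration_subset[of "tm i"] tm[OF i] by auto
      have "prob ?S \<le> expectation (\<lambda>\<omega>. \<bar>D i \<omega>\<bar>) / (\<epsilon> / 2)"
        using ED(1)[OF i] \<open>\<epsilon> > 0\<close> by (intro integral_Markov_inequality_measure[where A="{}"]) auto
      also have "\<dots> \<le> (\<epsilon> * \<theta> / 8) / (\<epsilon> / 2)" using ED(2)[OF i] \<open>\<epsilon> > 0\<close> by (intro divide_right_mono) auto
      finally have S: "prob ?S \<le> \<theta> / 4" using \<open>\<epsilon> > 0\<close> by simp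
      \<comment> \<open>Three exceptional events of probability at most \<open>\<theta> / 4\<close>
        each: \<open>X\<close> leaves the ball, the stopped difference is large, or the Euler sum is
        far from \<open>X\<close>.\<close>
      have "prob {\<omega> \<in> space M. \<bar>Y i \<omega> - X (tm i) \<omega>\<bar> > \<epsilon>} \<le> prob ((space M - E) \<union> (?S \<union> N i))"
      proof (rule finite_measure_mono)
        show "{\<omega> \<in> space M. \<bar>Y i \<omega> - X (tm i) \<omega>\<bar> > \<epsilon>} \<subseteq> (space M - E) \<union> (?S \<union> N i)"
        proof (rule subsetI, rule ccontr)
          fix \<omega> assume w: "\<omega> \<in> {\<omega> \<in> space M. \<bar>Y i \<omega> - X (tm i) \<omega>\<bar> > \<epsilon>}" and neg: "\<omega> \<notin> (space M - E) \<union> (?S \<union> N i)"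
          have wE: "\<omega> \<in> E" "\<omega> \<in> space M" using w neg by auto
          have "\<omega> \<in> GS j" if "j < i" for j
            using wE XR[OF wE(1) _ n] that i by (auto simp: GS_def tm_def)
          then have "D i \<omega> = Xt i \<omega> - Y i \<omega>" by (rule D_eq[OF i])
          moreover have "\<bar>D i \<omega>\<bar> < \<epsilon> / 2" "\<bar>Xt i \<omega> - X (tm i) \<omega>\<bar> \<le> v" using neg wE near[OF wE(2), of i] by auto
          ultimately show False using w v(2) unfolding mem_Collect_eq by linarith
        qed
      qed (use ev in auto)
      also have "\<dots> \<le> prob (space M - E) + prob (?S \<union> N i)" using ev by (intro measure_Un_le) auto
      also have "prob (?S \<union> N i) \<le> prob ?S + prob (N i)" using ev by (intro measure_Un_le) auto
      finally show ?thesis using E(2) S PN[OF i] \<omega>0(2) \<open>\<theta> > 0\<close> by linarith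
    qed
    have fm: "(\<lambda>(y, w). f i y w) \<in> borel_measurable (borel \<Otimes>\<^sub>M borel)" if "i < n" for i
    proof -
      have [measurable]: "bR (tm i) \<in> borel_measurable borel" "sL (tm i) \<in> borel_measurable borel" "clamp_to c \<in> borel_measurable borel"
        using bm(3,5)[OF tm[of i]] cm that by auto
      show ?thesis unfolding f_def by measurable
    qed
    have f_mono: "mono (\<lambda>y. f i y w)" if "i < n" for i w
      unfolding f_def using bR_lip[OF tm] sL(2)[OF tm] that h c by (intro euler_map_mono[where L=L and \<Lambda>=\<Lambda>]) auto
    have YF: "(\<lambda>\<omega> j. Y (min j i) \<omega>) \<in> measurable (\<F> (tm i)) (PiM UNIV (\<lambda>_. borel))" if "i \<le> n" for i
      by (rule measurable_PiM_single') (use that Ym[of "min j i" i for j] in auto)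
    have Y_meas: "(\<lambda>\<omega> j. Y (min j i) \<omega>) \<in> measurable M (PiM UNIV (\<lambda>_. borel))" if "i < n" for i
      using that tm[of i] by (intro measurable_filtration_M[OF YF]) auto
    have Z_meas: "dW i \<in> borel_measurable M" if "i < n" for i
      by (rule toM[OF dWm[of i "Suc i"], of]) (use that in auto)
    have ind: "distr M (PiM UNIV (\<lambda>_. borel) \<Otimes>\<^sub>M borel) (\<lambda>\<omega>. (\<lambda>j. Y (min j i) \<omega>, dW i \<omega>)) =
        distr M (PiM UNIV (\<lambda>_. borel)) (\<lambda>\<omega> j. Y (min j i) \<omega>) \<Otimes>\<^sub>M distr M borel (dW i)" if "i < n" for i
    proof -
      have "0 \<le> tm i" "tm i < tm (Suc i)" "tm (Suc i) \<le> T"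
        using tm[of i] tm[of "Suc i"] that T_pos n by (auto simp: tm_def field_simps)
      from indep_increment[OF this YF] that show ?thesis by (simp add: dW_def[abs_def] tm_def)
    qed
    have YS': "Y (Suc i) \<omega> = f i (Y i \<omega>) (dW i \<omega>)" if "i < n" for i \<omega> by (rule YS)
    note assoc = monotone_chain_association[where Y=Y and x=x and N=n and f=f and Z=dW and n=n, OF Y0 YS' f_mono fm
        Y_meas Z_meas ind order_refl]
    show "\<exists>Y :: nat \<Rightarrow> 'a \<Rightarrow> real.
      (\<forall>i\<le>n. Y i \<in> borel_measurable M) \<and>
      (\<forall>i\<le>n. prob {\<omega> \<in> space M. \<bar>Y i \<omega> - X (real i * T / n) \<omega>\<bar> > \<epsilon>} \<le> \<theta>) \<and>
      (\<forall>F G A B. F \<in> borel_measurable (PiM UNIV (\<lambda>_. borel)) \<and> mono F \<and> (\<forall>s. \<bar>F s\<bar> \<le> A) \<and>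
       G \<in> borel_measurable (PiM UNIV (\<lambda>_. borel)) \<and> mono G \<and> (\<forall>s. \<bar>G s\<bar> \<le> B) \<longrightarrow>
       positively_correlated (\<lambda>\<omega> j. Y (min j n) \<omega>) F G)"
    proof (intro exI[of _ Y] conjI allI impI)
      show "Y i \<in> borel_measurable M" if "i \<le> n" for i by (rule toM[OF Ym[OF order_refl that] that])
      show "prob {\<omega> \<in> space M. \<bar>Y i \<omega> - X (real i * T / n) \<omega>\<bar> > \<epsilon>} \<le> \<theta>" if "i \<le> n" for i
        using PY[OF that] by (simp add: tm_def)
      fix F G :: "(nat \<Rightarrow> real) \<Rightarrow> real" and A' B' :: real
      assume H: "F \<in> borel_measurable (PiM UNIV (\<lambda>_. borel)) \<and> mono F \<and> (\<forall>s. \<bar>F s\<bar> \<le> A') \<and>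
        G \<in> borel_measurable (PiM UNIV (\<lambda>_. borel)) \<and> mono G \<and> (\<forall>s. \<bar>G s\<bar> \<le> B')"
      show "positively_correlated (\<lambda>\<omega> j. Y (min j n) \<omega>) F G"
        by (rule assoc[of F A' G B']) (use H in blast)+
    qed
  qed
qed

end

section \<open>Path space and interpolation\<close>

lemma mdist_path_metric_le:
  assumes "T \<ge> 0" "\<alpha> \<in> mspace (path_metric T)" "\<beta> \<in> mspace (path_metric T)"
  shows "mdist (path_metric T) \<alpha> \<beta> \<le> r \<longleftrightarrow> (\<forall>t\<in>{0..T}. \<bar>\<alpha> t - \<beta> t\<bar> \<le> r)"
  using assms cfunspace_mdist_le[of \<alpha> "top_of_set {0..T}" euclidean_metric \<beta> r]
  unfolding path_metric_def by (simp add: dist_real_def)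

text \<open>Closed balls are used because a weak bound on the supremum distance is the same as a
  pointwise bound.\<close>

lemma openin_path_topology:
  assumes T: "T \<ge> 0"
  shows "openin (mtopology_of (path_metric T)) U \<longleftrightarrow> U \<subseteq> mspace (path_metric T) \<and>
    (\<forall>\<alpha>\<in>U. \<exists>r>0. \<forall>\<beta>\<in>mspace (path_metric T). (\<forall>t\<in>{0..T}. \<bar>\<alpha> t - \<beta> t\<bar> \<le> r) \<longrightarrow> \<beta> \<in> U)"
    (is "?L \<longleftrightarrow> ?R")
proof -
  interpret P: Metric_space "mspace (path_metric T)" "mdist (path_metric T)" by simp
  have eq: "?L \<longleftrightarrow> U \<subseteq> mspace (path_metric T) \<and> (\<forall>\<alpha>. \<alpha> \<in> U \<longrightarrow> (\<exists>r>0. P.mcball \<alpha> r \<subseteq> U))"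
    unfolding mtopology_of_def by (rule P.openin_mtopology_mcball)
  have "P.mcball \<alpha> r \<subseteq> U \<longleftrightarrow> (\<forall>\<beta>\<in>mspace (path_metric T). (\<forall>t\<in>{0..T}. \<bar>\<alpha> t - \<beta> t\<bar> \<le> r) \<longrightarrow> \<beta> \<in> U)"
    if "\<alpha> \<in> mspace (path_metric T)" for \<alpha> r
    using that mdist_path_metric_le[OF T that] by auto
  then show ?thesis unfolding eq by (auto simp: subset_iff)
qed

lemma topcontinuous_at_pathD:
  assumes "T \<ge> 0" "topcontinuous_at (mtopology_of (path_metric T)) euclideanreal F \<alpha>" "e > 0"
  shows "\<exists>r>0. \<forall>\<beta>\<in>mspace (path_metric T). (\<forall>t\<in>{0..T}. \<bar>\<alpha> t - \<beta> t\<bar> \<le> r) \<longrightarrow> \<bar>F \<beta> - F \<alpha>\<bar> < e"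
proof -
  have "openin euclideanreal (ball (F \<alpha>) e)" "F \<alpha> \<in> ball (F \<alpha>) e" using assms by auto
  then obtain U where U: "openin (mtopology_of (path_metric T)) U" "\<alpha> \<in> U" "\<forall>\<beta>\<in>U. F \<beta> \<in> ball (F \<alpha>) e"
    using assms(2) unfolding topcontinuous_at_def by blast
  then obtain r where "r > 0" "\<forall>\<beta>\<in>mspace (path_metric T). (\<forall>t\<in>{0..T}. \<bar>\<alpha> t - \<beta> t\<bar> \<le> r) \<longrightarrow> \<beta> \<in> U"
    unfolding openin_path_topology[OF assms(1)] by blast
  then show ?thesis using U(3)
    by (intro exI[of _ r]) (auto simp: dist_real_def abs_minus_commute)
qed

lemma sets_path_borel_openin: "openin (mtopology_of (path_metric T)) U \<Longrightarrow> U \<in> sets (path_borel T)"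
  unfolding path_borel_def by (subst sets_measure_of) (use openin_subset in force)+

lemma measurable_path_borelI:
  assumes "\<And>\<omega>. \<omega> \<in> space N \<Longrightarrow> f \<omega> \<in> mspace (path_metric T)"
    and "\<And>U. openin (mtopology_of (path_metric T)) U \<Longrightarrow> f -` U \<inter> space N \<in> sets N"
  shows "f \<in> measurable N (path_borel T)"
  unfolding path_borel_def
  by (rule measurable_measure_of) (use assms openin_subset in force)+

text \<open>An open set is the union over \<open>k\<close> of the closed sets of paths whose \<open>1/k\<close>-ball it contains, and
  membership in these passes to and from uniform limits up to a change of \<open>k\<close>.\<close>

lemma measurable_path_borel_limit:
  assumes T: "T \<ge> 0" and g: "\<And>n::nat. g n \<in> measurable N (path_borel T)"
    and f: "\<And>\<omega>. \<omega> \<in> space N \<Longrightarrow> f \<omega> \<in> mspace (path_metric T)"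
    and lim: "\<And>\<omega> e. \<omega> \<in> space N \<Longrightarrow> e > 0 \<Longrightarrow> \<exists>n0. \<forall>n\<ge>n0. \<forall>t\<in>{0..T}. \<bar>g n \<omega> t - f \<omega> t\<bar> \<le> e"
  shows "f \<in> measurable N (path_borel T)"
proof (rule measurable_path_borelI[OF f])
  fix U assume U: "openin (mtopology_of (path_metric T)) U"
  let ?near = "\<lambda>\<alpha> \<beta> r. \<forall>t\<in>{0..T}. \<bar>\<alpha> t - \<beta> t\<bar> \<le> r"
  \<comment> \<open>The open complements of these closed sets: paths closer than
    \<open>1 / Suc k\<close> to some path outside \<open>U\<close>.\<close>
  define C where "C k = {\<alpha> \<in> mspace (path_metric T). \<exists>\<beta>\<in>mspace (path_metric T). \<beta> \<notin> U \<and>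
      (\<exists>r < 1 / real (Suc k). ?near \<alpha> \<beta> r)}" for k
  have gm: "g n \<omega> \<in> mspace (path_metric T)" if "\<omega> \<in> space N" for n \<omega>
    using measurable_space[OF g that] by (simp add: space_path_borel)
  have "openin (mtopology_of (path_metric T)) (C k)" for k
    unfolding openin_path_topology[OF T]
  proof (intro conjI ballI)
    fix \<alpha> assume "\<alpha> \<in> C k"
    then obtain \<beta> r where b: "\<beta> \<in> mspace (path_metric T)" "\<beta> \<notin> U" "r < 1 / real (Suc k)" "?near \<alpha> \<beta> r"
      unfolding C_def by blast
    define s where "s = (1 / real (Suc k) - r) / 2"
    have "(q - r) / 2 > 0 \<and> r + (q - r) / 2 < q" if "r < q" for q
      using that by (simp add: field_simps)
    from this[OF b(3)] have s: "s > 0" "r + s < 1 / real (Suc k)" by (simp_all only: s_def)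
    have "\<gamma> \<in> C k" if g: "\<gamma> \<in> mspace (path_metric T)" "?near \<alpha> \<gamma> s" for \<gamma>
    proof -
      have "\<bar>\<gamma> t - \<beta> t\<bar> \<le> r + s" if "t \<in> {0..T}" for t
        using b(4) g(2) that by (smt (verit, best))
      then have "?near \<gamma> \<beta> (r + s)" by blast
      then show ?thesis unfolding C_def using g b(1,2) s(2) by blast
    qed
    then show "\<exists>r>0. \<forall>\<beta>\<in>mspace (path_metric T). ?near \<alpha> \<beta> r \<longrightarrow> \<beta> \<in> C k" using s(1) by blast
  qed (auto simp: C_def)
  then have "C k \<in> sets (path_borel T)" for k by (rule sets_path_borel_openin)
  then have meas: "g n -` C k \<inter> space N \<in> sets N" for n k by (rule measurable_sets[OF g])
  have "f -` U \<inter> space N = (\<Union>k. \<Union>n0. \<Inter>n\<in>{n0..}. space N - (g n -` C k \<inter> space N))" (is "_ = ?R")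
  proof (intro equalityI subsetI)
    fix \<omega> assume "\<omega> \<in> f -` U \<inter> space N"
    then have w: "\<omega> \<in> space N" "f \<omega> \<in> U" by auto
    obtain r where r: "r > 0" "\<And>\<beta>. \<beta> \<in> mspace (path_metric T) \<Longrightarrow> ?near (f \<omega>) \<beta> r \<Longrightarrow> \<beta> \<in> U"
      using U w(2) unfolding openin_path_topology[OF T] by meson
    obtain k where k: "inverse (real (Suc k)) < r / 2" using reals_Archimedean[of "r / 2"] r(1) by auto
    obtain n0 where n0: "\<And>n. n \<ge> n0 \<Longrightarrow> ?near (g n \<omega>) (f \<omega>) (r / 2)"
      using lim[OF w(1), of "r / 2"] r(1) by auto
    have "g n \<omega> \<notin> C k" if n: "n \<ge> n0" for n
    proof
      assume "g n \<omega> \<in> C k"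
      then obtain \<beta> s where b: "\<beta> \<in> mspace (path_metric T)" "\<beta> \<notin> U" "s < 1 / real (Suc k)" "?near (g n \<omega>) \<beta> s"
        unfolding C_def by blast
      have "\<bar>f \<omega> t - \<beta> t\<bar> \<le> r" if "t \<in> {0..T}" for t
      proof -
        have "\<bar>g n \<omega> t - f \<omega> t\<bar> \<le> r / 2" "\<bar>g n \<omega> t - \<beta> t\<bar> \<le> s" using n0[OF n] b(4) that by auto
        moreover have "s < r / 2" using b(3) k by (simp add: inverse_eq_divide)
        ultimately show ?thesis by linarith
      qed
      then show False using r(2)[OF b(1)] b(2) by blast
    qed
    then show "\<omega> \<in> ?R" using w(1) by blast
  next
    fix \<omega> assume "\<omega> \<in> ?R"
    then obtain k n0 where kn: "\<And>n. n \<ge> n0 \<Longrightarrow> \<omega> \<in> space N \<and> g n \<omega> \<notin> C k" by auto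
    then have w: "\<omega> \<in> space N" by blast
    \<comment> \<open>If \<open>f \<omega>\<close> were outside \<open>U\<close>, it would itself
      witness \<open>g n \<omega> \<in> C k\<close>. The radius with \<open>Suc (Suc k)\<close>
      provides the strict inequality that \<open>C k\<close> asks for.\<close>
    obtain n1 where n1: "\<And>n. n \<ge> n1 \<Longrightarrow> ?near (g n \<omega>) (f \<omega>) (1 / real (Suc (Suc k)))"
      using lim[OF w, of "1 / real (Suc (Suc k))"] by auto
    define n where "n = max n0 n1"
    have near: "?near (g n \<omega>) (f \<omega>) (1 / real (Suc (Suc k)))" by (rule n1) (simp add: n_def)
    have "g n \<omega> \<notin> C k" using kn[of n] by (simp add: n_def)
    moreover have "1 / real (Suc (Suc k)) < 1 / real (Suc k)" by (simp add: field_simps)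
    ultimately have "f \<omega> \<in> U"
      using near f[OF w] gm[OF w, of n] unfolding C_def by blast
    then show "\<omega> \<in> f -` U \<inter> space N" using w by simp
  qed
  also have "\<dots> \<in> sets N"
  proof (intro sets.countable_UN image_subsetI)
    fix k n0
    show "(\<Inter>n\<in>{n0..}. space N - (g n -` C k \<inter> space N)) \<in> sets N"
      by (rule sets.countable_INT') (use meas in auto)
  qed
  finally show "f -` U \<inter> space N \<in> sets N" .
qed

section \<open>Piecewise linear interpolation of grid values\<close>

definition hat :: "real \<Rightarrow> real" where "hat y = max 0 (1 - \<bar>y\<bar>)"

text \<open>Linear interpolation at the nodes \<open>j * T / m\<close>, written with nonnegative
  weights that sum to one, so that order and uniform bounds pass from \<open>v\<close> to the
  path.\<close>

definition path_interpolation :: "real \<Rightarrow> nat \<Rightarrow> (nat \<Rightarrow> real) \<Rightarrow> real \<Rightarrow> real" where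
  "path_interpolation T m v = restrict (\<lambda>t. \<Sum>j\<le>m. v j * hat (t * m / T - j)) {0..T}"

lemma sum_hat: "0 \<le> y \<Longrightarrow> y \<le> real m \<Longrightarrow> (\<Sum>j\<le>m. hat (y - real j)) = 1"
proof (induction m)
  case (Suc m)
  show ?case
  proof (cases "y \<le> real m")
    case True
    then show ?thesis using Suc by (simp add: hat_def)
  next
    case False
    have "(\<Sum>j\<le>m. hat (y - real j)) = (\<Sum>j\<in>{m}. hat (y - real j))"
      using False by (intro sum.mono_neutral_right) (auto simp: hat_def)
    then show ?thesis using False Suc.prems by (simp add: hat_def)
  qed
qed (simp add: hat_def)

lemma hat_nonneg: "hat y \<ge> 0" by (simp add: hat_def)

lemma path_interpolation_mspace: "path_interpolation T m v \<in> mspace (path_metric T)"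
proof -
  have "continuous_on {0..T} (\<lambda>t. \<Sum>j\<le>m. v j * hat (t * m / T - j))"
    unfolding hat_def divide_inverse by (intro continuous_intros)
  then show ?thesis
    unfolding mspace_path_metric path_interpolation_def by (auto cong: continuous_on_cong_simp)
qed

lemma path_interpolation_mono:
  assumes "v \<le> w" shows "path_le T (path_interpolation T m v) (path_interpolation T m w)"
  using assms unfolding path_le_def path_interpolation_def
  by (auto intro!: sum_mono mult_right_mono hat_nonneg simp: le_fun_def)

text \<open>The value at \<open>t\<close> is a weighted average over nodes within one cell of
  \<open>t\<close>.\<close>

lemma path_interpolation_error:
  assumes T: "T > 0" "m > 0" and t: "t \<in> {0..T}"
    and e: "\<And>j. j \<le> m \<Longrightarrow> \<bar>j * T / m - t\<bar> \<le> T / m \<Longrightarrow> \<bar>v j - a\<bar> \<le> e"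
  shows "\<bar>path_interpolation T m v t - a\<bar> \<le> e"
proof -
  have "0 \<le> t * real m / T" "t * real m / T \<le> real m" using T t by (auto simp: field_simps)
  then have s: "(\<Sum>j\<le>m. hat (t * m / T - real j)) = 1" by (rule sum_hat)
  have "path_interpolation T m v t - a = (\<Sum>j\<le>m. v j * hat (t * m / T - j)) - a * (\<Sum>j\<le>m. hat (t * m / T - real j))"
    using t by (simp add: path_interpolation_def s)
  also have "\<dots> = (\<Sum>j\<le>m. (v j - a) * hat (t * m / T - j))"
    by (simp add: sum_distrib_left sum_subtractf left_diff_distrib)
  finally have "\<bar>path_interpolation T m v t - a\<bar> \<le> (\<Sum>j\<le>m. \<bar>(v j - a) * hat (t * m / T - j)\<bar>)" by simp
  also have "\<dots> \<le> (\<Sum>j\<le>m. e * hat (t * m / T - j))"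
  proof (rule sum_mono)
    fix j assume j: "j \<in> {..m}"
    show "\<bar>(v j - a) * hat (t * m / T - j)\<bar> \<le> e * hat (t * m / T - j)"
    proof (cases "\<bar>t * m / T - j\<bar> \<le> 1")
      case True
      have "j * T / m - t = (j - t * m / T) * (T / m)" using T by (simp add: field_simps)
      then have "\<bar>j * T / m - t\<bar> = \<bar>t * m / T - j\<bar> * (T / m)"
        using T by (simp add: abs_mult abs_minus_commute)
      also have "\<dots> \<le> 1 * (T / m)" using T True by (intro mult_right_mono) auto
      finally show ?thesis
        using e[of j] j hat_nonneg[of "t * m / T - j"] by (auto simp: abs_mult intro!: mult_right_mono)
    qed (simp add: hat_def)
  qed
  also have "\<dots> = e" using s by (simp flip: sum_distrib_left)
  finally show ?thesis .
qed

lemma path_interpolation_dist: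
  assumes T: "T > 0" "m > 0" and t: "t \<in> {0..T}" and e: "\<And>j. j \<le> m \<Longrightarrow> \<bar>v j - w j\<bar> \<le> e"
  shows "\<bar>path_interpolation T m v t - path_interpolation T m w t\<bar> \<le> e"
proof -
  have "path_interpolation T m v t - path_interpolation T m w t = path_interpolation T m (\<lambda>j. v j - w j) t - 0"
    using t by (simp add: path_interpolation_def sum_subtractf left_diff_distrib)
  also have "\<bar>\<dots>\<bar> \<le> e" by (rule path_interpolation_error[OF T t]) (use e in simp)
  finally show ?thesis .
qed

text \<open>The map depends on finitely many coordinates and does not increase distances, hence is
  continuous for the product topology. Over a countable index set the product sigma-field is the
  Borel one.\<close>

lemma measurable_path_interpolation:
  assumes T: "T > 0" "m > 0"
  shows "path_interpolation T m \<in> measurable (PiM UNIV (\<lambda>_. borel)) (path_borel T)"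
proof (rule measurable_path_borelI[OF path_interpolation_mspace])
  fix U assume "openin (mtopology_of (path_metric T)) U"
  then have U: "\<exists>r>0. \<forall>\<beta>\<in>mspace (path_metric T). (\<forall>t\<in>{0..T}. \<bar>\<alpha> t - \<beta> t\<bar> \<le> r) \<longrightarrow> \<beta> \<in> U" if "\<alpha> \<in> U" for \<alpha>
    using T that by (subst (asm) openin_path_topology) auto
  have "open (path_interpolation T m -` U)"
  proof (subst open_subopen, intro ballI)
    fix v assume "v \<in> path_interpolation T m -` U"
    then obtain r where r: "r > 0" "\<And>\<beta>. \<beta> \<in> mspace (path_metric T) \<Longrightarrow>
        (\<forall>t\<in>{0..T}. \<bar>path_interpolation T m v t - \<beta> t\<bar> \<le> r) \<Longrightarrow> \<beta> \<in> U"
      using U[of "path_interpolation T m v"] by auto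
    let ?B = "PiE UNIV (\<lambda>j. if j \<le> m then ball (v j) r else UNIV)"
    have "open ?B" by (rule open_PiE) (auto intro: finite_subset[of _ "{..m}"])
    moreover have "v \<in> ?B" using r by auto
    moreover have "?B \<subseteq> path_interpolation T m -` U"
    proof
      fix w assume "w \<in> ?B"
      from PiE_mem[OF this] have "\<bar>v j - w j\<bar> \<le> r" if "j \<le> m" for j
        using that by (force simp: dist_real_def split: if_splits)
      then show "w \<in> path_interpolation T m -` U"
        by (auto intro!: r(2) path_interpolation_mspace path_interpolation_dist[OF T])
    qed
    ultimately show "\<exists>S. open S \<and> v \<in> S \<and> S \<subseteq> path_interpolation T m -` U" by blast
  qed
  then show "path_interpolation T m -` U \<inter> space (PiM UNIV (\<lambda>_. borel)) \<in> sets (PiM UNIV (\<lambda>_. borel))"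
    by (simp add: sets_PiM_equal_borel space_PiM)
qed

lemma path_uniformly_continuous:
  fixes \<alpha> :: "real \<Rightarrow> real"
  assumes "continuous_on {0..T} \<alpha>" "e > 0"
  shows "\<exists>d>0. \<forall>s\<in>{0..T}. \<forall>t\<in>{0..T}. \<bar>s - t\<bar> < d \<longrightarrow> \<bar>\<alpha> s - \<alpha> t\<bar> < e"
proof -
  have "uniformly_continuous_on {0..T} \<alpha>"
    using assms(1) by (intro compact_uniformly_continuous) auto
  then show ?thesis using assms(2) unfolding uniformly_continuous_on_def dist_real_def by blast
qed

text \<open>The threshold \<open>m0\<close> depends on the path and on \<open>e\<close> but not on
  \<open>v\<close> or \<open>\<delta>\<close>. With \<open>\<delta> = 0\<close> this is used for
  interpolating \<open>X\<close> itself, with positive \<open>\<delta>\<close> for the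
  chain.\<close>

lemma path_interpolation_tendsto:
  assumes T: "T > 0" and \<alpha>: "continuous_on {0..T} \<alpha>" and "e > 0"
  shows "\<exists>m0. \<forall>m\<ge>m0. m > 0 \<longrightarrow> (\<forall>v \<delta>. (\<forall>j\<le>m. \<bar>v j - \<alpha> (j * T / m)\<bar> \<le> \<delta>) \<longrightarrow>
    (\<forall>t\<in>{0..T}. \<bar>path_interpolation T m v t - \<alpha> t\<bar> \<le> \<delta> + e))"
proof -
  obtain d where d: "d > 0" "\<And>s t. s \<in> {0..T} \<Longrightarrow> t \<in> {0..T} \<Longrightarrow> \<bar>s - t\<bar> < d \<Longrightarrow> \<bar>\<alpha> s - \<alpha> t\<bar> < e"
    using path_uniformly_continuous[OF \<alpha> \<open>e > 0\<close>] by blast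
  obtain m0 :: nat where m0: "T / d < real m0" using reals_Archimedean2 by blast
  show ?thesis
  proof (intro exI[of _ m0] allI impI ballI)
    fix m :: nat and v :: "nat \<Rightarrow> real" and \<delta> t
    assume m: "m0 \<le> m" "m > 0" and v: "\<forall>j\<le>m. \<bar>v j - \<alpha> (j * T / m)\<bar> \<le> \<delta>" and t: "t \<in> {0..T}"
    have "T / d < real m" using m0 m(1) by linarith
    then have Tm: "T / m < d" using d(1) m(2) by (simp add: field_simps)
    show "\<bar>path_interpolation T m v t - \<alpha> t\<bar> \<le> \<delta> + e"
    proof (rule path_interpolation_error[OF T m(2) t])
      fix j assume j: "j \<le> m" "\<bar>j * T / m - t\<bar> \<le> T / m"
      have "j * T / m \<in> {0..T}" using j(1) T m(2) by (auto simp: field_simps)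
      then have "\<bar>\<alpha> (j * T / m) - \<alpha> t\<bar> < e" using d(2) t j(2) Tm by auto
      moreover have "\<bar>v j - \<alpha> (j * T / m)\<bar> \<le> \<delta>" using v j by blast
      ultimately show "\<bar>v j - \<alpha> t\<bar> \<le> \<delta> + e" by linarith
    qed
  qed
qed

section \<open>The co-monotony principle\<close>

context sde
begin

lemma expectation_bounded_tendsto:
  fixes f :: "nat \<Rightarrow> 'a \<Rightarrow> real"
  assumes "\<And>n. f n \<in> borel_measurable M" "g \<in> borel_measurable M" "\<And>n \<omega>. \<bar>f n \<omega>\<bar> \<le> B"
    and "AE \<omega> in M. (\<lambda>n. f n \<omega>) \<longlonglongrightarrow> g \<omega>"
  shows "(\<lambda>n. expectation (f n)) \<longlonglongrightarrow> expectation g"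
  by (rule integral_dominated_convergence[where w="\<lambda>_. B"]) (use assms in auto)

lemma path_of_mspace: "\<omega> \<in> space M \<Longrightarrow> path_of T X \<omega> \<in> mspace (path_metric T)"
  using X_cont unfolding mspace_path_metric path_of_def continuous_process_def
  by (auto cong: continuous_on_cong_simp)

lemma X_grid_measurable: "i \<le> n \<Longrightarrow> n > 0 \<Longrightarrow> X (real i * T / real n) \<in> borel_measurable M"
  using X_cont grid_mem by (auto simp: continuous_process_def)

lemma measurable_interpolated_process:
  fixes V :: "nat \<Rightarrow> 'a \<Rightarrow> real"
  assumes "m > 0" "\<And>j. V j \<in> borel_measurable M"
  shows "(\<lambda>\<omega>. path_interpolation T m (\<lambda>j. V j \<omega>)) \<in> measurable M (path_borel T)"
proof -
  have "(\<lambda>\<omega> j. V j \<omega>) \<in> measurable M (PiM UNIV (\<lambda>_. borel))"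
    by (rule measurable_PiM_single') (use assms in auto)
  from measurable_compose[OF this measurable_path_interpolation[OF T_pos assms(1)]] show ?thesis .
qed

text \<open>For every outcome the path is the uniform limit of the interpolations of its own grid
  values, each of which involves finitely many coordinates.\<close>

lemma measurable_path_of: "path_of T X \<in> measurable M (path_borel T)"
proof (rule measurable_path_borel_limit)
  let ?V = "\<lambda>m j \<omega>. X (real (min j m) * T / real m) \<omega>"
  show "(\<lambda>\<omega>. path_interpolation T (Suc k) (\<lambda>j. ?V (Suc k) j \<omega>)) \<in> measurable M (path_borel T)" for k
    by (rule measurable_interpolated_process[OF zero_less_Suc X_grid_measurable[OF min.cobounded2 zero_less_Suc]])
  fix \<omega> e assume w: "\<omega> \<in> space M" and e: "e > (0::real)"
  have "continuous_on {0..T} (\<lambda>t. X t \<omega>)" using X_cont w by (simp add: continuous_process_def)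
  from path_interpolation_tendsto[OF T_pos this e] obtain m0 where m0:
    "\<forall>m\<ge>m0. m > 0 \<longrightarrow> (\<forall>v \<delta>. (\<forall>j\<le>m. \<bar>v j - X (real j * T / real m) \<omega>\<bar> \<le> \<delta>) \<longrightarrow>
      (\<forall>t\<in>{0..T}. \<bar>path_interpolation T m v t - X t \<omega>\<bar> \<le> \<delta> + e))" ..
  have "\<bar>path_interpolation T (Suc k) (\<lambda>j. ?V (Suc k) j \<omega>) t - path_of T X \<omega> t\<bar> \<le> e"
    if "k \<ge> m0" "t \<in> {0..T}" for k t
    using m0[rule_format, OF _ zero_less_Suc, of k "\<lambda>j. ?V (Suc k) j \<omega>" 0 t] that
    by (simp add: path_of_def min_absorb1 del: of_nat_Suc)
  then show "\<exists>n0. \<forall>n\<ge>n0. \<forall>t\<in>{0..T}.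
      \<bar>path_interpolation T (Suc n) (\<lambda>j. ?V (Suc n) j \<omega>) t - path_of T X \<omega> t\<bar> \<le> e" by blast
qed (use T_pos path_of_mspace in auto)

text \<open>The scheme is run on a grid of \<open>m N\<close> steps, with \<open>N\<close> depending on \<open>m\<close>, but only its values at the
  \<open>m + 1\<close> coarse points are interpolated, so that convergence in probability at single times suffices.\<close>

lemma correlated_interpolations:
  fixes F G :: "(real \<Rightarrow> real) \<Rightarrow> real"
  assumes m: "m > 0" and e: "e > 0"
    and F: "F \<in> borel_measurable (path_borel T)" "monotone_on (mspace (path_metric T)) (path_le T) (\<le>) F"
       "\<forall>\<alpha>\<in>mspace (path_metric T). \<bar>F \<alpha>\<bar> \<le> A"
    and G: "G \<in> borel_measurable (path_borel T)" "monotone_on (mspace (path_metric T)) (path_le T) (\<le>) G"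
       "\<forall>\<alpha>\<in>mspace (path_metric T). \<bar>G \<alpha>\<bar> \<le> B"
  shows "\<exists>V :: nat \<Rightarrow> 'a \<Rightarrow> real. (\<forall>j. V j \<in> borel_measurable M) \<and>
    prob {\<omega> \<in> space M. \<exists>j\<le>m. \<bar>V j \<omega> - X (real j * T / real m) \<omega>\<bar> > e} \<le> e \<and>
    positively_correlated (\<lambda>\<omega>. path_interpolation T m (\<lambda>j. V j \<omega>)) F G"
proof -
  \<comment> \<open>The level is divided for the union bound over the \<open>m + 1\<close> coarse
    nodes.\<close>
  have "e / (real m + 1) > 0" using e by simp
  from monotone_scheme_approximation[OF e this] obtain n0 :: nat where n0: "\<forall>n\<ge>n0. n > 0 \<longrightarrow> (\<exists>Y :: nat \<Rightarrow> 'a \<Rightarrow> real.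
    (\<forall>i\<le>n. Y i \<in> borel_measurable M) \<and>
    (\<forall>i\<le>n. prob {\<omega> \<in> space M. \<bar>Y i \<omega> - X (real i * T / n) \<omega>\<bar> > e} \<le> e / (real m + 1)) \<and>
    (\<forall>F G A B. F \<in> borel_measurable (PiM UNIV (\<lambda>_. borel)) \<and> mono F \<and> (\<forall>s. \<bar>F s\<bar> \<le> A) \<and>
       G \<in> borel_measurable (PiM UNIV (\<lambda>_. borel)) \<and> mono G \<and> (\<forall>s. \<bar>G s\<bar> \<le> B) \<longrightarrow>
       positively_correlated (\<lambda>\<omega> j. Y (min j n) \<omega>) F G))"
    ..
  define k where "k = Suc n0"
  define n where "n = m * k"
  have k: "k > 0" by (simp add: k_def)
  have n: "n \<ge> n0" "n > 0" using m by (cases m; simp add: n_def k_def)+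
  obtain Y :: "nat \<Rightarrow> 'a \<Rightarrow> real" where Ym: "\<forall>i\<le>n. Y i \<in> borel_measurable M"
    and Yp: "\<forall>i\<le>n. prob {\<omega> \<in> space M. \<bar>Y i \<omega> - X (real i * T / n) \<omega>\<bar> > e} \<le> e / (real m + 1)"
    and Yc: "\<forall>F G A B. F \<in> borel_measurable (PiM UNIV (\<lambda>_. borel)) \<and> mono F \<and> (\<forall>s. \<bar>F s\<bar> \<le> A) \<and>
       G \<in> borel_measurable (PiM UNIV (\<lambda>_. borel)) \<and> mono G \<and> (\<forall>s. \<bar>G s\<bar> \<le> B) \<longrightarrow>
       positively_correlated (\<lambda>\<omega> j. Y (min j n) \<omega>) F G"
    using n0[rule_format, OF n] by (elim exE conjE) (rule that)
  \<comment> \<open>The \<open>min\<close> matters only beyond the last node, where it keeps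
    \<open>V j\<close> among the states known to be measurable.\<close>
  define V where "V j = Y (min (j * k) n)" for j
  have Vm: "V j \<in> borel_measurable M" for j using Ym by (simp add: V_def)
  have jk: "j * k \<le> n" if "j \<le> m" for j using that by (simp add: n_def)
  have tj: "real (j * k) * T / real n = real j * T / real m" for j
    using k m by (simp add: n_def divide_simps)
  have "prob {\<omega> \<in> space M. \<exists>j\<le>m. \<bar>V j \<omega> - X (real j * T / real m) \<omega>\<bar> > e} \<le> e"
  proof -
    have ev: "{\<omega> \<in> space M. \<bar>V j \<omega> - X (real j * T / real m) \<omega>\<bar> > e} \<in> events" if "j \<le> m" for j
    proof -
      have [measurable]: "V j \<in> borel_measurable M" "X (real j * T / real m) \<in> borel_measurable M"
        using Vm X_grid_measurable[OF that m] by auto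
      show ?thesis by measurable
    qed
    have "{\<omega> \<in> space M. \<exists>j\<le>m. \<bar>V j \<omega> - X (real j * T / real m) \<omega>\<bar> > e} =
        (\<Union>j\<le>m. {\<omega> \<in> space M. \<bar>V j \<omega> - X (real j * T / real m) \<omega>\<bar> > e})" by auto
    also have "prob \<dots> \<le> (\<Sum>j\<le>m. prob {\<omega> \<in> space M. \<bar>V j \<omega> - X (real j * T / real m) \<omega>\<bar> > e})"
      by (rule finite_measure_subadditive_finite) (use ev in auto)
    also have "\<dots> \<le> (\<Sum>j\<le>m. e / (real m + 1))"
    proof (rule sum_mono)
      fix j assume "j \<in> {..m}"
      then show "prob {\<omega> \<in> space M. \<bar>V j \<omega> - X (real j * T / real m) \<omega>\<bar> > e} \<le> e / (real m + 1)"
        using Yp[rule_format, OF jk[of j]] jk[of j] unfolding tj by (simp add: V_def min_absorb1)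
    qed
    also have "\<dots> = e"
    proof -
      have "real m + 1 \<noteq> 0" by linarith
      then show ?thesis by (simp add: add.commute[of 1 "real m"])
    qed
    finally show ?thesis .
  qed
  moreover have "positively_correlated (\<lambda>\<omega>. path_interpolation T m (\<lambda>j. V j \<omega>)) F G"
  proof -
    \<comment> \<open>Sampling every \<open>k\<close>-th state and interpolating preserve order, so
      \<open>P\<close> pulls a monotone functional of paths back to one of the fine chain.\<close>
    define P where "P s = path_interpolation T m (\<lambda>j. s (j * k))" for s :: "nat \<Rightarrow> real"
    have "(\<lambda>s j. s (j * k)) \<in> measurable (PiM UNIV (\<lambda>_. borel)) (PiM UNIV (\<lambda>_. borel :: real measure))"
      by (rule measurable_PiM_single') auto
    from measurable_compose[OF this measurable_path_interpolation[OF T_pos m]]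
    have Pm: "P \<in> measurable (PiM UNIV (\<lambda>_. borel)) (path_borel T)" unfolding P_def .
    have P_mono: "mono (\<lambda>s. H (P s))" if "monotone_on (mspace (path_metric T)) (path_le T) (\<le>) H" for H :: "_ \<Rightarrow> real"
    proof (rule monoI)
      fix s s' :: "nat \<Rightarrow> real" assume "s \<le> s'"
      then have "path_le T (P s) (P s')" unfolding P_def by (intro path_interpolation_mono) (auto simp: le_fun_def)
      then show "H (P s) \<le> H (P s')"
        by (rule monotone_onD[OF that, rotated 2]) (simp_all add: P_def path_interpolation_mspace)
    qed
    have bnd: "\<bar>H (P s)\<bar> \<le> D" if "\<forall>\<alpha>\<in>mspace (path_metric T). \<bar>H \<alpha>\<bar> \<le> D" for H :: "_ \<Rightarrow> real" and D s
      using that by (simp add: P_def path_interpolation_mspace)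
    have "positively_correlated (\<lambda>\<omega> j. Y (min j n) \<omega>) (\<lambda>s. F (P s)) (\<lambda>s. G (P s))"
    proof (rule Yc[rule_format, of _ A _ B], intro conjI allI)
      show "(\<lambda>s. F (P s)) \<in> borel_measurable (PiM UNIV (\<lambda>_. borel))" "(\<lambda>s. G (P s)) \<in> borel_measurable (PiM UNIV (\<lambda>_. borel))"
        using measurable_compose[OF Pm F(1)] measurable_compose[OF Pm G(1)] .
    qed (rule P_mono[OF F(2)] P_mono[OF G(2)] bnd[OF F(3)] bnd[OF G(3)])+
    moreover have "P (\<lambda>j. Y (min j n) \<omega>) = path_interpolation T m (\<lambda>j. V j \<omega>)" for \<omega>
      by (simp add: P_def V_def)
    ultimately show ?thesis by (simp add: positively_correlated_def)
  qed
  ultimately show ?thesis by (intro exI[of _ V] conjI allI Vm)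
qed

text \<open>The interpolated chains converge uniformly to the path of \<open>X\<close> almost
  surely, and almost every path of \<open>X\<close> is a continuity point of both functionals.
  Continuity at the limit alone gives convergence of the values, wherever the approximating paths
  lie, and boundedness gives convergence of the expectations.\<close>

lemma monotone_functionals_correlated:
  assumes F: "admissible_functional T (path_law M T X) F" "monotone_on (mspace (path_metric T)) (path_le T) (\<le>) F"
    and G: "admissible_functional T (path_law M T X) G" "monotone_on (mspace (path_metric T)) (path_le T) (\<le>) G"
  shows "positively_correlated (path_of T X) F G"
proof -
  have bounded: "\<exists>A. \<forall>\<alpha>\<in>mspace (path_metric T). \<bar>H \<alpha>\<bar> \<le> A"
    if "admissible_functional T (path_law M T X) H" for H
  proof -
    have "bounded (H ` mspace (path_metric T))" using that by (simp only: admissible_functional_def)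
    then show ?thesis by (simp add: bounded_iff)
  qed
  obtain A where A: "\<forall>\<alpha>\<in>mspace (path_metric T). \<bar>F \<alpha>\<bar> \<le> A" using bounded[OF F(1)] ..
  obtain B where B: "\<forall>\<alpha>\<in>mspace (path_metric T). \<bar>G \<alpha>\<bar> \<le> B" using bounded[OF G(1)] ..
  have Fm: "F \<in> borel_measurable (path_borel T)" and Gm: "G \<in> borel_measurable (path_borel T)"
    using F(1) G(1) by (simp_all only: admissible_functional_def)
  have ae: "AE \<omega> in M. topcontinuous_at (mtopology_of (path_metric T)) euclideanreal H (path_of T X \<omega>)"
    if "admissible_functional T (path_law M T X) H" for H
  proof (rule AE_distrD[OF measurable_path_of])
    show "AE \<alpha> in distr M (path_borel T) (path_of T X). topcontinuous_at (mtopology_of (path_metric T)) euclideanreal H \<alpha>"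
      using that by (simp only: admissible_functional_def as_continuous_def path_law_def)
  qed
  \<comment> \<open>Serves both as tolerance, since it tends to zero, and as probability bound,
    since it is summable.\<close>
  define e where "e k = (1 / 2 :: real) ^ k" for k
  have e0: "e k > 0" for k by (simp add: e_def)
  have "\<forall>k. \<exists>V :: nat \<Rightarrow> 'a \<Rightarrow> real. (\<forall>j. V j \<in> borel_measurable M) \<and>
    prob {\<omega> \<in> space M. \<exists>j\<le>Suc k. \<bar>V j \<omega> - X (real j * T / real (Suc k)) \<omega>\<bar> > e k} \<le> e k \<and>
    positively_correlated (\<lambda>\<omega>. path_interpolation T (Suc k) (\<lambda>j. V j \<omega>)) F G"
    by (rule allI) (rule correlated_interpolations[OF zero_less_Suc e0 Fm F(2) A Gm G(2) B])
  from choice[OF this] obtain V :: "nat \<Rightarrow> nat \<Rightarrow> 'a \<Rightarrow> real" where V: "\<forall>k. (\<forall>j. V k j \<in> borel_measurable M) \<and>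
    prob {\<omega> \<in> space M. \<exists>j\<le>Suc k. \<bar>V k j \<omega> - X (real j * T / real (Suc k)) \<omega>\<bar> > e k} \<le> e k \<and>
    positively_correlated (\<lambda>\<omega>. path_interpolation T (Suc k) (\<lambda>j. V k j \<omega>)) F G" ..
  have Vm: "V k j \<in> borel_measurable M" for k j using V by blast
  define U where "U k \<omega> = path_interpolation T (Suc k) (\<lambda>j. V k j \<omega>)" for k \<omega>
  have U_eq: "U k = (\<lambda>\<omega>. path_interpolation T (Suc k) (\<lambda>j. V k j \<omega>))" for k by (rule ext) (rule U_def)
  have Um: "U k \<in> measurable M (path_borel T)" for k
    unfolding U_eq by (rule measurable_interpolated_process[OF zero_less_Suc Vm])
  have corr: "positively_correlated (U k) F G" for k
    unfolding U_eq by (rule conjunct2[OF conjunct2[OF spec[OF V]]])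
  have U_space: "U k \<omega> \<in> mspace (path_metric T)" for k \<omega> unfolding U_def by (rule path_interpolation_mspace)
  define N where "N k = {\<omega> \<in> space M. \<exists>j\<le>Suc k. \<bar>V k j \<omega> - X (real j * T / real (Suc k)) \<omega>\<bar> > e k}" for k
  have N_ev: "N k \<in> events" for k
  proof -
    have "{\<omega> \<in> space M. \<exists>j\<in>{..Suc k}. \<bar>V k j \<omega> - X (real j * T / real (Suc k)) \<omega>\<bar> > e k} \<in> events"
    proof (rule sets.sets_Collect_finite_Ex)
      fix j assume "j \<in> {..Suc k}"
      then have [measurable]: "X (real j * T / real (Suc k)) \<in> borel_measurable M" "V k j \<in> borel_measurable M"
        by (auto intro: X_grid_measurable[OF _ zero_less_Suc] Vm simp del: of_nat_Suc)
      show "{\<omega> \<in> space M. \<bar>V k j \<omega> - X (real j * T / real (Suc k)) \<omega>\<bar> > e k} \<in> events" by measurable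
    qed simp
    moreover have "N k = {\<omega> \<in> space M. \<exists>j\<in>{..Suc k}. \<bar>V k j \<omega> - X (real j * T / real (Suc k)) \<omega>\<bar> > e k}"
      unfolding N_def Bex_def atMost_iff by (rule refl)
    ultimately show ?thesis by (simp only:)
  qed
  have N_prob: "prob (N k) \<le> e k" for k
    unfolding N_def by (rule conjunct1[OF conjunct2[OF spec[OF V]]])
  have ae_N: "AE \<omega> in M. \<forall>\<^sub>F k in sequentially. \<omega> \<in> space M - N k"
  proof (rule borel_cantelli_AE1[OF N_ev])
    have "summable e" unfolding e_def[abs_def] by (rule summable_geometric) simp
    then show "summable (\<lambda>k. prob (N k))"
      by (rule summable_comparison_test'[of e 0]) (use N_prob in auto)
    show "emeasure M (N k) < \<infinity>" for k by (simp add: less_top[symmetric])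
  qed
  have near: "\<forall>\<^sub>F k in sequentially. \<forall>t\<in>{0..T}. \<bar>path_of T X \<omega> t - U k \<omega> t\<bar> \<le> \<eta>"
    if w: "\<omega> \<in> space M" and ev: "\<forall>\<^sub>F k in sequentially. \<omega> \<in> space M - N k" and \<eta>: "\<eta> > 0" for \<omega> \<eta>
  proof -
    have "continuous_on {0..T} (\<lambda>t. X t \<omega>)" using X_cont w by (simp add: continuous_process_def)
    from path_interpolation_tendsto[OF T_pos this half_gt_zero[OF \<eta>]] obtain m0 where m0:
      "\<forall>m\<ge>m0. m > 0 \<longrightarrow> (\<forall>v \<delta>. (\<forall>j\<le>m. \<bar>v j - X (real j * T / real m) \<omega>\<bar> \<le> \<delta>) \<longrightarrow>
        (\<forall>t\<in>{0..T}. \<bar>path_interpolation T m v t - X t \<omega>\<bar> \<le> \<delta> + \<eta> / 2))" ..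
    have "e \<longlonglongrightarrow> 0" unfolding e_def[abs_def] by (rule LIMSEQ_realpow_zero) auto
    then have "\<forall>\<^sub>F k in sequentially. e k < \<eta> / 2" by (rule order_tendstoD) (use \<eta> in simp)
    then show ?thesis using ev eventually_ge_at_top[of m0]
    proof eventually_elim
      case (elim k)
      have "\<omega> \<notin> N k" using elim(2) by blast
      then have VK: "\<forall>j\<le>Suc k. \<bar>V k j \<omega> - X (real j * T / real (Suc k)) \<omega>\<bar> \<le> e k"
        unfolding N_def using w by (simp only: mem_Collect_eq simp_thms not_ex de_Morgan_conj not_less imp_conv_disj)
      have "Suc k \<ge> m0" using elim(3) by (rule le_SucI)
      from mp[OF spec[OF spec[OF mp[OF mp[OF spec[OF m0] this] zero_less_Suc]]] VK]
      have UX: "\<forall>t\<in>{0..T}. \<bar>U k \<omega> t - X t \<omega>\<bar> \<le> e k + \<eta> / 2" unfolding U_def .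
      show ?case
      proof
        fix t assume t: "t \<in> {0..T}"
        have "path_of T X \<omega> t = X t \<omega>" unfolding path_of_def using t by (rule restrict_apply')
        then show "\<bar>path_of T X \<omega> t - U k \<omega> t\<bar> \<le> \<eta>" using bspec[OF UX t] elim(1) by linarith
      qed
    qed
  qed
  have conv: "AE \<omega> in M. (\<lambda>k. H (U k \<omega>)) \<longlonglongrightarrow> H (path_of T X \<omega>)"
    if H: "admissible_functional T (path_law M T X) H" for H
    using ae[OF H] ae_N AE_space
  proof eventually_elim
    case (elim \<omega>)
    show ?case
    proof (rule LIMSEQ_I)
      fix r :: real assume "r > 0"
      obtain \<eta> where \<eta>: "\<eta> > 0" "\<forall>\<beta>\<in>mspace (path_metric T). (\<forall>t\<in>{0..T}. \<bar>path_of T X \<omega> t - \<beta> t\<bar> \<le> \<eta>) \<longrightarrow> \<bar>H \<beta> - H (path_of T X \<omega>)\<bar> < r"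
        using topcontinuous_at_pathD[OF less_imp_le[OF T_pos] elim(1) \<open>r > 0\<close>] by (elim exE conjE) (rule that)
      have "\<forall>\<^sub>F k in sequentially. \<bar>H (U k \<omega>) - H (path_of T X \<omega>)\<bar> < r"
        using near[OF elim(3,2) \<eta>(1)]
      proof eventually_elim
        case (elim k)
        then show ?case by (rule mp[OF bspec[OF \<eta>(2) U_space]])
      qed
      then show "\<exists>n0. \<forall>k\<ge>n0. norm (H (U k \<omega>) - H (path_of T X \<omega>)) < r"
        by (simp add: eventually_sequentially)
    qed
  qed
  have FX: "(\<lambda>\<omega>. F (path_of T X \<omega>)) \<in> borel_measurable M" "(\<lambda>\<omega>. G (path_of T X \<omega>)) \<in> borel_measurable M"
    "\<And>k. (\<lambda>\<omega>. F (U k \<omega>)) \<in> borel_measurable M" "\<And>k. (\<lambda>\<omega>. G (U k \<omega>)) \<in> borel_measurable M"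
    using measurable_compose[OF measurable_path_of Fm] measurable_compose[OF measurable_path_of Gm]
      measurable_compose[OF Um Fm] measurable_compose[OF Um Gm] by auto
  have FU: "\<bar>F (U k \<omega>)\<bar> \<le> A" "\<bar>G (U k \<omega>)\<bar> \<le> B" for k \<omega>
    by (rule bspec[OF A U_space], rule bspec[OF B U_space])
  have A0: "A \<ge> 0" using FU(1)[of 0 undefined] by linarith
  have l1: "(\<lambda>k. expectation (\<lambda>\<omega>. F (U k \<omega>))) \<longlonglongrightarrow> expectation (\<lambda>\<omega>. F (path_of T X \<omega>))"
    by (rule expectation_bounded_tendsto[OF FX(3,1) FU(1) conv[OF F(1)]])
  have l2: "(\<lambda>k. expectation (\<lambda>\<omega>. G (U k \<omega>))) \<longlonglongrightarrow> expectation (\<lambda>\<omega>. G (path_of T X \<omega>))"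
    by (rule expectation_bounded_tendsto[OF FX(4,2) FU(2) conv[OF G(1)]])
  have l3: "(\<lambda>k. expectation (\<lambda>\<omega>. F (U k \<omega>) * G (U k \<omega>))) \<longlonglongrightarrow> expectation (\<lambda>\<omega>. F (path_of T X \<omega>) * G (path_of T X \<omega>))"
  proof (rule expectation_bounded_tendsto)
    show "\<bar>F (U k \<omega>) * G (U k \<omega>)\<bar> \<le> A * B" for k \<omega>
      unfolding abs_mult using FU A0 by (intro mult_mono) auto
    show "AE \<omega> in M. (\<lambda>k. F (U k \<omega>) * G (U k \<omega>)) \<longlonglongrightarrow> F (path_of T X \<omega>) * G (path_of T X \<omega>)"
      using conv[OF F(1)] conv[OF G(1)] by eventually_elim (rule tendsto_mult)
  qed (use FX in auto)
  have "expectation (\<lambda>\<omega>. F (path_of T X \<omega>)) * expectation (\<lambda>\<omega>. G (path_of T X \<omega>)) \<le>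
      expectation (\<lambda>\<omega>. F (path_of T X \<omega>) * G (path_of T X \<omega>))"
    by (rule LIMSEQ_le[OF tendsto_mult[OF l1 l2] l3]) (use corr in \<open>auto simp: positively_correlated_def\<close>)
  then show ?thesis by (simp add: positively_correlated_def)
qed

lemma admissible_functional_uminus:
  assumes "admissible_functional T P F" shows "admissible_functional T P (\<lambda>\<alpha>. - F \<alpha>)"
proof -
  have neg: "topcontinuous_at (mtopology_of (path_metric T)) euclideanreal (\<lambda>\<alpha>. - F \<alpha>) \<alpha>"
    if "topcontinuous_at (mtopology_of (path_metric T)) euclideanreal F \<alpha>" for \<alpha>
    unfolding topcontinuous_at_def
  proof (intro conjI allI impI)
    show "\<alpha> \<in> topspace (mtopology_of (path_metric T))" using that unfolding topcontinuous_at_def by (rule conjunct1)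
    show "(\<lambda>\<alpha>. - F \<alpha>) \<in> topspace (mtopology_of (path_metric T)) \<rightarrow> topspace euclideanreal" by simp
    fix V :: "real set" assume "openin euclideanreal V \<and> - F \<alpha> \<in> V"
    then have V: "openin euclideanreal (uminus -` V) \<and> F \<alpha> \<in> uminus -` V"
      using open_vimage[of V uminus, OF _ continuous_on_minus[OF continuous_on_id]] by simp
    from that have "\<forall>V. openin euclideanreal V \<and> F \<alpha> \<in> V \<longrightarrow>
        (\<exists>U. openin (mtopology_of (path_metric T)) U \<and> \<alpha> \<in> U \<and> (\<forall>y\<in>U. F y \<in> V))"
      unfolding topcontinuous_at_def by (elim conjE)
    from mp[OF spec[OF this] V]
    obtain U where "openin (mtopology_of (path_metric T)) U \<and> \<alpha> \<in> U \<and> (\<forall>y\<in>U. F y \<in> uminus -` V)" ..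
    then show "\<exists>U. openin (mtopology_of (path_metric T)) U \<and> \<alpha> \<in> U \<and> (\<forall>y\<in>U. - F y \<in> V)"
      unfolding vimage_eq by (rule exI)
  qed
  have "F \<in> borel_measurable (path_borel T)" "bounded (F ` mspace (path_metric T))" "as_continuous T P F"
    using assms by (simp_all only: admissible_functional_def)
  moreover from this(2) have "bounded ((\<lambda>\<alpha>. - F \<alpha>) ` mspace (path_metric T))"
    by (simp add: bounded_iff)
  moreover from calculation(3) have "as_continuous T P (\<lambda>\<alpha>. - F \<alpha>)"
    unfolding as_continuous_def by eventually_elim (rule neg)
  ultimately show ?thesis unfolding admissible_functional_def by (intro conjI borel_measurable_uminus)
qed

theorem solution_functional_co_monotony: "functional_co_monotony M T X"
  unfolding functional_co_monotony_def
proof (intro allI impI, elim conjE)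
  fix F G assume F: "admissible_functional T (path_law M T X) F" and G: "admissible_functional T (path_law M T X) G"
    and co: "co_monotone T F G"
  from co consider
    "monotone_on (mspace (path_metric T)) (path_le T) (\<le>) F" "monotone_on (mspace (path_metric T)) (path_le T) (\<le>) G" |
    "monotone_on (mspace (path_metric T)) (path_le T) (\<ge>) F" "monotone_on (mspace (path_metric T)) (path_le T) (\<ge>) G"
    unfolding co_monotone_def by blast
  then have "positively_correlated (path_of T X) F G"
  proof cases
    case 1
    then show ?thesis by (intro monotone_functionals_correlated F G)
  next
    case 2
    \<comment> \<open>Negating both functionals reverses their monotonicity and leaves the
      covariance unchanged.\<close>
    then have "positively_correlated (path_of T X) (\<lambda>\<alpha>. - F \<alpha>) (\<lambda>\<alpha>. - G \<alpha>)"
      by (intro monotone_functionals_correlated admissible_functional_uminus F G) (auto simp: monotone_on_def)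
    then show ?thesis by (simp add: positively_correlated_def)
  qed
  then show "expectation (\<lambda>\<omega>. F (path_of T X \<omega>)) * expectation (\<lambda>\<omega>. G (path_of T X \<omega>)) \<le>
      expectation (\<lambda>\<omega>. F (path_of T X \<omega>) * G (path_of T X \<omega>))"
    by (simp add: positively_correlated_def)
qed

end

theorem mainTheorem8:
  fixes M :: "'a measure"
    and T x :: real
    and W X :: "real \<Rightarrow> 'a \<Rightarrow> real"
    and b \<sigma> :: "real \<Rightarrow> real \<Rightarrow> real"
    and \<rho> :: "real \<Rightarrow> real"
  assumes "prob_space M"
    and "T > 0"
    and "standard_brownian_motion M T W"
    and "continuous_on ({0..T} \<times> UNIV) (\<lambda>(t, y). b t y)"
    and "\<exists>L. \<forall>t\<in>{0..T}. L-lipschitz_on UNIV (b t)"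
    and "continuous_on ({0..T} \<times> UNIV) (\<lambda>(t, y). \<sigma> t y)"
    and "\<exists>C. \<forall>t\<in>{0..T}. \<forall>y. \<bar>\<sigma> t y\<bar> \<le> C * (1 + \<bar>y\<bar>)"
    and "\<forall>y z. \<forall>t\<in>{0..T}. \<bar>\<sigma> t y - \<sigma> t z\<bar> \<le> \<rho> \<bar>y - z\<bar>"
    and "strict_mono \<rho>"
    and "\<rho> 0 = 0"
    and "\<forall>\<epsilon>>0. (\<integral>\<^sup>+u\<in>{0<..<\<epsilon>}. ennreal (1 / (\<rho> u)\<^sup>2) \<partial>lborel) = \<infinity>"
    and "strong_solution M T W b \<sigma> x X"
  shows "functional_co_monotony M T X"
proof -
  obtain L where L: "\<forall>t\<in>{0..T}. L-lipschitz_on UNIV (b t)" using assms(5) ..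
  have L0: "L \<ge> 0" using L assms(2) lipschitz_on_nonneg[of L UNIV "b 0"] by simp
  have b_lip: "\<bar>b t y - b t z\<bar> \<le> L * \<bar>y - z\<bar>" if "t \<in> {0..T}" for t y z
    using lipschitz_onD[OF L[rule_format, OF that], of y z] by (simp add: dist_real_def)
  interpret prob_space M by fact
  interpret sde M T W x L b \<sigma> \<rho> X
  proof unfold_locales
    show "sde_solution M (brownian_filtration M W) T W b \<sigma> x X" using assms(12) by (simp add: strong_solution_def)
    show "\<And>t y z. t \<in> {0..T} \<Longrightarrow> \<bar>\<sigma> t y - \<sigma> t z\<bar> \<le> \<rho> \<bar>y - z\<bar>" using assms(8) by blast
  qed (fact assms L0 b_lip)+
  show ?thesis by (rule solution_functional_co_monotony)
qed

end
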